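(* Let $0<\alpha<1$ and let $\Omega\in L(\log L)^{\frac1{n'}}(\mathbb S^{n-1})$ have mean zero. Let $$n<p<\frac n\alpha,\qquad\frac1q=\frac1p-\frac\alpha n,\qquad\alpha-\frac np<\lambda<1-\frac np.$$ Then there is a constant $C$ such that for all $f\in C_c^\infty(\mathbb R^n)$ $$\Big(\int_{\mathbb R^n}\big(|x|^\lambda|T_{\Omega,\alpha}f(x)|\big)^q\,dx\Big)^{\frac1q}\le C\Big(\int_{\mathbb R^n}\big(|x|^\lambda|\nabla f(x)|\big)^p\,dx\Big)^{\frac1p}.$$
   Context: $n$ is a positive integer and $\frac1{n'}=1-\frac1n$. $\sigma=\mathcal H^{n-1}$ is surface measure on $\mathbb S^{n-1}$; "mean zero" means $\int_{\mathbb S^{n-1}}\Omega\,d\sigma=0$. $L(\log L)^{\frac1{n'}}(\mathbb S^{n-1})$ is the Orlicz space on $(\mathbb S^{n-1},\sigma)$ associated with $\Psi(t)=t\,(\log(1+t))^{\frac1{n'}}$. $T_{\Omega,\alpha}f(x)=\mathrm{p.v.}\int_{\mathbb R^n}\frac{\Omega(y')}{|y|^{n+1-\alpha}}f(x-y)\,dy=\lim_{\varepsilon\to0^+}\int_{|y|>\varepsilon}\frac{\Omega(y')}{|y|^{n+1-\alpha}}f(x-y)\,dy$, with $y'=y/|y|$. *)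

theory Defs
  imports "HOL-Analysis.Analysis"
begin

section \<open>Hausdorff measure\<close>

text \<open>
  The normalisation \<open>unit_ball_vol d * (diameter U / 2) ^ d\<close> makes the \<open>d\<close>-dimensional Hausdorff
  measure agree with Lebesgue measure in dimension \<open>d\<close>.  The case distinction matters only for
  \<open>d = 0\<close>: with \<open>0 ^ 0 = 1\<close> points get weight one, the empty set must get weight zero, and one
  obtains counting measure.
\<close>

definition hausdorff_gauge :: "nat \<Rightarrow> 'a::metric_space set \<Rightarrow> ennreal" where
  "hausdorff_gauge d U =
     (if U = {} then 0 else ennreal (unit_ball_vol (real d) * (diameter U / 2) ^ d))"

definition hausdorff_pre :: "nat \<Rightarrow> real \<Rightarrow> 'a::metric_space set \<Rightarrow> ennreal" where
  "hausdorff_pre d \<delta> A =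
     (INF U\<in>{U :: nat \<Rightarrow> 'a set. A \<subseteq> (\<Union>i. U i) \<and> (\<forall>i. bounded (U i) \<and> diameter (U i) \<le> \<delta>)}.
        \<Sum>i. hausdorff_gauge d (U i))"

definition hausdorff_outer :: "nat \<Rightarrow> 'a::metric_space set \<Rightarrow> ennreal" where
  "hausdorff_outer d A = (SUP \<delta>\<in>{0<..}. hausdorff_pre d \<delta> A)"

definition hausdorff_measure :: "nat \<Rightarrow> 'a::metric_space measure" where
  "hausdorff_measure d = measure_of UNIV (sets borel) (hausdorff_outer d)"

text \<open>
  \<^const>\<open>measure_of\<close> silently yields the null measure unless the given set function is countably
  additive, so we check that it is.
\<close>

lemma hausdorff_pre_empty: "0 < \<delta> \<Longrightarrow> hausdorff_pre d \<delta> {} = 0"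
  unfolding hausdorff_pre_def le_zero_eq[symmetric]
  by (rule INF_lower2[of "\<lambda>_. {}"]) (auto simp: hausdorff_gauge_def)

lemma hausdorff_pre_mono: "A \<subseteq> B \<Longrightarrow> hausdorff_pre d \<delta> A \<le> hausdorff_pre d \<delta> B"
  unfolding hausdorff_pre_def by (rule INF_superset_mono) auto

lemma hausdorff_pre_antimono: "\<delta> \<le> \<epsilon> \<Longrightarrow> hausdorff_pre d \<epsilon> A \<le> hausdorff_pre d \<delta> A"
  unfolding hausdorff_pre_def by (rule INF_superset_mono) (auto intro: order_trans)

lemma hausdorff_pre_le_outer: "0 < \<delta> \<Longrightarrow> hausdorff_pre d \<delta> A \<le> hausdorff_outer d A"
  unfolding hausdorff_outer_def by (rule SUP_upper) simp

lemma hausdorff_outer_mono: "A \<subseteq> B \<Longrightarrow> hausdorff_outer d A \<le> hausdorff_outer d B"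
  unfolding hausdorff_outer_def by (rule SUP_mono) (auto intro: hausdorff_pre_mono)

lemma hausdorff_outer_empty: "hausdorff_outer d {} = 0"
  unfolding hausdorff_outer_def by (simp add: hausdorff_pre_empty)

lemma hausdorff_pre_countable_subadditive:
  fixes A :: "nat \<Rightarrow> 'a::metric_space set"
  shows "hausdorff_pre d \<delta> (\<Union>i. A i) \<le> (\<Sum>i. hausdorff_pre d \<delta> (A i))"
proof (rule ennreal_le_epsilon)
  fix e :: real
  assume e: "0 < e" and fin: "(\<Sum>i. hausdorff_pre d \<delta> (A i)) < top"
  let ?C = "\<lambda>n U. A n \<subseteq> (\<Union>i. U i) \<and> (\<forall>i. bounded (U i) \<and> diameter (U i) \<le> \<delta>) \<and>
      (\<Sum>i. hausdorff_gauge d (U i)) < hausdorff_pre d \<delta> (A n) + ennreal (e * (1/2) ^ Suc n)"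
  have "\<exists>U :: nat \<Rightarrow> 'a set. ?C n U" for n
  proof -
    have "hausdorff_pre d \<delta> (A n) < top"
      using fin by (meson ennreal_suminf_lessD)
    then have "hausdorff_pre d \<delta> (A n) < hausdorff_pre d \<delta> (A n) + ennreal (e * (1/2) ^ Suc n)"
      using e by (simp add: less_top)
    then show ?thesis
      unfolding hausdorff_pre_def[of d \<delta> "A n"] INF_less_iff by (auto simp: hausdorff_pre_def)
  qed
  then obtain U :: "nat \<Rightarrow> nat \<Rightarrow> 'a set" where U: "\<And>n. ?C n (U n)"
    by metis
  define V where "V k = case_prod U (prod_decode k)" for k
  have "(\<Union>i. A i) \<subseteq> (\<Union>k. V k)"
  proof
    fix x assume "x \<in> (\<Union>i. A i)"
    then obtain i j where "x \<in> U i j" using U by blast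
    then have "x \<in> V (prod_encode (i, j))" by (simp add: V_def)
    then show "x \<in> (\<Union>k. V k)" by blast
  qed
  moreover have "\<forall>k. bounded (V k) \<and> diameter (V k) \<le> \<delta>"
    using U by (simp add: V_def split: prod.split)
  ultimately have "hausdorff_pre d \<delta> (\<Union>i. A i) \<le> (\<Sum>k. hausdorff_gauge d (V k))"
    unfolding hausdorff_pre_def by (intro INF_lower) auto
  also have "\<dots> = (\<Sum>n. \<Sum>i. hausdorff_gauge d (U n i))"
    using suminf_ennreal_2dimen[where f = "\<lambda>p. hausdorff_gauge d (case_prod U p)"
        and g = "\<lambda>n. \<Sum>i. hausdorff_gauge d (U n i)"]
    by (simp add: V_def)
  also have "\<dots> \<le> (\<Sum>n. hausdorff_pre d \<delta> (A n) + ennreal (e * (1/2) ^ Suc n))"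
    using U by (intro suminf_le) (auto intro: less_imp_le)
  also have "\<dots> = (\<Sum>n. hausdorff_pre d \<delta> (A n)) + (\<Sum>n. ennreal (e * (1/2) ^ Suc n))"
    by (subst suminf_add) auto
  also have "(\<Sum>n. ennreal (e * (1/2) ^ Suc n)) = ennreal e"
  proof -
    have "(\<lambda>n. e * (1/2) ^ Suc n) sums (e * 1)"
      by (rule sums_mult[OF power_half_series])
    then show ?thesis
      using e by (subst suminf_ennreal_eq[where x = e]) auto
  qed
  finally show "hausdorff_pre d \<delta> (\<Union>i. A i) \<le> (\<Sum>i. hausdorff_pre d \<delta> (A i)) + ennreal e" .
qed

lemma hausdorff_outer_countable_subadditive:
  "hausdorff_outer d (\<Union>i::nat. A i) \<le> (\<Sum>i. hausdorff_outer d (A i))"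
  unfolding hausdorff_outer_def[of d "\<Union>i. A i"]
proof (rule SUP_least)
  fix \<delta> :: real assume "\<delta> \<in> {0<..}"
  then show "hausdorff_pre d \<delta> (\<Union>i. A i) \<le> (\<Sum>i. hausdorff_outer d (A i))"
    by (intro order_trans[OF hausdorff_pre_countable_subadditive] suminf_le)
       (auto intro: hausdorff_pre_le_outer)
qed

lemma outer_measure_space_hausdorff_outer: "outer_measure_space UNIV (hausdorff_outer d)"
  by (auto simp: outer_measure_space_def positive_def increasing_def countably_subadditive_def
      hausdorff_outer_empty hausdorff_outer_countable_subadditive intro: hausdorff_outer_mono)

lemma hausdorff_outer_Un_le:
  fixes A B :: "'a::metric_space set"
  shows "hausdorff_outer d (A \<union> B) \<le> hausdorff_outer d A + hausdorff_outer d B"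
proof -
  have "countably_subadditive UNIV (hausdorff_outer d :: 'a set \<Rightarrow> ennreal)"
    and "positive UNIV (hausdorff_outer d :: 'a set \<Rightarrow> ennreal)"
    using outer_measure_space_hausdorff_outer by (auto simp: outer_measure_space_def)
  moreover have "ring_of_sets UNIV (UNIV :: 'a set set)"
    using sigma_algebra.axioms(1)[OF sigma_algebra_Pow, of "UNIV :: 'a set"]
    by (simp add: algebra_def)
  ultimately have "subadditive UNIV (hausdorff_outer d :: 'a set \<Rightarrow> ennreal)"
    by (metis ring_of_sets.countably_subadditive_subadditive)
  then have "hausdorff_outer d (A \<union> (B - A)) \<le> hausdorff_outer d A + hausdorff_outer d (B - A)"
    unfolding subadditive_def by blast
  also have "\<dots> \<le> hausdorff_outer d A + hausdorff_outer d B"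
    by (intro add_left_mono hausdorff_outer_mono) auto
  finally show ?thesis by simp
qed

lemma hausdorff_outer_separated:
  fixes A B :: "'a::metric_space set"
  assumes r: "0 < r" and sep: "\<And>x y. x \<in> A \<Longrightarrow> y \<in> B \<Longrightarrow> r \<le> dist x y"
  shows "hausdorff_outer d A + hausdorff_outer d B \<le> hausdorff_outer d (A \<union> B)"
proof -
  have pre: "hausdorff_pre d \<delta> A + hausdorff_pre d \<delta> B \<le> hausdorff_pre d \<delta> (A \<union> B)"
    if \<delta>: "\<delta> < r" for \<delta>
    unfolding hausdorff_pre_def[of d \<delta> "A \<union> B"]
  proof (rule INF_greatest, clarify)
    fix U :: "nat \<Rightarrow> 'a set"
    assume cov: "A \<union> B \<subseteq> (\<Union>i. U i)" and U: "\<forall>i. bounded (U i) \<and> diameter (U i) \<le> \<delta>"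
    define V where "V i = (if U i \<inter> A = {} then {} else U i)" for i
    define W where "W i = (if U i \<inter> B = {} then {} else U i)" for i
    have ne: "U i \<inter> A = {} \<or> U i \<inter> B = {}" for i
    proof (rule ccontr)
      assume "\<not> ?thesis"
      then obtain x y where "x \<in> U i" "x \<in> A" "y \<in> U i" "y \<in> B" by blast
      then have "r \<le> dist x y" "dist x y \<le> diameter (U i)"
        using sep diameter_bounded_bound U by blast+
      then show False using U \<delta> by (meson leD order_trans)
    qed
    have *: "0 \<le> \<delta>" using U diameter_ge_0 order_trans by blast
    have "hausdorff_pre d \<delta> A \<le> (\<Sum>i. hausdorff_gauge d (V i))"
      unfolding hausdorff_pre_def
    proof (rule INF_lower, clarsimp, intro conjI)
      show "A \<subseteq> (\<Union>i. V i)"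
      proof
        fix x assume "x \<in> A"
        moreover from this cov obtain i where "x \<in> U i" by auto
        ultimately have "x \<in> V i" by (auto simp: V_def)
        then show "x \<in> (\<Union>i. V i)" by blast
      qed
      show "\<forall>i. bounded (V i) \<and> diameter (V i) \<le> \<delta>" using U * by (simp add: V_def)
    qed
    moreover have "hausdorff_pre d \<delta> B \<le> (\<Sum>i. hausdorff_gauge d (W i))"
      unfolding hausdorff_pre_def
    proof (rule INF_lower, clarsimp, intro conjI)
      show "B \<subseteq> (\<Union>i. W i)"
      proof
        fix x assume "x \<in> B"
        moreover from this cov obtain i where "x \<in> U i" by auto
        ultimately have "x \<in> W i" by (auto simp: W_def)
        then show "x \<in> (\<Union>i. W i)" by blast
      qed
      show "\<forall>i. bounded (W i) \<and> diameter (W i) \<le> \<delta>" using U * by (simp add: W_def)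
    qed
    ultimately have "hausdorff_pre d \<delta> A + hausdorff_pre d \<delta> B
        \<le> (\<Sum>i. hausdorff_gauge d (V i)) + (\<Sum>i. hausdorff_gauge d (W i))"
      by (rule add_mono)
    also have "\<dots> = (\<Sum>i. hausdorff_gauge d (V i) + hausdorff_gauge d (W i))"
      by (rule suminf_add) auto
    also have "\<dots> \<le> (\<Sum>i. hausdorff_gauge d (U i))"
    proof (rule suminf_le)
      fix i
      show "hausdorff_gauge d (V i) + hausdorff_gauge d (W i) \<le> hausdorff_gauge d (U i)"
        using ne[of i] by (auto simp: V_def W_def hausdorff_gauge_def)
    qed auto
    finally show "hausdorff_pre d \<delta> A + hausdorff_pre d \<delta> B \<le> (\<Sum>i. hausdorff_gauge d (U i))" .
  qed
  have two: "hausdorff_pre d \<delta> A + hausdorff_pre d \<epsilon> B \<le> hausdorff_outer d (A \<union> B)"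
    if "0 < \<delta>" "0 < \<epsilon>" for \<delta> \<epsilon>
  proof -
    define \<eta> where "\<eta> = min (r/2) (min \<delta> \<epsilon>)"
    have \<eta>: "0 < \<eta>" "\<eta> < r" "\<eta> \<le> \<delta>" "\<eta> \<le> \<epsilon>" using r that by (auto simp: \<eta>_def)
    have "hausdorff_pre d \<delta> A + hausdorff_pre d \<epsilon> B \<le> hausdorff_pre d \<eta> A + hausdorff_pre d \<eta> B"
      using \<eta> by (intro add_mono hausdorff_pre_antimono)
    also have "\<dots> \<le> hausdorff_outer d (A \<union> B)"
      using pre[OF \<eta>(2)] hausdorff_pre_le_outer[OF \<eta>(1)] order_trans by blast
    finally show ?thesis .
  qed
  have ne: "{0<..} \<noteq> ({} :: real set)" by auto
  have "hausdorff_outer d A + hausdorff_outer d B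
      = (SUP \<delta>\<in>{0<..}. hausdorff_pre d \<delta> A + (SUP \<epsilon>\<in>{0<..}. hausdorff_pre d \<epsilon> B))"
    unfolding hausdorff_outer_def by (rule ennreal_SUP_add_left[OF ne, symmetric])
  also have "\<dots> = (SUP \<delta>\<in>{0<..}. SUP \<epsilon>\<in>{0<..}. hausdorff_pre d \<delta> A + hausdorff_pre d \<epsilon> B)"
    by (subst ennreal_SUP_add_right[OF ne]) auto
  also have "\<dots> \<le> hausdorff_outer d (A \<union> B)"
    using two by (intro SUP_least) auto
  finally show ?thesis .
qed

lemma hausdorff_outer_closed_split:
  fixes F :: "'a::metric_space set"
  assumes F: "closed F"
  shows "hausdorff_outer d (E \<inter> F) + hausdorff_outer d (E - F) \<le> hausdorff_outer d E"
proof (cases "F = {} \<or> hausdorff_outer d E = top")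
  case True
  then show ?thesis by (auto simp: hausdorff_outer_empty)
next
  case False
  then have F0: "F \<noteq> {}" and fin: "hausdorff_outer d E \<noteq> top" by auto
  let ?H = "hausdorff_outer d"
  define G where "G k = {x \<in> E. 1 / real (Suc k) \<le> infdist x F}" for k
  define S where "S k = G (Suc k) - G k" for k
  have dec: "1 / real (Suc (Suc k)) < 1 / real (Suc k)" for k
    by (simp add: field_simps)
  have Gmono: "G j \<subseteq> G k" if "j \<le> k" for j k
  proof -
    have "1 / real (Suc k) \<le> 1 / real (Suc j)" using that by (simp add: frac_le)
    then show ?thesis by (auto simp: G_def)
  qed
  have GE: "G k \<subseteq> E - F" for k
    using F by (auto simp: G_def)
  have SG: "S k \<subseteq> G (Suc k)" for k by (auto simp: S_def)
  have sepFG: "1 / real (Suc k) \<le> dist x y" if "x \<in> E \<inter> F" "y \<in> G k" for x y k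
    using that infdist_le[of x F y] by (auto simp: G_def dist_commute)
  have bound: "?H (E \<inter> F) + ?H (G k) \<le> ?H E" for k
  proof -
    have "?H (E \<inter> F) + ?H (G k) \<le> ?H (E \<inter> F \<union> G k)"
      by (rule hausdorff_outer_separated[where r = "1 / real (Suc k)"]) (use sepFG in auto)
    also have "\<dots> \<le> ?H E" using GE by (intro hausdorff_outer_mono) auto
    finally show ?thesis .
  qed
  have sepS: "?H (G k) + ?H (S (Suc k)) \<le> ?H (G k \<union> S (Suc k))" for k
  proof (rule hausdorff_outer_separated[where r = "1 / real (Suc k) - 1 / real (Suc (Suc k))"])
    show "0 < 1 / real (Suc k) - 1 / real (Suc (Suc k))" using dec[of k] by simp
    fix x y assume x: "x \<in> G k" and y: "y \<in> S (Suc k)"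
    have "infdist y F < 1 / real (Suc (Suc k))" using y by (auto simp: S_def G_def)
    moreover have "1 / real (Suc k) \<le> infdist x F" using x by (simp add: G_def)
    moreover have "infdist x F \<le> infdist y F + dist x y" by (rule infdist_triangle)
    ultimately show "1 / real (Suc k) - 1 / real (Suc (Suc k)) \<le> dist x y" by linarith
  qed
  have sums: "(\<Sum>i<m. ?H (S (Suc (2 * i + c)))) \<le> ?H (G (2 * m + c))" for m c
  proof (induction m)
    case 0
    then show ?case by simp
  next
    case (Suc m)
    have "(\<Sum>i<Suc m. ?H (S (Suc (2 * i + c))))
        \<le> ?H (G (2 * m + c)) + ?H (S (Suc (2 * m + c)))"
      using Suc.IH by (simp add: add_right_mono)
    also have "\<dots> \<le> ?H (G (2 * m + c) \<union> S (Suc (2 * m + c)))" by (rule sepS)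
    also have "\<dots> \<le> ?H (G (2 * Suc m + c))"
      using Gmono[of "2 * m + c" "2 * Suc m + c"] SG[of "Suc (2 * m + c)"]
      by (intro hausdorff_outer_mono) auto
    finally show ?case .
  qed
  define h where "h k = ?H (S (Suc k))" for k
  have par: "(\<Sum>k<2 * m. h k) = (\<Sum>i<m. h (2 * i)) + (\<Sum>i<m. h (2 * i + 1))" for m
    by (induction m) (simp_all add: ac_simps)
  have "(\<Sum>k<m. h k) \<le> ?H E + ?H E" for m
  proof -
    have "(\<Sum>k<m. h k) \<le> (\<Sum>k<2 * m. h k)" by (rule sum_mono2) auto
    also have "\<dots> \<le> ?H (G (2 * m + 0)) + ?H (G (2 * m + 1))"
      unfolding par unfolding h_def using sums[of 0 m] sums[of 1 m]
      by (intro add_mono) simp_all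
    also have "\<dots> \<le> ?H E + ?H E"
      using GE by (intro add_mono hausdorff_outer_mono) auto
    finally show ?thesis .
  qed
  then have "(\<Sum>k. h k) \<le> ?H E + ?H E"
    by (intro suminf_le_const[OF summableI]) auto
  then have hfin: "(\<Sum>k. h k) \<noteq> top"
    using fin by (auto simp: top_unique)
  define r where "r k = enn2real (h k)" for k
  have "h k \<noteq> top" for k
    using hfin ennreal_suminf_lessD[of h top k] by (auto simp: less_top)
  then have hr: "h = (\<lambda>k. ennreal (r k))"
    by (auto simp: r_def fun_eq_iff less_top)
  have sr: "summable r"
    using hfin unfolding hr by (intro summable_suminf_not_top) (auto simp: r_def)
  have cover: "E - F \<subseteq> G (Suc k) \<union> (\<Union>j. S (Suc (j + k)))" for k
  proof
    fix x assume x: "x \<in> E - F"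
    then have "0 < infdist x F"
      using F F0 by (metis DiffD2 in_closed_iff_infdist_zero infdist_nonneg less_eq_real_def)
    then obtain N where "1 / real (Suc N) < infdist x F"
      using nat_approx_posE by blast
    then have ex: "x \<in> G N" using x by (auto simp: G_def)
    define M where "M = (LEAST N. x \<in> G N)"
    have M: "x \<in> G M" "\<And>j. j < M \<Longrightarrow> x \<notin> G j"
      unfolding M_def using ex by (auto intro: LeastI dest: not_less_Least)
    show "x \<in> G (Suc k) \<union> (\<Union>j. S (Suc (j + k)))"
    proof (cases "M \<le> Suc k")
      case True
      then show ?thesis using M(1) Gmono by blast
    next
      case False
      then obtain j where "M = Suc (Suc (j + k))"
        by (metis add.commute less_imp_Suc_add not_le add_Suc)
      then have "x \<in> S (Suc (j + k))" using M by (auto simp: S_def)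
      then show ?thesis by blast
    qed
  qed
  have main: "?H (E \<inter> F) + ?H (E - F) \<le> ?H E + (\<Sum>j. h (j + k))" for k
  proof -
    have "?H (E - F) \<le> ?H (G (Suc k) \<union> (\<Union>j. S (Suc (j + k))))"
      using cover by (rule hausdorff_outer_mono)
    also have "\<dots> \<le> ?H (G (Suc k)) + (\<Sum>j. h (j + k))"
      unfolding h_def
      by (intro order_trans[OF hausdorff_outer_Un_le] add_left_mono
          hausdorff_outer_countable_subadditive)
    finally have "?H (E \<inter> F) + ?H (E - F) \<le> ?H (E \<inter> F) + (?H (G (Suc k)) + (\<Sum>j. h (j + k)))"
      by (rule add_left_mono)
    also have "\<dots> \<le> ?H E + (\<Sum>j. h (j + k))"
      using bound[of "Suc k"] by (simp add: add.assoc[symmetric] add_right_mono)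
    finally show ?thesis .
  qed
  show ?thesis
  proof (rule ennreal_le_epsilon)
    fix e :: real assume "0 < e"
    then obtain N where "\<And>n. n \<ge> N \<Longrightarrow> norm (\<Sum>i. r (i + n)) < e"
      using suminf_exist_split[OF _ sr] by blast
    then have "norm (\<Sum>i. r (i + N)) < e" by simp
    moreover have "(\<Sum>j. h (j + N)) = ennreal (\<Sum>i. r (i + N))"
      unfolding hr using sr summable_iff_shift[of r N]
      by (intro suminf_ennreal2) (simp_all add: r_def)
    ultimately have "(\<Sum>j. h (j + N)) \<le> ennreal e"
      by (auto intro!: ennreal_leI)
    then show "?H (E \<inter> F) + ?H (E - F) \<le> ?H E + ennreal e"
      using main[of N] by (meson add_left_mono order_trans)
  qed
qed

lemma measure_space_hausdorff:
  "measure_space UNIV (sets (borel :: 'a::metric_space measure)) (hausdorff_outer d)"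
proof -
  interpret U: sigma_algebra "UNIV :: 'a set" UNIV
    using sigma_algebra_Pow[of "UNIV :: 'a set"] by simp
  let ?L = "lambda_system UNIV UNIV (hausdorff_outer d :: 'a set \<Rightarrow> ennreal)"
  have L: "measure_space UNIV ?L (hausdorff_outer d)"
    by (rule U.caratheodory_lemma[OF outer_measure_space_hausdorff_outer])
  then interpret L: sigma_algebra UNIV ?L by (simp add: measure_space_def)
  have closed: "F \<in> ?L" if "closed F" for F :: "'a set"
    unfolding U.lambda_system_eq
  proof (intro CollectI conjI ballI antisym)
    fix E :: "'a set"
    show "hausdorff_outer d (E \<inter> F) + hausdorff_outer d (E - F) \<le> hausdorff_outer d E"
      using that by (rule hausdorff_outer_closed_split)
    show "hausdorff_outer d E \<le> hausdorff_outer d (E \<inter> F) + hausdorff_outer d (E - F)"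
      using hausdorff_outer_Un_le[of d "E \<inter> F" "E - F"] by (simp add: Un_Diff_Int Un_commute)
  qed simp
  have "sets (borel :: 'a measure) \<subseteq> ?L"
    unfolding borel_eq_closed using closed by (auto intro!: L.sigma_sets_subset)
  then show ?thesis
    using L sets.sigma_algebra_axioms[of "borel :: 'a measure"] by (auto intro: measure_down)
qed

lemma space_hausdorff_measure [simp]: "space (hausdorff_measure d) = UNIV"
  and sets_hausdorff_measure [simp, measurable_cong]: "sets (hausdorff_measure d) = sets borel"
  by (simp_all add: hausdorff_measure_def sets.sigma_sets_eq[of borel, simplified])

lemma emeasure_hausdorff_measure:
  "A \<in> sets borel \<Longrightarrow> emeasure (hausdorff_measure d) A = hausdorff_outer d A"
  using measure_space_hausdorff[of d] unfolding hausdorff_measure_def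
  by (intro emeasure_measure_of_sigma) (auto simp: measure_space_def)


section \<open>Function spaces\<close>

text \<open>
  The completion makes \<open>borel_measurable surface_measure\<close> contain all almost-everywhere modifications
  of Borel functions; accordingly, integrals over the whole space are taken with respect to
  \<^const>\<open>lebesgue\<close>.
\<close>

definition surface_measure :: "'a::euclidean_space measure" where
  "surface_measure = completion (restrict_space (hausdorff_measure (DIM('a) - 1)) (sphere 0 1))"

text \<open>
  Elements of the Orlicz space are represented by functions rather than by classes of functions
  modulo null sets.
\<close>

definition orlicz_space :: "'a measure \<Rightarrow> (real \<Rightarrow> real) \<Rightarrow> ('a \<Rightarrow> complex) set" where
  "orlicz_space M \<Psi> =
     {g \<in> borel_measurable M. \<exists>k>0. (\<integral>\<^sup>+x. ennreal (\<Psi> (cmod (g x) / k)) \<partial>M) < \<infinity>}"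

text \<open>
  The space \<open>L(log L)\<^sup>a\<close> on the unit sphere.  Note that \<open>0 powr 0 = 0\<close>, so for \<open>a = 0\<close> the Young
  function is the identity on the nonnegative reals and the space is \<open>L\<^sup>1\<close>.
\<close>

definition L_log_L_sphere :: "real \<Rightarrow> ('a::euclidean_space \<Rightarrow> complex) set" where
  "L_log_L_sphere a = orlicz_space surface_measure (\<lambda>t. t * ln (1 + t) powr a)"

primrec C_k :: "nat \<Rightarrow> ('a::euclidean_space \<Rightarrow> complex) \<Rightarrow> bool" where
  "C_k 0 f \<longleftrightarrow> continuous_on UNIV f"
| "C_k (Suc k) f \<longleftrightarrow> (\<forall>x. f differentiable (at x)) \<and>
     (\<forall>b\<in>Basis. C_k k (\<lambda>x. frechet_derivative f (at x) b))"

definition Cc_infinity :: "('a::euclidean_space \<Rightarrow> complex) set" where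
  "Cc_infinity = {f. (\<forall>k. C_k k f) \<and> compact (closure {x. f x \<noteq> 0})}"

definition gradient :: "(real ^ 'n \<Rightarrow> complex) \<Rightarrow> real ^ 'n \<Rightarrow> complex ^ 'n" where
  "gradient f x = (\<chi> i. frechet_derivative f (at x) (axis i 1))"

text \<open>The extended nonnegative number \<open>(\<integral> (|x|\<^sup>l |g(x)|)\<^sup>p dx)\<^bsup>1/p\<^esup>\<close>.\<close>

definition weighted_Lp_norm ::
  "real \<Rightarrow> real \<Rightarrow> ('a::euclidean_space \<Rightarrow> 'b::real_normed_vector) \<Rightarrow> ennreal" where
  "weighted_Lp_norm p l g =
     (let I = (\<integral>\<^sup>+x. ennreal ((norm x powr l * norm (g x)) powr p) \<partial>lebesgue)
      in if I = \<infinity> then \<infinity> else ennreal (enn2real I powr (1 / p)))"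


section \<open>The singular integral operator\<close>

definition T_truncated ::
  "('a::euclidean_space \<Rightarrow> complex) \<Rightarrow> real \<Rightarrow> real \<Rightarrow> ('a \<Rightarrow> complex) \<Rightarrow> 'a \<Rightarrow> complex" where
  "T_truncated \<Omega> \<alpha> \<epsilon> f x =
     (LINT y:{y. norm y > \<epsilon>}|lebesgue.
        \<Omega> (y /\<^sub>R norm y) / of_real (norm y powr (real DIM('a) + 1 - \<alpha>)) * f (x - y))"

text \<open>
  \<^const>\<open>Lim\<close> is unspecified when the limit does not exist.  For \<open>f\<close> in \<^const>\<open>Cc_infinity\<close>, \<open>\<alpha> > 0\<close> and
  \<open>\<Omega>\<close> integrable with mean zero the limit exists at every point: near the origin \<open>f (x - y)\<close> may be
  replaced by \<open>f (x - y) - f x = O(|y|)\<close>.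
\<close>

definition T_op ::
  "('a::euclidean_space \<Rightarrow> complex) \<Rightarrow> real \<Rightarrow> ('a \<Rightarrow> complex) \<Rightarrow> 'a \<Rightarrow> complex" where
  "T_op \<Omega> \<alpha> f x = Lim (at_right 0) (\<lambda>\<epsilon>. T_truncated \<Omega> \<alpha> \<epsilon> f x)"

end

theory Submission
  imports Defs
begin

text \<open>
  Write \<open>n\<close> for the dimension and \<open>g\<close> for the length of the gradient of \<open>f\<close>.  The proof reduces the operator
  pointwise to a positive operator that acts on \<open>g\<close> and no longer sees \<open>\<Omega>\<close>, and then proves a weighted
  Hardy--Littlewood--Sobolev inequality for that operator.

  Reduction.  As \<open>\<Omega>\<close> has mean zero, the truncated integrals converge to the absolutely convergent integral of
  the kernel against \<open>f (x - y) - f x\<close> (\<open>T_op_le_difference_integral\<close>).  Because \<open>p > n\<close> there is an exponent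
  \<open>s\<close> strictly between \<open>n\<close> and \<open>p\<close>, and Morrey's inequality bounds this difference by \<open>norm y\<close> times the
  \<open>L\<^sup>s\<close> mean of \<open>g\<close> over the ball of radius \<open>2 norm y\<close> about \<open>x\<close> (\<open>Morrey_inequality\<close>).  This bound is radial in
  \<open>y\<close>, so the integral over \<open>y\<close> splits into the integral of \<open>\<bar>\<Omega>\<bar>\<close> over the sphere and a radial integral
  (\<open>angular_radial_le\<close>).  The result is \<open>T_op_le_ball_potential\<close>: up to a constant, the operator is dominated by
  the integral of \<open>norm y powr (\<alpha> - n)\<close> times the \<open>L\<^sup>s\<close> mean of \<open>g\<close> over the ball of radius \<open>2 norm y\<close>.

  The separation of the radial and the angular integral is needed for Hausdorff measure on the sphere.  Both
  Hausdorff measure and the image of a radial measure under \<open>y \<mapsto> y / norm y\<close> are invariant under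
  rotations.  A covering argument shows that the Hausdorff measure of the sphere is neither zero nor infinite, and two
  finite measures on a compact set are proportional if for each of them the mass of a ball depends only on its radius (\<open>uniform_on_unique\<close>).

  Weighted bound (\<open>weighted_ball_potential_bound\<close>).  Split the potential at \<open>norm y = norm x / 4\<close>.  Where \<open>y\<close> is
  small, the weight is essentially constant on the ball and may be moved onto \<open>g\<close>; what remains is unweighted and
  follows from the maximal theorem by Hedberg's argument (\<open>ball_potential_bound\<close>).  Where \<open>y\<close> is large, the
  ball about \<open>x\<close> may be replaced by a larger one about the origin, and the claim is an inequality of Hardy type
  (\<open>hardy_potential_bound\<close>).  It needs \<open>- n / q < l < n / s - n / p\<close>.  As \<open>- n / q = \<alpha> - n / p\<close>, the left inequality
  is a hypothesis; the right one is achieved by the choice of \<open>s\<close> close to \<open>n\<close>, since \<open>l < 1 - n / p\<close>.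

  The norm inequalities are proved for integrals with values in the extended nonnegative reals, so that the norms
  may be multiplied and raised to powers without first being shown to be finite.
\<close>

section \<open>Powers of extended nonnegative numbers\<close>

text \<open>
  Infinity is a fixed point for every exponent; this is the convention under which the weighted norm is
  \<open>epow I (1 / p)\<close> for the integral \<open>I\<close> in its definition.
\<close>

definition epow :: "ennreal \<Rightarrow> real \<Rightarrow> ennreal" where
  "epow x a = (if x = \<infinity> then \<infinity> else ennreal (enn2real x powr a))"

lemma epow_ennreal: "0 \<le> x \<Longrightarrow> epow (ennreal x) a = ennreal (x powr a)"
  by (simp add: epow_def)

lemma epow_top [simp]: "epow \<infinity> a = \<infinity>" "epow top a = top"
  by (simp_all add: epow_def)

lemma epow_0 [simp]: "epow 0 a = 0"
  by (simp add: epow_def)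

lemma epow_1 [simp]: "epow x 1 = x"
  by (cases x) (simp_all add: epow_ennreal)

lemma epow_eq_0_iff [simp]: "epow x a = 0 \<longleftrightarrow> x = 0"
  by (cases x) (simp_all add: epow_ennreal ennreal_eq_0_iff)

lemma epow_eq_top_iff [simp]: "epow x a = top \<longleftrightarrow> x = top"
  by (cases x) (simp_all add: epow_ennreal)

lemma epow_mono: "x \<le> y \<Longrightarrow> 0 \<le> a \<Longrightarrow> epow x a \<le> epow y a"
  by (cases x; cases y) (auto simp: epow_ennreal top_unique intro!: ennreal_leI powr_mono2)

lemma epow_mult: "epow (x * y) a = epow x a * epow y a"
proof (cases "x = 0 \<or> y = 0")
  case False
  then show ?thesis
    by (cases x; cases y)
       (auto simp: epow_ennreal ennreal_mult[symmetric] powr_mult ennreal_mult_top ennreal_top_mult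
         ennreal_eq_0_iff)
qed auto

lemma epow_epow: "epow (epow x a) b = epow x (a * b)"
  by (cases x) (simp_all add: epow_ennreal powr_powr)

lemma epow_add_exp: "epow x (a + b) = epow x a * epow x b"
  by (cases x) (simp_all add: epow_ennreal powr_add ennreal_mult[symmetric])

lemma measurable_epow [measurable (raw)]:
  assumes [measurable]: "f \<in> borel_measurable M"
  shows "(\<lambda>x. epow (f x) a) \<in> borel_measurable M"
  unfolding epow_def by measurable

lemma epow_add_le: "0 < a \<Longrightarrow> epow (x + y) a \<le> ennreal (2 powr a) * (epow x a + epow y a)"
proof -
  assume a: "0 < a"
  have "epow (x + y) a \<le> epow (2 * max x y) a"
    using a by (intro epow_mono) (auto simp: mult_2 intro!: add_mono)
  also have "\<dots> = epow 2 a * epow (max x y) a" by (rule epow_mult)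
  also have "epow 2 a = ennreal (2 powr a)"
    using epow_ennreal[of 2 a] by simp
  also have "epow (max x y) a \<le> epow x a + epow y a"
    by (auto simp: max_def add_increasing add_increasing2)
  finally show ?thesis by (simp add: mult_left_mono)
qed

lemma Young_ennreal:
  assumes "1 < p" "1 < q" "1 / p + 1 / q = 1"
  shows "u * v \<le> ennreal (1 / p) * epow u p + ennreal (1 / q) * epow v q"
proof (cases "u = 0 \<or> v = 0 \<or> u = top \<or> v = top")
  case True
  then show ?thesis using assms by (auto simp: ennreal_mult_top)
next
  case False
  then obtain a b where ab: "u = ennreal a" "v = ennreal b" "0 \<le> a" "0 \<le> b"
    by (metis ennreal_cases)
  have "a * b \<le> a powr p / p + b powr q / q"
    using assms ab by (intro Youngs_inequality) auto
  then show ?thesis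
    using ab assms by (simp add: epow_ennreal ennreal_mult[symmetric] ennreal_plus[symmetric]
        ennreal_leI del: ennreal_plus)
qed

text \<open>Hoelder's inequality, by integrating Young's inequality for the normalised functions.\<close>

lemma nn_integral_Hoelder:
  assumes f[measurable]: "f \<in> borel_measurable M" and g[measurable]: "g \<in> borel_measurable M"
    and pq: "1 < p" "1 < q" "1 / p + 1 / q = 1"
  shows "(\<integral>\<^sup>+x. f x * g x \<partial>M)
    \<le> epow (\<integral>\<^sup>+x. epow (f x) p \<partial>M) (1 / p) * epow (\<integral>\<^sup>+x. epow (g x) q \<partial>M) (1 / q)"
proof -
  define A where "A = (\<integral>\<^sup>+x. epow (f x) p \<partial>M)"
  define B where "B = (\<integral>\<^sup>+x. epow (g x) q \<partial>M)"
  consider "A = 0" | "B = 0" | "A \<noteq> 0" "B \<noteq> 0" "A = top \<or> B = top"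
    | a b where "A = ennreal a" "B = ennreal b" "0 < a" "0 < b"
    by (metis ennreal_cases ennreal_eq_0_iff not_le)
  then show ?thesis
    unfolding A_def[symmetric] B_def[symmetric]
  proof cases
    case 1
    then have "AE x in M. f x * g x = 0"
      unfolding A_def by (subst (asm) nn_integral_0_iff_AE) auto
    then have "(\<integral>\<^sup>+x. f x * g x \<partial>M) = 0"
      by (subst nn_integral_0_iff_AE) auto
    then show "(\<integral>\<^sup>+x. f x * g x \<partial>M) \<le> epow A (1 / p) * epow B (1 / q)" by simp
  next
    case 2
    then have "AE x in M. f x * g x = 0"
      unfolding B_def by (subst (asm) nn_integral_0_iff_AE) auto
    then have "(\<integral>\<^sup>+x. f x * g x \<partial>M) = 0"
      by (subst nn_integral_0_iff_AE) auto
    then show "(\<integral>\<^sup>+x. f x * g x \<partial>M) \<le> epow A (1 / p) * epow B (1 / q)" by simp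
  next
    case 3
    then show "(\<integral>\<^sup>+x. f x * g x \<partial>M) \<le> epow A (1 / p) * epow B (1 / q)"
      by (auto simp: ennreal_mult_top ennreal_top_mult)
  next
    case (4 a b)
    define \<alpha> \<beta> where "\<alpha> = a powr (1 / p)" and "\<beta> = b powr (1 / q)"
    have pos: "0 < \<alpha>" "0 < \<beta>" using 4 by (auto simp: \<alpha>_def \<beta>_def)
    have pw: "f x * g x \<le> ennreal (\<alpha> * \<beta> / (p * a)) * epow (f x) p + ennreal (\<alpha> * \<beta> / (q * b)) * epow (g x) q"
      for x
    proof -
      have inv: "ennreal \<alpha> * ennreal (1 / \<alpha>) = 1" "ennreal \<beta> * ennreal (1 / \<beta>) = 1"
        using pos by (simp_all add: ennreal_mult[symmetric])
      have e: "epow (ennreal (1 / \<alpha>)) p = ennreal (1 / a)" "epow (ennreal (1 / \<beta>)) q = ennreal (1 / b)"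
        using pos 4 pq by (simp_all add: epow_ennreal powr_divide \<alpha>_def \<beta>_def powr_powr)
      have "f x * g x = (ennreal \<alpha> * ennreal (1 / \<alpha>)) * (ennreal \<beta> * ennreal (1 / \<beta>)) * (f x * g x)"
        by (simp add: inv)
      also have "\<dots> = ennreal (\<alpha> * \<beta>) * ((ennreal (1 / \<alpha>) * f x) * (ennreal (1 / \<beta>) * g x))"
        using pos by (simp add: ennreal_mult ac_simps)
      also have "\<dots> \<le> ennreal (\<alpha> * \<beta>) * (ennreal (1 / p) * epow (ennreal (1 / \<alpha>) * f x) p
          + ennreal (1 / q) * epow (ennreal (1 / \<beta>) * g x) q)"
        by (intro mult_left_mono Young_ennreal pq) auto
      also have "\<dots> = ennreal (\<alpha> * \<beta>) * ennreal (1 / p) * ennreal (1 / a) * epow (f x) p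
          + ennreal (\<alpha> * \<beta>) * ennreal (1 / q) * ennreal (1 / b) * epow (g x) q"
        by (simp add: epow_mult e distrib_left mult.assoc)
      also have "\<dots> = ennreal (\<alpha> * \<beta> / (p * a)) * epow (f x) p + ennreal (\<alpha> * \<beta> / (q * b)) * epow (g x) q"
        using pos pq 4 by (simp add: ennreal_mult[symmetric] field_simps)
      finally show ?thesis .
    qed
    have "(\<integral>\<^sup>+x. f x * g x \<partial>M)
        \<le> (\<integral>\<^sup>+x. ennreal (\<alpha> * \<beta> / (p * a)) * epow (f x) p + ennreal (\<alpha> * \<beta> / (q * b)) * epow (g x) q \<partial>M)"
      by (intro nn_integral_mono pw)
    also have "\<dots> = ennreal (\<alpha> * \<beta> / (p * a)) * A + ennreal (\<alpha> * \<beta> / (q * b)) * B"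
      by (simp add: nn_integral_add nn_integral_cmult A_def B_def)
    also have "\<dots> = ennreal (\<alpha> * \<beta> / (p * a) * a + \<alpha> * \<beta> / (q * b) * b)"
      using 4 pos pq by (simp add: ennreal_mult[symmetric] ennreal_plus[symmetric] del: ennreal_plus)
    also have "\<alpha> * \<beta> / (p * a) * a + \<alpha> * \<beta> / (q * b) * b = \<alpha> * \<beta> * (1 / p + 1 / q)"
      using 4 pq by (simp add: field_simps)
    also have "\<dots> = \<alpha> * \<beta>" using pq by simp
    also have "ennreal (\<alpha> * \<beta>) = epow A (1 / p) * epow B (1 / q)"
      using 4 pos by (simp add: epow_ennreal \<alpha>_def \<beta>_def ennreal_mult)
    finally show "(\<integral>\<^sup>+x. f x * g x \<partial>M) \<le> epow A (1 / p) * epow B (1 / q)" .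
  qed
qed

section \<open>Integrals of powers of the norm\<close>

lemma term_le_suminf: "f k \<le> (\<Sum>k. f k)" for f :: "nat \<Rightarrow> ennreal"
  using sum_le_suminf[of f "{k}"] by simp

lemma sum_geometric_ennreal:
  fixes a :: real
  assumes "0 < a"
  shows "(\<Sum>k. ennreal ((2 powr - real k) powr a)) = ennreal (1 / (1 - 2 powr - a))"
proof -
  have e: "(2 powr - real k) powr a = (2 powr - a) ^ k" for k
    by (simp add: powr_powr powr_realpow[symmetric] mult.commute)
  have "(\<lambda>k. (2 powr - a) ^ k) sums (1 / (1 - 2 powr - a))"
    using assms by (intro geometric_sums) (simp add: powr_less_one)
  then show ?thesis unfolding e by (intro suminf_ennreal_eq) auto
qed

lemma dyadic_below:
  fixes t R :: real assumes "0 < t" "t \<le> R"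
  obtains k where "R * 2 powr (- real k - 1) < t" "t \<le> R * 2 powr (- real k)"
proof -
  define k where "k = nat \<lfloor>log 2 (R / t)\<rfloor>"
  have R: "0 < R" using assms by simp
  have "0 \<le> log 2 (R / t)" using assms by simp
  then have k: "real k \<le> log 2 (R / t)" "log 2 (R / t) < real k + 1"
    unfolding k_def by linarith+
  have l: "log 2 (R / t) = log 2 R - log 2 t" using assms R by (simp add: log_divide)
  have "2 powr (log 2 R + (- real k - 1)) < 2 powr (log 2 t)"
    by (rule powr_less_mono) (use k l in auto)
  moreover have "2 powr (log 2 t) \<le> 2 powr (log 2 R + (- real k))"
    by (rule powr_mono) (use k l in auto)
  ultimately show ?thesis
    using that[of k] assms R by (simp only: powr_add) simp
qed

text \<open>
  On each dyadic shell the power is comparable to a constant, so that it is dominated by a sum of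
  multiples of indicators of balls; integrated, this becomes a geometric series.  The lemma
  \<open>nn_integral_norm_powr_outside\<close> does the same for shells that grow to infinity.
\<close>

lemma nn_integral_norm_powr_cball:
  fixes a :: real
  assumes a: "0 < a"
  obtains c where "0 < c"
    "\<And>R. 0 < R \<Longrightarrow> (\<integral>\<^sup>+y. ennreal (norm y powr (a - DIM('a))) * indicator (cball (0::'a::euclidean_space) R) y \<partial>lborel)
       \<le> ennreal (c * R powr a)"
proof -
  define b where "b = a - DIM('a)"
  define K where "K = max 1 (2 powr - b)"
  define c where "c = K * unit_ball_vol DIM('a) * (1 / (1 - 2 powr - a))"
  have K: "0 < K" by (simp add: K_def)
  have V: "0 < unit_ball_vol (real DIM('a))" by simp
  have le1: "2 powr - a < 1" using a by (simp add: powr_less_one)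
  have "(\<integral>\<^sup>+(y::'a). ennreal (norm y powr b) * indicator (cball 0 R) y \<partial>lborel) \<le> ennreal (c * R powr a)"
    if R: "0 < R" for R
  proof -
    let ?r = "\<lambda>k::nat. R * 2 powr - real k"
    have r: "0 < ?r k" for k using R by simp
    have "ennreal (norm y powr b) * indicator (cball 0 R) y
        \<le> (\<Sum>k. ennreal (K * ?r k powr b) * indicator (cball 0 (?r k)) y)" for y :: 'a
    proof (cases "y = 0 \<or> norm y > R")
      case False
      then obtain k where k: "R * 2 powr (- real k - 1) < norm y" "norm y \<le> ?r k"
        using dyadic_below[of "norm y" R] by auto
      have half: "?r k / 2 < norm y" using k(1) by (simp add: powr_diff)
      have "norm y powr b \<le> K * ?r k powr b"
      proof (cases "0 \<le> b")
        case True
        then have "norm y powr b \<le> ?r k powr b" using k by (intro powr_mono2) auto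
        also have "\<dots> \<le> K * ?r k powr b" by (simp add: K_def mult_le_cancel_right1)
        finally show ?thesis .
      next
        case False
        then have "norm y powr b \<le> (?r k / 2) powr b"
          using half r[of k] by (intro powr_mono2') auto
        also have "\<dots> = 2 powr - b * ?r k powr b"
          by (simp only: powr_divide powr_minus) (simp add: divide_inverse)
        also have "\<dots> \<le> K * ?r k powr b" by (intro mult_right_mono) (simp_all add: K_def)
        finally show ?thesis .
      qed
      then have "ennreal (norm y powr b) * indicator (cball 0 R) y
          \<le> ennreal (K * ?r k powr b) * indicator (cball 0 (?r k)) y"
        using k by (auto simp: indicator_def intro!: ennreal_leI)
      also have "\<dots> \<le> (\<Sum>k. ennreal (K * ?r k powr b) * indicator (cball 0 (?r k)) y)"
        by (rule term_le_suminf)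
      finally show ?thesis .
    qed (auto simp: indicator_def)
    then have "(\<integral>\<^sup>+(y::'a). ennreal (norm y powr b) * indicator (cball 0 R) y \<partial>lborel)
        \<le> (\<integral>\<^sup>+(y::'a). (\<Sum>k. ennreal (K * ?r k powr b) * indicator (cball 0 (?r k)) y) \<partial>lborel)"
      by (rule nn_integral_mono)
    also have "\<dots> = (\<Sum>k. ennreal (K * ?r k powr b) * emeasure lborel (cball 0 (?r k) :: 'a set))"
    proof (subst nn_integral_suminf)
      show "(\<Sum>k. \<integral>\<^sup>+(y::'a). ennreal (K * ?r k powr b) * indicator (cball 0 (?r k)) y \<partial>lborel)
        = (\<Sum>k. ennreal (K * ?r k powr b) * emeasure lborel (cball 0 (?r k) :: 'a set))"
        by (intro suminf_cong nn_integral_cmult_indicator) simp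
    qed (intro borel_measurable_times_ennreal borel_measurable_indicator borel_measurable_const,
        simp)
    also have "\<dots> = (\<Sum>k. ennreal (K * unit_ball_vol DIM('a) * R powr a) * ennreal ((2 powr - real k) powr a))"
    proof (intro suminf_cong)
      fix k
      have "?r k powr b * ?r k ^ DIM('a) = ?r k powr a"
        using r[of k] by (simp add: powr_realpow[symmetric] powr_add[symmetric] b_def)
      moreover have "?r k powr a = R powr a * (2 powr - real k) powr a"
        using R by (simp add: powr_mult)
      ultimately show "ennreal (K * ?r k powr b) * emeasure lborel (cball 0 (?r k) :: 'a set)
        = ennreal (K * unit_ball_vol DIM('a) * R powr a) * ennreal ((2 powr - real k) powr a)"
        using K V R by (simp add: emeasure_cball ennreal_mult[symmetric] ac_simps)
    qed
    also have "\<dots> = ennreal (K * unit_ball_vol DIM('a) * R powr a) * ennreal (1 / (1 - 2 powr - a))"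
      by (simp add: sum_geometric_ennreal[OF a] ennreal_suminf_cmult)
    also have "\<dots> = ennreal (c * R powr a)"
      using K V R le1 by (simp add: c_def ennreal_mult[symmetric] ac_simps)
    finally show ?thesis .
  qed
  moreover have "0 < c" using K V le1 by (simp add: c_def)
  ultimately show ?thesis using that unfolding b_def by blast
qed

lemma powr_mult_power: "0 < x \<Longrightarrow> x powr (a - real n) * x ^ n = x powr a" for x :: real
  by (simp add: powr_realpow[symmetric] powr_add[symmetric])

lemma nn_integral_norm_powr_outside:
  fixes a :: real
  assumes a: "0 < a"
  obtains c where "0 < c"
    "\<And>R. 0 < R \<Longrightarrow> (\<integral>\<^sup>+y. ennreal (norm y powr (- a - DIM('a))) * indicator {y::'a::euclidean_space. R \<le> norm y} y \<partial>lborel)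
       \<le> ennreal (c * R powr - a)"
proof -
  define n where "n = DIM('a)"
  define c where "c = 2 ^ n * unit_ball_vol n * (1 / (1 - 2 powr - a))"
  have V: "0 < unit_ball_vol (real n)" by simp
  have le1: "2 powr - a < 1" using a by (simp add: powr_less_one)
  have "(\<integral>\<^sup>+(y::'a). ennreal (norm y powr (- a - n)) * indicator {y. R \<le> norm y} y \<partial>lborel) \<le> ennreal (c * R powr - a)"
    if R: "0 < R" for R
  proof -
    define r where "r k = R * 2 powr real k" for k :: nat
    have r: "0 < r k" for k using R by (simp add: r_def)
    have "ennreal (norm y powr (- a - n)) * indicator {y. R \<le> norm y} y
        \<le> (\<Sum>k. ennreal (r k powr (- a - n)) * indicator (cball 0 (2 * r k)) y)" for y :: 'a
    proof (cases "norm y < R")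
      case False
      then obtain k where k: "norm y * 2 powr (- real k - 1) < R" "R \<le> norm y * 2 powr (- real k)"
        using dyadic_below[of R "norm y"] R by auto
      have 1: "norm y \<le> 2 * r k" "r k \<le> norm y"
        using k by (simp_all add: r_def powr_diff powr_minus field_simps)
      then have "norm y powr (- a - n) \<le> r k powr (- a - n)"
        using r[of k] a by (intro powr_mono2') auto
      then have "ennreal (norm y powr (- a - n)) * indicator {y. R \<le> norm y} y
          \<le> ennreal (r k powr (- a - n)) * indicator (cball 0 (2 * r k)) y"
        using 1 by (auto simp: indicator_def intro!: ennreal_leI)
      also have "\<dots> \<le> (\<Sum>k. ennreal (r k powr (- a - n)) * indicator (cball 0 (2 * r k)) y)"
        by (rule term_le_suminf)
      finally show ?thesis .
    qed (auto simp: indicator_def)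
    then have "(\<integral>\<^sup>+(y::'a). ennreal (norm y powr (- a - n)) * indicator {y. R \<le> norm y} y \<partial>lborel)
        \<le> (\<integral>\<^sup>+(y::'a). (\<Sum>k. ennreal (r k powr (- a - n)) * indicator (cball 0 (2 * r k)) y) \<partial>lborel)"
      by (rule nn_integral_mono)
    also have "\<dots> = (\<Sum>k. ennreal (r k powr (- a - n)) * emeasure lborel (cball 0 (2 * r k) :: 'a set))"
    proof (subst nn_integral_suminf)
      show "(\<Sum>k. \<integral>\<^sup>+(y::'a). ennreal (r k powr (- a - n)) * indicator (cball 0 (2 * r k)) y \<partial>lborel)
        = (\<Sum>k. ennreal (r k powr (- a - n)) * emeasure lborel (cball 0 (2 * r k) :: 'a set))"
        by (intro suminf_cong nn_integral_cmult_indicator) simp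
    qed (intro borel_measurable_times_ennreal borel_measurable_indicator borel_measurable_const,
        simp)
    also have "\<dots> = (\<Sum>k. ennreal (2 ^ n * unit_ball_vol n * R powr - a) * ennreal ((2 powr - real k) powr a))"
    proof (intro suminf_cong)
      fix k
      have "r k powr (- a - n) * r k ^ n = r k powr - a"
        by (rule powr_mult_power) (rule r)
      moreover have "r k powr - a = R powr - a * (2 powr - real k) powr a"
        by (simp only: r_def powr_mult powr_powr mult_minus_left mult_minus_right)
      ultimately have e: "r k powr (- a - n) * r k ^ n = R powr - a * (2 powr - real k) powr a" by simp
      have "ennreal (r k powr (- a - n)) * emeasure lborel (cball 0 (2 * r k) :: 'a set)
        = ennreal (r k powr (- a - n) * (unit_ball_vol n * (2 * r k) ^ n))"
        using less_imp_le[OF r[of k]] by (subst emeasure_cball) (simp_all add: n_def ennreal_mult[symmetric])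
      also have "r k powr (- a - n) * (unit_ball_vol n * (2 * r k) ^ n)
          = 2 ^ n * unit_ball_vol n * (r k powr (- a - n) * r k ^ n)"
        by (simp only: power_mult_distrib mult_ac)
      also have "\<dots> = (2 ^ n * unit_ball_vol n * R powr - a) * (2 powr - real k) powr a"
        unfolding e by simp
      finally show "ennreal (r k powr (- a - n)) * emeasure lborel (cball 0 (2 * r k) :: 'a set)
        = ennreal (2 ^ n * unit_ball_vol n * R powr - a) * ennreal ((2 powr - real k) powr a)"
        by (simp add: ennreal_mult)
    qed
    also have "\<dots> = ennreal (2 ^ n * unit_ball_vol n * R powr - a) * ennreal (1 / (1 - 2 powr - a))"
      by (simp add: sum_geometric_ennreal[OF a] ennreal_suminf_cmult)
    also have "\<dots> = ennreal (c * R powr - a)"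
      using V R le1 by (simp add: c_def ennreal_mult[symmetric] ac_simps)
    finally show ?thesis .
  qed
  moreover have "0 < c" using V le1 by (simp add: c_def)
  ultimately show ?thesis using that unfolding n_def by blast
qed

section \<open>The Hardy--Littlewood maximal function\<close>

definition ball_int :: "('a::euclidean_space \<Rightarrow> ennreal) \<Rightarrow> 'a \<Rightarrow> real \<Rightarrow> ennreal" where
  "ball_int h x r = (\<integral>\<^sup>+y. h y * indicator (ball x r) y \<partial>lborel)"

lemma measurable_ball_int [measurable (raw)]:
  assumes [measurable]: "f \<in> N \<rightarrow>\<^sub>M borel" "r \<in> borel_measurable N" "h \<in> borel_measurable borel"
  shows "(\<lambda>w. ball_int h (f w) (r w)) \<in> borel_measurable N"
  unfolding ball_int_def ball_def by measurable

lemma ball_int_mono_ball: "ball x r \<subseteq> ball y s \<Longrightarrow> ball_int h x r \<le> ball_int h y s"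
  unfolding ball_int_def by (intro nn_integral_mono mult_left_mono) (auto simp: indicator_def)

lemma ball_int_le: "ball_int h x r \<le> (\<integral>\<^sup>+y. h y \<partial>lborel)"
  unfolding ball_int_def by (intro nn_integral_mono) (auto simp: indicator_def)

text \<open>
  Means over balls, up to the volume of the unit ball.  The supremum is over rational radii, which
  makes the maximal function measurable and costs a dimensional factor.
\<close>

definition maximal :: "('a::euclidean_space \<Rightarrow> ennreal) \<Rightarrow> 'a \<Rightarrow> ennreal" where
  "maximal h x = (SUP r\<in>{0<..} \<inter> \<rat>. ennreal (r powr - real DIM('a)) * ball_int h x r)"

lemma measurable_maximal [measurable]:
  fixes h :: "'a::euclidean_space \<Rightarrow> ennreal"
  assumes [measurable]: "h \<in> borel_measurable borel"
  shows "maximal h \<in> borel_measurable borel"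
proof -
  have "countable ({0<..} \<inter> \<rat> :: real set)"
    using countable_rat by (rule countable_subset[rotated]) auto
  then have "(\<lambda>x. SUP r\<in>{0<..} \<inter> \<rat>. ennreal (r powr - real DIM('a)) * ball_int h x r) \<in> borel_measurable borel"
    by (intro borel_measurable_SUP) measurable
  then show ?thesis by (simp add: maximal_def[abs_def])
qed

lemma ball_int_le_maximal:
  fixes h :: "'a::euclidean_space \<Rightarrow> ennreal"
  assumes r: "0 < r"
  shows "ennreal (r powr - real DIM('a)) * ball_int h x r \<le> ennreal (2 ^ DIM('a)) * maximal h x"
proof -
  let ?n = "real DIM('a)"
  obtain q where q: "q \<in> \<rat>" "r < q" "q < 2 * r"
    using Rats_dense_in_real[of r "2 * r"] r by auto
  have "r powr - ?n = 2 ^ DIM('a) * (2 * r) powr - ?n"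
    using r by (simp add: powr_mult powr_minus powr_realpow)
  also have "\<dots> \<le> 2 ^ DIM('a) * q powr - ?n"
    using r q by (intro mult_left_mono powr_mono2') auto
  finally have "ennreal (r powr - ?n) * ball_int h x r
      \<le> ennreal (2 ^ DIM('a) * q powr - ?n) * ball_int h x q"
    using q by (intro mult_mono ennreal_leI ball_int_mono_ball subset_ball) auto
  also have "\<dots> = ennreal (2 ^ DIM('a)) * (ennreal (q powr - ?n) * ball_int h x q)"
    by (simp add: ennreal_mult mult.assoc)
  also have "\<dots> \<le> ennreal (2 ^ DIM('a)) * maximal h x"
    unfolding maximal_def using q r by (intro mult_left_mono SUP_upper) auto
  finally show ?thesis .
qed

text \<open>
  The weak type estimate: among the balls witnessing that the maximal function exceeds the level,
  Vitali's lemma selects disjoint ones whose fivefold enlargements still cover.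
\<close>

lemma maximal_weak_type:
  fixes h :: "'a::euclidean_space \<Rightarrow> ennreal"
  assumes h[measurable]: "h \<in> borel_measurable borel" and t: "0 < t"
  shows "emeasure lborel {x. ennreal t < maximal h x}
    \<le> ennreal (5 ^ DIM('a) * unit_ball_vol DIM('a) / t) * (\<integral>\<^sup>+y. h y \<partial>lborel)"
proof (cases "(\<integral>\<^sup>+y. h y \<partial>lborel)")
  case top
  have "unit_ball_vol (real DIM('a)) \<noteq> 0"
    by (metis less_irrefl of_nat_0_le_iff unit_ball_vol_pos)
  with top show ?thesis using t by (simp add: ennreal_mult_top)
next
  case (real I)
  define n where "n = DIM('a)"
  define V where "V = unit_ball_vol (real n)"
  have V: "0 < V" by (simp add: V_def)
  define E where "E = {x. ennreal t < maximal h x}"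
  have [measurable]: "E \<in> sets borel" unfolding E_def by measurable
  have "\<exists>r. 0 < r \<and> ennreal (t * r ^ n) \<le> ball_int h x r" if "x \<in> E" for x
  proof -
    have "\<exists>r\<in>{0<..} \<inter> \<rat>. ennreal t < ennreal (r powr - real n) * ball_int h x r"
      using that unfolding E_def mem_Collect_eq maximal_def less_SUP_iff n_def .
    then obtain r where r: "r \<in> {0<..} \<inter> \<rat>" "ennreal t < ennreal (r powr - real n) * ball_int h x r"
      by (rule bexE)
    from r(1) have "0 < r" by simp
    have e: "r powr - real n * r ^ n = 1"
      using \<open>0 < r\<close> by (simp add: powr_minus powr_realpow)
    have "ennreal (t * r ^ n) = ennreal t * ennreal (r ^ n)" using t \<open>0 < r\<close> by (simp add: ennreal_mult)
    also have "\<dots> \<le> ennreal (r powr - real n) * ball_int h x r * ennreal (r ^ n)"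
      using r by (intro mult_right_mono) auto
    also have "\<dots> = ennreal (r powr - real n * r ^ n) * ball_int h x r"
      using \<open>0 < r\<close> by (simp add: ennreal_mult ac_simps)
    finally show ?thesis using \<open>0 < r\<close> e by auto
  qed
  then obtain r where r: "\<And>x. x \<in> E \<Longrightarrow> 0 < r x" "\<And>x. x \<in> E \<Longrightarrow> ennreal (t * r x ^ n) \<le> ball_int h x (r x)"
    by metis
  have rB: "r x \<le> max 1 (I / t)" if "x \<in> E" for x
  proof (cases "r x \<le> 1")
    case False
    have "ennreal (t * r x ^ n) \<le> ennreal I"
      using order_trans[OF r(2)[OF that] ball_int_le] unfolding real by blast
    then have "t * r x ^ n \<le> I" using real by simp
    moreover have "r x ^ 1 \<le> r x ^ n" using False by (intro power_increasing) (auto simp: n_def Suc_leI)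
    ultimately have "r x * t \<le> I" using t by (smt (verit) mult.commute mult_left_mono power_one_right)
    then show ?thesis using t by (simp add: pos_le_divide_eq le_max_iff_disj)
  qed auto
  have cov: "E \<subseteq> (\<Union>x\<in>E. ball x (r x))" using r by auto
  obtain C where C: "countable C" "C \<subseteq> E"
    "pairwise (\<lambda>i j. disjnt (ball i (r i)) (ball j (r j))) C"
    "E \<subseteq> (\<Union>i\<in>C. ball i (5 * r i))"
    by (rule Vitali_covering_lemma_balls[where a = "\<lambda>x. x", OF cov, of "max 1 (I / t)"])
       (use r(1) rB in blast)+
  have le: "indicator E x \<le> (\<integral>\<^sup>+i. indicator (ball i (5 * r i)) x \<partial>count_space C)" for x
  proof (cases "x \<in> E")
    case True
    then obtain i where i: "i \<in> C" "x \<in> ball i (5 * r i)" using C by auto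
    have "indicator E x \<le> (indicator (ball i (5 * r i)) x :: ennreal)" using i by (simp add: indicator_def)
    also have "\<dots> \<le> (\<integral>\<^sup>+i. indicator (ball i (5 * r i)) x \<partial>count_space C)"
      using i by (intro nn_integral_ge_point) auto
    finally show ?thesis .
  qed auto
  have "emeasure lborel E = (\<integral>\<^sup>+x. indicator E x \<partial>lborel)" by simp
  also have "\<dots> \<le> (\<integral>\<^sup>+x. \<integral>\<^sup>+i. indicator (ball i (5 * r i)) x \<partial>count_space C \<partial>lborel)"
    by (intro nn_integral_mono le)
  also have "\<dots> = (\<integral>\<^sup>+i. emeasure lborel (ball i (5 * r i)) \<partial>count_space C)"
    using C(1) by (subst nn_integral_count_space_nn_integral) (auto intro: borel_measurable_indicator)
  also have "\<dots> \<le> (\<integral>\<^sup>+i. ennreal (5 ^ n * V / t) * ball_int h i (r i) \<partial>count_space C)"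
  proof (intro nn_integral_mono)
    fix i assume "i \<in> space (count_space C)"
    then have i: "0 < r i" "ennreal (t * r i ^ n) \<le> ball_int h i (r i)" using r C by auto
    have "emeasure lborel (ball i (5 * r i)) = ennreal (5 ^ n * V / t) * ennreal (t * r i ^ n)"
      using i t V by (simp add: emeasure_ball ennreal_mult[symmetric] n_def V_def power_mult_distrib)
    also have "\<dots> \<le> ennreal (5 ^ n * V / t) * ball_int h i (r i)"
      using i by (intro mult_left_mono) auto
    finally show "emeasure lborel (ball i (5 * r i)) \<le> ennreal (5 ^ n * V / t) * ball_int h i (r i)" .
  qed
  also have "\<dots> = ennreal (5 ^ n * V / t) * (\<integral>\<^sup>+i. emeasure (density lborel h) (ball i (r i)) \<partial>count_space C)"
    by (simp add: nn_integral_cmult ball_int_def emeasure_density)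
  also have "(\<integral>\<^sup>+i. emeasure (density lborel h) (ball i (r i)) \<partial>count_space C)
      = emeasure (density lborel h) (\<Union>i\<in>C. ball i (r i))"
    using C by (intro emeasure_UN_countable[symmetric]) (auto simp: disjoint_family_on_def pairwise_def disjnt_def)
  also have "\<dots> \<le> emeasure (density lborel h) (space (density lborel h))"
    by (rule emeasure_space)
  also have "\<dots> = (\<integral>\<^sup>+y. h y \<partial>lborel)" by (subst emeasure_density) auto
  finally show ?thesis by (simp add: E_def n_def V_def mult_left_mono)
qed

text \<open>
  An inequality suffices in place of the layer cake formula, and for finite \<open>u\<close> it needs only the
  levels between \<open>u / 2\<close> and \<open>u\<close>.
\<close>

lemma epow_le_layer_cake:
  assumes r: "1 < r"
  shows "epow u r \<le> ennreal (2 powr r) *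
    (\<integral>\<^sup>+t. ennreal (t powr (r - 1)) * indicator {t. 0 < t \<and> ennreal t < u} t \<partial>lborel)"
    (is "_ \<le> _ * ?I u")
proof -
  have fin: "ennreal ((b / 2) powr r) \<le> ?I u" if b: "0 < b" "ennreal b \<le> u" for b
  proof -
    have lt: "ennreal t < u" if "0 < t" "t < b" for t
      using that b by (meson ennreal_lessI less_le_trans order_less_trans)
    have "ennreal ((b / 2) powr r) = ennreal ((b / 2) powr (r - 1) * (b / 2))"
      using b by (simp add: powr_diff)
    also have "\<dots> = ennreal ((b / 2) powr (r - 1)) * emeasure lborel {b/2<..<b}"
      using b by (simp add: ennreal_mult[symmetric])
    also have "\<dots> = (\<integral>\<^sup>+t. ennreal ((b / 2) powr (r - 1)) * indicator {b/2<..<b} t \<partial>lborel)"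
      by (simp add: nn_integral_cmult_indicator)
    also have "\<dots> \<le> ?I u"
      using b r lt by (intro nn_integral_mono) (auto simp: indicator_def intro!: ennreal_leI powr_mono2)
    finally show ?thesis .
  qed
  show ?thesis
  proof (cases u)
    case (real b)
    show ?thesis
    proof (cases "b = 0")
      case False
      then have b: "0 < b" using real by simp
      have "epow u r = ennreal (2 powr r) * ennreal ((b / 2) powr r)"
        using real b by (simp add: epow_ennreal ennreal_mult[symmetric] powr_mult[symmetric])
      also have "\<dots> \<le> ennreal (2 powr r) * ?I u"
        using fin b real by (intro mult_left_mono) auto
      finally show ?thesis .
    qed (use real in simp)
  next
    case top
    have "?I u = top"
    proof (cases "?I u")
      case (real v)
      define b where "b = 2 * (v + 1) powr (1 / r)"
      have "0 < b" "(b / 2) powr r = v + 1" using real r by (auto simp: b_def powr_powr)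
      then have "ennreal (v + 1) \<le> ennreal v" using fin[of b] top real by simp
      then show ?thesis using real by (simp del: ennreal_plus)
    qed
    then show ?thesis by (simp add: ennreal_mult_top)
  qed
qed

text \<open>
  The weak type estimate, applied at each level to the part of \<open>h\<close> that can reach this level, is integrated over the
  levels; exchanging the integrals leaves a power integral up to a multiple of \<open>h x\<close>.
\<close>

lemma maximal_strong_type:
  assumes r: "1 < r"
  obtains c where "0 < c"
    "\<And>h::'a::euclidean_space \<Rightarrow> ennreal. h \<in> borel_measurable borel \<Longrightarrow>
      (\<integral>\<^sup>+x. epow (maximal h x) r \<partial>lborel) \<le> ennreal c * (\<integral>\<^sup>+x. epow (h x) r \<partial>lborel)"
proof -
  define V where "V = unit_ball_vol (real DIM('a))"
  have V: "0 < V" by (simp add: V_def)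
  define A where "A = 2 * 5 ^ DIM('a) * V"
  have A: "0 < A" using V by (simp add: A_def)
  obtain k where k: "0 < k"
    "\<And>R. 0 < R \<Longrightarrow> (\<integral>\<^sup>+(t::real). ennreal (norm t powr (r - 1 - DIM(real))) * indicator (cball 0 R) t \<partial>lborel)
       \<le> ennreal (k * R powr (r - 1))"
    using nn_integral_norm_powr_cball[of "r - 1", where 'a = real] r by auto
  define c where "c = 2 powr r * (A * (k * (2 * V) powr (r - 1)))"
  have "(\<integral>\<^sup>+x. epow (maximal h x) r \<partial>lborel) \<le> ennreal c * (\<integral>\<^sup>+x. epow (h x) r \<partial>lborel)"
    if h[measurable]: "h \<in> borel_measurable borel" for h :: "'a \<Rightarrow> ennreal"
  proof -
    \<comment> \<open>Only the part of \<open>h\<close> above \<open>t / (2 V)\<close> matters at level \<open>t\<close>: the rest contributes at most \<open>t / 2\<close>.\<close>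
    have level: "emeasure lborel {x. ennreal t < maximal h x}
        \<le> ennreal (A / t) * (\<integral>\<^sup>+x. h x * indicator {x. ennreal (t / (2 * V)) < h x} x \<partial>lborel)"
      if t: "0 < t" for t
    proof -
      define g where "g x = h x * indicator {x. ennreal (t / (2 * V)) < h x} x" for x
      have [measurable]: "g \<in> borel_measurable borel" unfolding g_def by measurable
      have mle: "maximal h x \<le> maximal g x + ennreal (t / 2)" for x
        unfolding maximal_def[of h]
      proof (rule SUP_least)
        fix \<rho> :: real assume \<rho>: "\<rho> \<in> {0<..} \<inter> \<rat>"
        then have \<rho>0: "0 < \<rho>" by simp
        have [measurable]: "ball x \<rho> \<in> sets borel" by simp
        have "ball_int h x \<rho> \<le> (\<integral>\<^sup>+y. g y * indicator (ball x \<rho>) y + ennreal (t / (2 * V)) * indicator (ball x \<rho>) y \<partial>lborel)"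
          unfolding ball_int_def by (intro nn_integral_mono) (auto simp: g_def indicator_def)
        also have "\<dots> = ball_int g x \<rho> + ennreal (t / (2 * V)) * emeasure lborel (ball x \<rho>)"
          unfolding ball_int_def by (subst nn_integral_add) (auto simp: nn_integral_cmult_indicator)
        also have "\<dots> = ball_int g x \<rho> + ennreal (t / 2 * \<rho> ^ DIM('a))"
          using \<rho>0 t V by (simp add: emeasure_ball ennreal_mult[symmetric] V_def[symmetric])
        finally have "ennreal (\<rho> powr - real DIM('a)) * ball_int h x \<rho>
          \<le> ennreal (\<rho> powr - real DIM('a)) * (ball_int g x \<rho> + ennreal (t / 2 * \<rho> ^ DIM('a)))"
          by (intro mult_left_mono) auto
        also have "\<dots> = ennreal (\<rho> powr - real DIM('a)) * ball_int g x \<rho> + ennreal (t / 2)"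
          using \<rho>0 t by (simp add: distrib_left ennreal_mult[symmetric] powr_minus powr_realpow)
        also have "\<dots> \<le> maximal g x + ennreal (t / 2)"
          unfolding maximal_def by (intro add_right_mono SUP_upper \<rho>)
        finally show "ennreal (\<rho> powr - real DIM('a)) * ball_int h x \<rho> \<le> maximal g x + ennreal (t / 2)" .
      qed
      have "{x. ennreal t < maximal h x} \<subseteq> {x. ennreal (t / 2) < maximal g x}"
      proof safe
        fix x assume "ennreal t < maximal h x"
        also note mle[of x]
        finally have "ennreal (t / 2) + ennreal (t / 2) < maximal g x + ennreal (t / 2)"
          using t by (simp add: ennreal_plus[symmetric] del: ennreal_plus)
        then show "ennreal (t / 2) < maximal g x"
          by (meson add_right_mono not_le)
      qed
      then have "emeasure lborel {x. ennreal t < maximal h x} \<le> emeasure lborel {x. ennreal (t / 2) < maximal g x}"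
        by (intro emeasure_mono) auto
      also have "\<dots> \<le> ennreal (5 ^ DIM('a) * unit_ball_vol DIM('a) / (t / 2)) * (\<integral>\<^sup>+y. g y \<partial>lborel)"
        using t by (intro maximal_weak_type) auto
      also have "5 ^ DIM('a) * unit_ball_vol DIM('a) / (t / 2) = A / t"
        by (simp add: A_def V_def)
      finally show ?thesis by (simp add: g_def)
    qed
    have inner: "(\<integral>\<^sup>+t. ennreal (t powr (r - 2)) * indicator {t. 0 < t \<and> ennreal (t / (2 * V)) < u} t \<partial>lborel) * u
        \<le> ennreal (k * (2 * V) powr (r - 1)) * epow u r" for u
    proof (cases u)
      case (real b)
      show ?thesis
      proof (cases "b = 0")
        case False
        then have b: "0 < b" using real by simp
        have "(\<integral>\<^sup>+t. ennreal (t powr (r - 2)) * indicator {t. 0 < t \<and> ennreal (t / (2 * V)) < u} t \<partial>lborel)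
          \<le> (\<integral>\<^sup>+(t::real). ennreal (norm t powr (r - 1 - DIM(real))) * indicator (cball 0 (2 * V * b)) t \<partial>lborel)"
          using real V b
          by (intro nn_integral_mono) (auto simp: indicator_def ennreal_less_iff field_simps)
        also have "\<dots> \<le> ennreal (k * (2 * V * b) powr (r - 1))"
          using V b by (intro k) auto
        finally have "(\<integral>\<^sup>+t. ennreal (t powr (r - 2)) * indicator {t. 0 < t \<and> ennreal (t / (2 * V)) < u} t \<partial>lborel) * u
          \<le> ennreal (k * (2 * V * b) powr (r - 1)) * ennreal b"
          using real by (intro mult_mono) auto
        also have "\<dots> = ennreal (k * (2 * V) powr (r - 1) * b powr r)"
          using b k V by (simp add: ennreal_mult[symmetric] powr_mult powr_diff)
        also have "\<dots> = ennreal (k * (2 * V) powr (r - 1)) * epow u r"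
          using real k by (simp add: epow_ennreal ennreal_mult)
        finally show ?thesis .
      qed (use real in simp)
    next
      case top
      then show ?thesis using k V by (simp add: ennreal_mult_top)
    qed
    have "(\<integral>\<^sup>+x. epow (maximal h x) r \<partial>lborel) \<le> (\<integral>\<^sup>+x. ennreal (2 powr r) *
      (\<integral>\<^sup>+t. ennreal (t powr (r - 1)) * indicator {t. 0 < t \<and> ennreal t < maximal h x} t \<partial>lborel) \<partial>lborel)"
      by (intro nn_integral_mono epow_le_layer_cake r)
    also have "\<dots> = ennreal (2 powr r) * (\<integral>\<^sup>+x.
      (\<integral>\<^sup>+t. ennreal (t powr (r - 1)) * indicator {t. 0 < t \<and> ennreal t < maximal h x} t \<partial>lborel) \<partial>lborel)"
      by (rule nn_integral_cmult) measurable
    also have "(\<integral>\<^sup>+x. (\<integral>\<^sup>+t. ennreal (t powr (r - 1)) * indicator {t. 0 < t \<and> ennreal t < maximal h x} t \<partial>lborel) \<partial>lborel)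
      = (\<integral>\<^sup>+t. (\<integral>\<^sup>+x. ennreal (t powr (r - 1)) * indicator {t. 0 < t \<and> ennreal t < maximal h x} t \<partial>lborel) \<partial>lborel)"
      by (rule lborel_pair.Fubini') measurable
    also have "\<dots> \<le> (\<integral>\<^sup>+t. (\<integral>\<^sup>+x. ennreal A * (ennreal (t powr (r - 2)) *
        indicator {t. 0 < t \<and> ennreal (t / (2 * V)) < h x} t * h x) \<partial>lborel) \<partial>lborel)"
    proof (rule nn_integral_mono)
      fix t :: real
      show "(\<integral>\<^sup>+x. ennreal (t powr (r - 1)) * indicator {t. 0 < t \<and> ennreal t < maximal h x} t \<partial>lborel)
        \<le> (\<integral>\<^sup>+x. ennreal A * (ennreal (t powr (r - 2)) * indicator {t. 0 < t \<and> ennreal (t / (2 * V)) < h x} t * h x) \<partial>lborel)"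
      proof (cases "0 < t")
        case True
        have "(\<integral>\<^sup>+x. ennreal (t powr (r - 1)) * indicator {t. 0 < t \<and> ennreal t < maximal h x} t \<partial>lborel)
          = (\<integral>\<^sup>+x. ennreal (t powr (r - 1)) * indicator {x. ennreal t < maximal h x} x \<partial>lborel)"
          using True by (intro nn_integral_cong) (auto simp: indicator_def)
        also have "\<dots> = ennreal (t powr (r - 1)) * emeasure lborel {x. ennreal t < maximal h x}"
          by (intro nn_integral_cmult_indicator) measurable
        also have "\<dots> \<le> ennreal (t powr (r - 1)) *
            (ennreal (A / t) * (\<integral>\<^sup>+x. h x * indicator {x. ennreal (t / (2 * V)) < h x} x \<partial>lborel))"
          by (intro mult_left_mono level True) simp
        also have "\<dots> = ennreal (A * t powr (r - 2)) * (\<integral>\<^sup>+x. h x * indicator {x. ennreal (t / (2 * V)) < h x} x \<partial>lborel)"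
        proof -
          have "t powr (r - 1) * (A / t) = A * t powr (r - 2)"
            using True by (simp add: powr_diff power2_eq_square field_simps)
          then show ?thesis using True A by (simp add: mult.assoc[symmetric] ennreal_mult[symmetric])
        qed
        also have "\<dots> = (\<integral>\<^sup>+x. ennreal (A * t powr (r - 2)) * (h x * indicator {x. ennreal (t / (2 * V)) < h x} x) \<partial>lborel)"
          by (rule nn_integral_cmult[symmetric]) measurable
        also have "\<dots> = (\<integral>\<^sup>+x. ennreal A * (ennreal (t powr (r - 2)) *
            indicator {t. 0 < t \<and> ennreal (t / (2 * V)) < h x} t * h x) \<partial>lborel)"
          using True A by (intro nn_integral_cong) (auto simp: indicator_def ennreal_mult mult.assoc)
        finally show ?thesis .
      qed (simp add: indicator_def)
    qed
    also have "\<dots> = (\<integral>\<^sup>+x. (\<integral>\<^sup>+t. ennreal A * (ennreal (t powr (r - 2)) *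
        indicator {t. 0 < t \<and> ennreal (t / (2 * V)) < h x} t * h x) \<partial>lborel) \<partial>lborel)"
      by (rule lborel_pair.Fubini') measurable
    also have "\<dots> = (\<integral>\<^sup>+x. ennreal A * ((\<integral>\<^sup>+t. ennreal (t powr (r - 2)) *
        indicator {t. 0 < t \<and> ennreal (t / (2 * V)) < h x} t \<partial>lborel) * h x) \<partial>lborel)"
      by (intro nn_integral_cong, subst nn_integral_cmult, measurable, subst nn_integral_multc, measurable)
    also have "\<dots> \<le> (\<integral>\<^sup>+x. ennreal A * (ennreal (k * (2 * V) powr (r - 1)) * epow (h x) r) \<partial>lborel)"
      by (intro nn_integral_mono mult_left_mono inner) simp
    also have "\<dots> = ennreal A * (ennreal (k * (2 * V) powr (r - 1)) * (\<integral>\<^sup>+x. epow (h x) r \<partial>lborel))"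
      by (simp add: nn_integral_cmult)
    finally have "(\<integral>\<^sup>+x. epow (maximal h x) r \<partial>lborel)
      \<le> ennreal (2 powr r) * (ennreal A * (ennreal (k * (2 * V) powr (r - 1)) * (\<integral>\<^sup>+x. epow (h x) r \<partial>lborel)))"
      by (simp add: mult_left_mono)
    also have "\<dots> = ennreal c * (\<integral>\<^sup>+x. epow (h x) r \<partial>lborel)"
      using A k V by (simp add: c_def ennreal_mult mult.assoc)
    finally show ?thesis .
  qed
  moreover have "0 < c" using A k V by (simp add: c_def)
  ultimately show ?thesis using that by blast
qed

section \<open>The potential of means over balls\<close>

text \<open>
  For \<open>s = 1\<close> this is, up to constants, the Riesz potential of order \<open>\<alpha>\<close>; for larger \<open>s\<close> the means over balls
  are replaced by \<open>L\<^sup>s\<close> means.  As in \<open>ball_int\<close>, the volume of the unit ball is not divided out.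
\<close>

definition ball_potential :: "real \<Rightarrow> real \<Rightarrow> ('a::euclidean_space \<Rightarrow> ennreal) \<Rightarrow> 'a \<Rightarrow> ennreal" where
  "ball_potential \<alpha> s g x = (\<integral>\<^sup>+(y::'a). ennreal (norm y powr (\<alpha> - real DIM('a))) *
     epow (ennreal (norm y powr - real DIM('a)) * ball_int (\<lambda>z. epow (g z) s) x (2 * norm y)) (1 / s) \<partial>lborel)"

lemma measurable_ball_potential [measurable]:
  fixes g :: "'a::euclidean_space \<Rightarrow> ennreal" and \<alpha> s :: real
  assumes [measurable]: "g \<in> borel_measurable borel"
  shows "ball_potential \<alpha> s g \<in> borel_measurable borel"
  unfolding ball_potential_def[abs_def] by measurable

lemma ball_int_Hoelder:
  fixes h :: "'a::euclidean_space \<Rightarrow> ennreal"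
  assumes [measurable]: "h \<in> borel_measurable borel" and t: "1 < t" and r: "0 < r"
  shows "ball_int h x r
    \<le> ennreal (unit_ball_vol DIM('a) powr (1 - 1 / t) * r powr (DIM('a) * (1 - 1 / t)))
      * epow (\<integral>\<^sup>+y. epow (h y) t \<partial>lborel) (1 / t)"
proof -
  define t' where "t' = t / (t - 1)"
  have t': "1 < t'" "1 / t + 1 / t' = 1" "1 / t' = 1 - 1 / t" "t' \<noteq> 0"
    using t by (simp_all add: t'_def field_simps)
  have [measurable]: "ball x r \<in> sets borel" by simp
  have V: "0 < unit_ball_vol (real DIM('a))" by simp
  have "ball_int h x r \<le> epow (\<integral>\<^sup>+y. epow (h y) t \<partial>lborel) (1 / t)
      * epow (\<integral>\<^sup>+y. epow (indicator (ball x r) y) t' \<partial>lborel) (1 / t')"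
    unfolding ball_int_def using t t' by (intro nn_integral_Hoelder) measurable
  also have "(\<lambda>y. epow (indicator (ball x r) y) t') = indicator (ball x r)"
    using epow_ennreal[of 1 t'] by (auto simp: fun_eq_iff indicator_def)
  also have "(\<integral>\<^sup>+y. indicator (ball x r) y \<partial>lborel) = ennreal (unit_ball_vol DIM('a) * r ^ DIM('a))"
    using r by (simp add: emeasure_ball)
  also have "epow \<dots> (1 / t') = ennreal (unit_ball_vol DIM('a) powr (1 - 1 / t) * r powr (DIM('a) * (1 - 1 / t)))"
    using r V t' by (simp add: epow_ennreal powr_mult powr_realpow[symmetric] powr_powr)
  finally show ?thesis by (simp add: mult.commute)
qed

lemma optimise_radius:
  fixes \<alpha> \<beta> M N :: real
  assumes "0 < \<alpha>" "0 < \<beta>" "0 < M" "0 < N"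
  defines "R \<equiv> (N / M) powr (1 / (\<alpha> + \<beta>))"
  shows "R powr \<alpha> * M = M powr (\<beta> / (\<alpha> + \<beta>)) * N powr (\<alpha> / (\<alpha> + \<beta>))"
    and "R powr - \<beta> * N = M powr (\<beta> / (\<alpha> + \<beta>)) * N powr (\<alpha> / (\<alpha> + \<beta>))"
proof -
  let ?s = "\<alpha> + \<beta>"
  have "?s / ?s = 1" using assms(1,2) by simp
  then have "\<alpha> / ?s + \<beta> / ?s = 1" by (simp only: add_divide_distrib)
  then have s: "\<alpha> / ?s = 1 - \<beta> / ?s" "\<beta> / ?s = 1 - \<alpha> / ?s" by linarith+
  have R: "R powr a = N powr (a / ?s) * M powr - (a / ?s)" for a
    by (simp add: R_def powr_powr powr_divide powr_minus_divide)
  have "R powr \<alpha> * M = N powr (\<alpha> / ?s) * (M powr - (\<alpha> / ?s) * M powr 1)"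
    using assms(3) by (simp add: R)
  also have "M powr - (\<alpha> / ?s) * M powr 1 = M powr (\<beta> / ?s)"
    unfolding powr_add[symmetric] s(2) by simp
  finally show "R powr \<alpha> * M = M powr (\<beta> / ?s) * N powr (\<alpha> / ?s)" by simp
  have "R powr - \<beta> * N = M powr (\<beta> / ?s) * (N powr - (\<beta> / ?s) * N powr 1)"
    using assms(4) by (simp add: R)
  also have "N powr - (\<beta> / ?s) * N powr 1 = N powr (\<alpha> / ?s)"
    unfolding powr_add[symmetric] s(1) by simp
  finally show "R powr - \<beta> * N = M powr (\<beta> / ?s) * N powr (\<alpha> / ?s)" .
qed

text \<open>
  Hedberg's argument: the mean over a small ball is controlled by the maximal function, that over a
  large ball by Hoelder's inequality, and one splits at the radius where the two bounds agree.
\<close>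

lemma ball_potential_Hedberg:
  fixes \<alpha> p q s :: real
  assumes \<alpha>: "0 < \<alpha>" and s: "0 < s" "s < p" and p\<alpha>: "\<alpha> < DIM('a) / p"
    and q: "1 / q = 1 / p - \<alpha> / DIM('a)"
  obtains c where "0 < c"
    "\<And>(g :: 'a::euclidean_space \<Rightarrow> ennreal) x. g \<in> borel_measurable borel \<Longrightarrow>
      epow (ball_potential \<alpha> s g x) q \<le> ennreal c * (epow (maximal (\<lambda>z. epow (g z) s) x) (p / s)
        * epow (\<integral>\<^sup>+z. epow (g z) p \<partial>lborel) (q / p - 1))"
proof -
  define n where "n = real DIM('a)"
  have n: "0 < n" by (simp add: n_def)
  have p: "0 < p" using s by simp
  define t where "t = p / s"
  have t: "1 < t" using s by (simp add: t_def)
  define \<beta> where "\<beta> = n / p - \<alpha>"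
  have \<beta>: "0 < \<beta>" using p\<alpha> by (simp add: \<beta>_def n_def)
  have "1 / q = \<beta> / n" using q n by (simp add: \<beta>_def n_def diff_divide_distrib)
  then have qe: "q = n / \<beta>" using n \<beta> by (cases "q = 0") (auto simp: field_simps)
  have q0: "0 < q" using qe n \<beta> by simp
  \<comment> \<open>Since \<open>\<alpha> + \<beta> = n / p\<close>, these are the exponents that the optimal radius produces.\<close>
  have e1: "\<beta> / (\<alpha> + \<beta>) * q = p" "\<alpha> / (\<alpha> + \<beta>) * q = q - p"
    using n \<beta> p unfolding qe by (simp_all add: \<beta>_def field_simps)
  obtain k1 where k1: "0 < k1"
    "\<And>R. 0 < R \<Longrightarrow> (\<integral>\<^sup>+(y::'a). ennreal (norm y powr (\<alpha> - DIM('a))) * indicator (cball 0 R) y \<partial>lborel)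
       \<le> ennreal (k1 * R powr \<alpha>)"
    by (rule nn_integral_norm_powr_cball[OF \<alpha>]) (rule that)
  obtain k2 where k2: "0 < k2"
    "\<And>R. 0 < R \<Longrightarrow> (\<integral>\<^sup>+(y::'a). ennreal (norm y powr (- \<beta> - DIM('a))) * indicator {y. R \<le> norm y} y \<partial>lborel)
       \<le> ennreal (k2 * R powr - \<beta>)"
    by (rule nn_integral_norm_powr_outside[OF \<beta>]) (rule that)
  define d1 where "d1 = (4 ^ DIM('a)) powr (1 / s)"
  define d2 where "d2 = (unit_ball_vol n powr (1 - 1 / t) * 2 powr (n * (1 - 1 / t))) powr (1 / s)"
  have "unit_ball_vol n \<noteq> 0" unfolding n_def by (metis less_irrefl of_nat_0_le_iff unit_ball_vol_pos)
  then have d: "0 < d1" "0 < d2" by (auto simp: d1_def d2_def)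
  define c where "c = (k1 * d1 + k2 * d2) powr q"
  have c0: "0 < k1 * d1 + k2 * d2" using k1 k2 d by (intro add_pos_pos mult_pos_pos)
  have c: "0 < c" using c0 by (simp add: c_def)
  have "epow (ball_potential \<alpha> s g x) q \<le> ennreal c * (epow (maximal (\<lambda>z. epow (g z) s) x) (p / s)
        * epow (\<integral>\<^sup>+z. epow (g z) p \<partial>lborel) (q / p - 1))"
    if g[measurable]: "g \<in> borel_measurable borel" for g :: "'a \<Rightarrow> ennreal" and x :: 'a
  proof -
    define h where "h z = epow (g z) s" for z
    have [measurable]: "h \<in> borel_measurable borel" unfolding h_def by measurable
    define M where "M = epow (maximal h x) (1 / s)"
    define N where "N = epow (\<integral>\<^sup>+z. epow (g z) p \<partial>lborel) (1 / p)"
    have hN: "epow (epow (\<integral>\<^sup>+z. epow (h z) t \<partial>lborel) (1 / t)) (1 / s) = N"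
      using s by (simp add: h_def t_def N_def epow_epow)
    define J where "J y = ennreal (norm y powr (\<alpha> - n)) *
      epow (ennreal (norm y powr - n) * ball_int h x (2 * norm y)) (1 / s)" for y :: 'a
    have [measurable]: "J \<in> borel_measurable borel" unfolding J_def by measurable
    have pot: "ball_potential \<alpha> s g x = (\<integral>\<^sup>+y. J y \<partial>lborel)"
      by (simp add: ball_potential_def J_def n_def h_def[abs_def])
    have J1: "J y \<le> ennreal (norm y powr (\<alpha> - n)) * (ennreal d1 * M)" for y
    proof (cases "y = 0")
      case False
      have "norm y powr - n = 2 ^ DIM('a) * (2 * norm y) powr - n"
        using False by (simp add: n_def powr_mult powr_minus powr_realpow)
      then have "ennreal (norm y powr - n) * ball_int h x (2 * norm y)
          = ennreal (2 ^ DIM('a)) * (ennreal ((2 * norm y) powr - n) * ball_int h x (2 * norm y))"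
        by (simp add: ennreal_mult mult.assoc)
      also have "\<dots> \<le> ennreal (2 ^ DIM('a)) * (ennreal (2 ^ DIM('a)) * maximal h x)"
        unfolding n_def using False by (intro mult_left_mono ball_int_le_maximal) auto
      also have "\<dots> = ennreal (4 ^ DIM('a)) * maximal h x"
        by (simp add: mult.assoc[symmetric] ennreal_mult[symmetric] power_mult_distrib[symmetric])
      finally have "epow (ennreal (norm y powr - n) * ball_int h x (2 * norm y)) (1 / s)
          \<le> epow (ennreal (4 ^ DIM('a)) * maximal h x) (1 / s)"
        using s by (intro epow_mono) auto
      also have "\<dots> = ennreal d1 * M"
        by (simp add: epow_mult M_def d1_def epow_ennreal del: ennreal_power ennreal_numeral)
      finally show ?thesis unfolding J_def by (intro mult_left_mono) auto
    qed (simp add: J_def)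
    have J2: "J y \<le> ennreal (norm y powr (- \<beta> - n)) * (ennreal d2 * N)" for y
    proof (cases "y = 0")
      case False
      have "ennreal (norm y powr - n) * ball_int h x (2 * norm y)
        \<le> ennreal (norm y powr - n) * (ennreal (unit_ball_vol n powr (1 - 1 / t) * (2 * norm y) powr (n * (1 - 1 / t)))
          * epow (\<integral>\<^sup>+z. epow (h z) t \<partial>lborel) (1 / t))"
        unfolding n_def using False t by (intro mult_left_mono ball_int_Hoelder) auto
      also have "\<dots> = ennreal (norm y powr - n * (unit_ball_vol n powr (1 - 1 / t) * (2 * norm y) powr (n * (1 - 1 / t))))
          * epow (\<integral>\<^sup>+z. epow (h z) t \<partial>lborel) (1 / t)"
        by (simp add: ennreal_mult mult.assoc)
      also have "norm y powr - n * (unit_ball_vol n powr (1 - 1 / t) * (2 * norm y) powr (n * (1 - 1 / t)))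
          = (unit_ball_vol n powr (1 - 1 / t) * 2 powr (n * (1 - 1 / t))) * norm y powr (- n / t)"
      proof -
        have "norm y powr - n * norm y powr (n * (1 - 1 / t)) = norm y powr (- n / t)"
          unfolding powr_add[symmetric] by (simp add: algebra_simps)
        then show ?thesis by (simp add: powr_mult mult_ac)
      qed
      finally have "epow (ennreal (norm y powr - n) * ball_int h x (2 * norm y)) (1 / s)
        \<le> epow (ennreal ((unit_ball_vol n powr (1 - 1 / t) * 2 powr (n * (1 - 1 / t))) * norm y powr (- n / t))
           * epow (\<integral>\<^sup>+z. epow (h z) t \<partial>lborel) (1 / t)) (1 / s)"
        using s by (intro epow_mono) auto
      also have "\<dots> = ennreal (d2 * norm y powr (- n / p)) * N"
      proof -
        have "- n / t * (1 / s) = - n / p" using s p by (simp add: t_def)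
        then have "((unit_ball_vol n powr (1 - 1 / t) * 2 powr (n * (1 - 1 / t))) * norm y powr (- n / t)) powr (1 / s)
          = d2 * norm y powr (- n / p)"
          by (simp only: powr_mult d2_def powr_powr)
        moreover have "0 \<le> (unit_ball_vol n powr (1 - 1 / t) * 2 powr (n * (1 - 1 / t))) * norm y powr (- n / t)"
          by simp
        ultimately show ?thesis by (simp only: epow_mult hN epow_ennreal)
      qed
      finally have "J y \<le> ennreal (norm y powr (\<alpha> - n)) * (ennreal (d2 * norm y powr (- n / p)) * N)"
        unfolding J_def by (intro mult_left_mono) auto
      also have "\<dots> = ennreal (norm y powr (\<alpha> - n) * norm y powr (- n / p)) * (ennreal d2 * N)"
        using d by (simp add: ennreal_mult mult_ac)
      also have "norm y powr (\<alpha> - n) * norm y powr (- n / p) = norm y powr (- \<beta> - n)"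
        unfolding powr_add[symmetric] by (simp add: \<beta>_def algebra_simps)
      finally show ?thesis .
    qed (simp add: J_def)
    have split: "(\<integral>\<^sup>+y. J y \<partial>lborel) \<le> ennreal (k1 * d1 * R powr \<alpha>) * M + ennreal (k2 * d2 * R powr - \<beta>) * N"
      if R: "0 < R" for R
    proof -
      have [measurable]: "cball 0 R \<in> sets (borel :: 'a measure)" by simp
      have "J y \<le> ennreal d1 * M * (ennreal (norm y powr (\<alpha> - n)) * indicator (cball 0 R) y)
          + ennreal d2 * N * (ennreal (norm y powr (- \<beta> - n)) * indicator {y. R \<le> norm y} y)" for y
      proof (cases "norm y \<le> R")
        case True
        have "J y \<le> ennreal d1 * M * (ennreal (norm y powr (\<alpha> - n)) * indicator (cball 0 R) y)"
          using J1[of y] True by (simp add: indicator_def mult_ac)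
        then show ?thesis by (rule add_increasing2[rotated]) simp
      next
        case False
        have "J y \<le> ennreal d2 * N * (ennreal (norm y powr (- \<beta> - n)) * indicator {y. R \<le> norm y} y)"
          using J2[of y] False by (simp add: indicator_def mult_ac)
        then show ?thesis by (rule add_increasing[rotated]) simp
      qed
      then have "(\<integral>\<^sup>+y. J y \<partial>lborel)
        \<le> (\<integral>\<^sup>+(y::'a). ennreal d1 * M * (ennreal (norm y powr (\<alpha> - n)) * indicator (cball 0 R) y)
          + ennreal d2 * N * (ennreal (norm y powr (- \<beta> - n)) * indicator {y. R \<le> norm y} y) \<partial>lborel)"
        by (intro nn_integral_mono)
      also have "\<dots> = ennreal d1 * M * (\<integral>\<^sup>+(y::'a). ennreal (norm y powr (\<alpha> - n)) * indicator (cball 0 R) y \<partial>lborel)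
          + ennreal d2 * N * (\<integral>\<^sup>+(y::'a). ennreal (norm y powr (- \<beta> - n)) * indicator {y. R \<le> norm y} y \<partial>lborel)"
        by (subst nn_integral_add, measurable, subst nn_integral_cmult, measurable, subst nn_integral_cmult, measurable)
      also have "\<dots> \<le> ennreal d1 * M * ennreal (k1 * R powr \<alpha>) + ennreal d2 * N * ennreal (k2 * R powr - \<beta>)"
        unfolding n_def by (intro add_mono mult_left_mono k1 k2 R) auto
      also have "\<dots> = ennreal (k1 * d1 * R powr \<alpha>) * M + ennreal (k2 * d2 * R powr - \<beta>) * N"
        using k1 k2 d by (simp add: ennreal_mult mult_ac)
      finally show ?thesis .
    qed
    have "epow (\<integral>\<^sup>+y. J y \<partial>lborel) q \<le> ennreal c * (epow M p * epow N (q - p))"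
    proof -
      consider "M = 0" | "N = 0" | "M \<noteq> 0" "N \<noteq> 0" "M = top \<or> N = top"
        | m k where "M = ennreal m" "N = ennreal k" "0 < m" "0 < k"
        by (metis ennreal_cases ennreal_eq_0_iff not_le)
      then show ?thesis
      proof cases
        case 1
        then have "J = (\<lambda>_. 0)" using J1 by (simp add: fun_eq_iff)
        then show ?thesis by simp
      next
        case 2
        then have "J = (\<lambda>_. 0)" using J2 by (simp add: fun_eq_iff)
        then show ?thesis by simp
      next
        case 3
        then show ?thesis using c by (auto simp: ennreal_mult_top ennreal_top_mult)
      next
        case (4 m k)
        define R where "R = (k / m) powr (1 / (\<alpha> + \<beta>))"
        have R: "0 < R" using 4 by (simp add: R_def)
        define X where "X = m powr (\<beta> / (\<alpha> + \<beta>)) * k powr (\<alpha> / (\<alpha> + \<beta>))"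
        have X: "R powr \<alpha> * m = X" "R powr - \<beta> * k = X"
          unfolding R_def X_def by (rule optimise_radius[OF \<alpha> \<beta> 4(3,4)])+
        have "(\<integral>\<^sup>+y. J y \<partial>lborel) \<le> ennreal (k1 * d1 * R powr \<alpha>) * M + ennreal (k2 * d2 * R powr - \<beta>) * N"
          by (rule split[OF R])
        also have "\<dots> = ennreal (k1 * d1 * (R powr \<alpha> * m) + k2 * d2 * (R powr - \<beta> * k))"
          using 4 k1 k2 d by (simp add: ennreal_mult[symmetric] ennreal_plus[symmetric] mult.assoc del: ennreal_plus)
        also have "\<dots> = ennreal ((k1 * d1 + k2 * d2) * X)" unfolding X by (simp add: algebra_simps)
        finally have "epow (\<integral>\<^sup>+y. J y \<partial>lborel) q \<le> epow (ennreal ((k1 * d1 + k2 * d2) * X)) q"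
          using q0 by (intro epow_mono) auto
        also have "\<dots> = ennreal (((k1 * d1 + k2 * d2) * X) powr q)"
          using c0 by (intro epow_ennreal) (simp add: X_def)
        also have "((k1 * d1 + k2 * d2) * X) powr q = c * (m powr p * k powr (q - p))"
          by (simp only: powr_mult c_def X_def powr_powr e1)
        also have "ennreal \<dots> = ennreal c * (epow M p * epow N (q - p))"
          using c 4 by (simp add: epow_ennreal ennreal_mult)
        finally show ?thesis .
      qed
    qed
    also have "epow M p = epow (maximal (\<lambda>z. epow (g z) s) x) (p / s)"
      by (simp add: M_def epow_epow h_def[abs_def])
    also have "epow N (q - p) = epow (\<integral>\<^sup>+z. epow (g z) p \<partial>lborel) (q / p - 1)"
      using p by (simp add: N_def epow_epow diff_divide_distrib)
    finally show ?thesis by (simp add: pot)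
  qed
  with c show ?thesis using that by blast
qed

text \<open>
  Since \<open>p / s > 1\<close>, the maximal theorem applies to the power \<open>p / s\<close> of the maximal function of \<open>g powr s\<close>.
\<close>

lemma ball_potential_bound:
  fixes \<alpha> p q s :: real
  assumes \<alpha>: "0 < \<alpha>" and s: "0 < s" "s < p" and p\<alpha>: "\<alpha> < DIM('a) / p"
    and q: "1 / q = 1 / p - \<alpha> / DIM('a)"
  obtains c where "0 < c"
    "\<And>g :: 'a::euclidean_space \<Rightarrow> ennreal. g \<in> borel_measurable borel \<Longrightarrow>
      (\<integral>\<^sup>+x. epow (ball_potential \<alpha> s g x) q \<partial>lborel) \<le> ennreal c * epow (\<integral>\<^sup>+z. epow (g z) p \<partial>lborel) (q / p)"
proof -
  obtain c1 where c1: "0 < c1"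
    "\<And>(g :: 'a \<Rightarrow> ennreal) x. g \<in> borel_measurable borel \<Longrightarrow>
      epow (ball_potential \<alpha> s g x) q \<le> ennreal c1 * (epow (maximal (\<lambda>z. epow (g z) s) x) (p / s)
        * epow (\<integral>\<^sup>+z. epow (g z) p \<partial>lborel) (q / p - 1))"
    using ball_potential_Hedberg[OF assms] by metis
  have "1 < p / s" using s by simp
  then obtain c2 where c2: "0 < c2"
    "\<And>h::'a \<Rightarrow> ennreal. h \<in> borel_measurable borel \<Longrightarrow>
      (\<integral>\<^sup>+x. epow (maximal h x) (p / s) \<partial>lborel) \<le> ennreal c2 * (\<integral>\<^sup>+x. epow (h x) (p / s) \<partial>lborel)"
    using maximal_strong_type[where 'a = 'a] by metis
  have "(\<integral>\<^sup>+x. epow (ball_potential \<alpha> s g x) q \<partial>lborel)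
      \<le> ennreal (c1 * c2) * epow (\<integral>\<^sup>+z. epow (g z) p \<partial>lborel) (q / p)"
    if g[measurable]: "g \<in> borel_measurable borel" for g :: "'a \<Rightarrow> ennreal"
  proof -
    define P where "P = (\<integral>\<^sup>+z. epow (g z) p \<partial>lborel)"
    have "(\<integral>\<^sup>+x. epow (ball_potential \<alpha> s g x) q \<partial>lborel)
      \<le> (\<integral>\<^sup>+x. ennreal c1 * (epow (maximal (\<lambda>z. epow (g z) s) x) (p / s) * epow P (q / p - 1)) \<partial>lborel)"
      unfolding P_def by (intro nn_integral_mono c1 g)
    also have "\<dots> = ennreal c1 * ((\<integral>\<^sup>+x. epow (maximal (\<lambda>z. epow (g z) s) x) (p / s) \<partial>lborel) * epow P (q / p - 1))"
      by (subst nn_integral_cmult, measurable, subst nn_integral_multc, measurable)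
    also have "\<dots> \<le> ennreal c1 * ((ennreal c2 * (\<integral>\<^sup>+x. epow (epow (g x) s) (p / s) \<partial>lborel)) * epow P (q / p - 1))"
      by (intro mult_left_mono mult_right_mono c2) auto
    also have "(\<integral>\<^sup>+x. epow (epow (g x) s) (p / s) \<partial>lborel) = epow P 1"
      using s by (simp add: epow_epow P_def)
    also have "ennreal c1 * ((ennreal c2 * epow P 1) * epow P (q / p - 1))
        = ennreal (c1 * c2) * (epow P 1 * epow P (q / p - 1))"
      using c1 c2 by (simp add: ennreal_mult mult_ac)
    also have "epow P 1 * epow P (q / p - 1) = epow P (q / p)"
      unfolding epow_add_exp[symmetric] by simp
    finally show ?thesis unfolding P_def .
  qed
  then show ?thesis using that[of "c1 * c2"] c1 c2 by simp
qed

section \<open>The part of the potential away from the point\<close>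

text \<open>
  For \<open>norm y \<ge> norm x / 4\<close> the ball of radius \<open>2 norm y\<close> around \<open>x\<close> is contained in that of radius
  \<open>6 norm y\<close> around the origin, so this dominates the part of the potential with such \<open>y\<close>.
\<close>

definition hardy_potential :: "real \<Rightarrow> real \<Rightarrow> ('a::euclidean_space \<Rightarrow> ennreal) \<Rightarrow> 'a \<Rightarrow> ennreal" where
  "hardy_potential \<alpha> s g x = (\<integral>\<^sup>+(y::'a). ennreal (norm y powr (\<alpha> - real DIM('a))) *
     epow (ennreal (norm y powr - real DIM('a)) * ball_int (\<lambda>z. epow (g z) s) 0 (6 * norm y)) (1 / s)
     * indicator {y. norm x / 4 \<le> norm y} y \<partial>lborel)"

lemma measurable_hardy_potential [measurable]:
  fixes g :: "'a::euclidean_space \<Rightarrow> ennreal" and \<alpha> s :: real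
  assumes [measurable]: "g \<in> borel_measurable borel"
  shows "hardy_potential \<alpha> s g \<in> borel_measurable borel"
  unfolding hardy_potential_def[abs_def] by measurable

lemma AE_lborel_nonzero: "AE x in lborel. x \<noteq> (0::'a::euclidean_space)"
  by (rule AE_lborel_singleton)

text \<open>Hoelder's inequality against a power weight; \<open>w\<close> is small enough for the dual weight to be integrable.\<close>

lemma ball_int_weighted_Hoelder:
  fixes w s p :: real
  assumes s: "0 < s" "s < p" and w: "w < DIM('a) / s - DIM('a) / p"
  obtains c where "0 < c"
    "\<And>(g :: 'a::euclidean_space \<Rightarrow> ennreal) \<rho>. g \<in> borel_measurable borel \<Longrightarrow> 0 < \<rho> \<Longrightarrow>
      epow (ball_int (\<lambda>z. epow (g z) s) 0 \<rho>) (1 / s)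
      \<le> ennreal (c * \<rho> powr (DIM('a) / s - DIM('a) / p - w))
        * epow (ball_int (\<lambda>z. ennreal (norm z powr (w * p)) * epow (g z) p) 0 \<rho>) (1 / p)"
proof -
  define n where "n = real DIM('a)"
  have n: "0 < n" by (simp add: n_def)
  have p: "0 < p" using s by simp
  define t where "t = p / s"
  define t' where "t' = p / (p - s)"
  have t: "1 < t" "1 < t'" "1 / t + 1 / t' = 1" using s by (simp_all add: t_def t'_def field_simps)
  have t'e: "1 / t' = 1 - s / p" using s by (simp add: t'_def field_simps)
  define a where "a = n - w * s * t'"
  have a: "0 < a"
  proof -
    have "w < (n / s) * (1 / t')" using w s p unfolding t'e n_def by (simp add: field_simps)
    then show ?thesis using s t by (simp add: a_def field_simps)
  qed
  obtain k where k: "0 < k"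
    "\<And>R. 0 < R \<Longrightarrow> (\<integral>\<^sup>+(y::'a). ennreal (norm y powr (a - DIM('a))) * indicator (cball 0 R) y \<partial>lborel)
       \<le> ennreal (k * R powr a)"
    by (rule nn_integral_norm_powr_cball[OF a]) (rule that)
  define c where "c = (k powr (1 / t')) powr (1 / s)"
  have "epow (ball_int (\<lambda>z. epow (g z) s) 0 \<rho>) (1 / s)
      \<le> ennreal (c * \<rho> powr (n / s - n / p - w))
        * epow (ball_int (\<lambda>z. ennreal (norm z powr (w * p)) * epow (g z) p) 0 \<rho>) (1 / p)"
    if g[measurable]: "g \<in> borel_measurable borel" and \<rho>: "0 < \<rho>" for g :: "'a \<Rightarrow> ennreal" and \<rho>
  proof -
    define F where "F = ball_int (\<lambda>z. ennreal (norm z powr (w * p)) * epow (g z) p) 0 \<rho>"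
    have [measurable]: "ball (0::'a) \<rho> \<in> sets borel" by simp
    define u where "u z = ennreal (norm z powr (w * s)) * epow (g z) s * indicator (ball 0 \<rho>) z" for z :: 'a
    define v where "v z = ennreal (norm z powr - (w * s)) * indicator (ball 0 \<rho>) z" for z :: 'a
    have [measurable]: "u \<in> borel_measurable borel" "v \<in> borel_measurable borel"
      unfolding u_def v_def by measurable
    have uv: "epow (g z) s * indicator (ball 0 \<rho>) z = u z * v z" if "z \<noteq> 0" for z
    proof -
      have "ennreal (norm z powr (w * s)) * ennreal (norm z powr - (w * s)) = 1"
        using that by (simp add: ennreal_mult[symmetric] powr_minus)
      then show ?thesis by (simp add: u_def v_def indicator_def mult_ac)
    qed
    have "ball_int (\<lambda>z. epow (g z) s) 0 \<rho> = (\<integral>\<^sup>+z. u z * v z \<partial>lborel)"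
      unfolding ball_int_def using AE_lborel_nonzero
      by (intro nn_integral_cong_AE) (auto elim!: eventually_mono simp: uv)
    also have "\<dots> \<le> epow (\<integral>\<^sup>+z. epow (u z) t \<partial>lborel) (1 / t) * epow (\<integral>\<^sup>+z. epow (v z) t' \<partial>lborel) (1 / t')"
      by (intro nn_integral_Hoelder t) measurable
    also have "(\<integral>\<^sup>+z. epow (u z) t \<partial>lborel) = F"
      unfolding F_def ball_int_def
    proof (intro nn_integral_cong)
      fix z :: 'a
      have "w * s * t = w * p" "s * t = p" using s by (simp_all add: t_def)
      then show "epow (u z) t = ennreal (norm z powr (w * p)) * epow (g z) p * indicator (ball 0 \<rho>) z"
        by (cases "z \<in> ball 0 \<rho>") (auto simp: u_def epow_mult epow_ennreal powr_powr epow_epow mult.assoc)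
    qed
    also have "(\<integral>\<^sup>+z. epow (v z) t' \<partial>lborel) \<le> (\<integral>\<^sup>+(z::'a). ennreal (norm z powr (a - DIM('a))) * indicator (cball 0 \<rho>) z \<partial>lborel)"
    proof (intro nn_integral_mono)
      fix z :: 'a
      have "a - DIM('a) = - (w * s) * t'" by (simp add: a_def n_def)
      then show "epow (v z) t' \<le> ennreal (norm z powr (a - DIM('a))) * indicator (cball 0 \<rho>) z"
        by (cases "z \<in> ball 0 \<rho>") (auto simp: v_def epow_ennreal powr_powr)
    qed
    also have "\<dots> \<le> ennreal (k * \<rho> powr a)" by (intro k \<rho>)
    finally have "ball_int (\<lambda>z. epow (g z) s) 0 \<rho> \<le> epow F (1 / t) * epow (ennreal (k * \<rho> powr a)) (1 / t')"
      using t by (simp add: epow_mono mult_left_mono)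
    then have "epow (ball_int (\<lambda>z. epow (g z) s) 0 \<rho>) (1 / s)
        \<le> epow (epow F (1 / t) * epow (ennreal (k * \<rho> powr a)) (1 / t')) (1 / s)"
      using s by (intro epow_mono) auto
    also have "\<dots> = ennreal (((k * \<rho> powr a) powr (1 / t')) powr (1 / s)) * epow F (1 / t * (1 / s))"
      using k by (simp add: epow_mult epow_ennreal epow_epow mult_ac del: times_divide_eq_right)
    also have "((k * \<rho> powr a) powr (1 / t')) powr (1 / s) = c * \<rho> powr (n / s - n / p - w)"
    proof -
      have "a * (1 / t') * (1 / s) = (n * (1 / t') - w * s) / s"
        using t by (simp add: a_def field_simps)
      also have "\<dots> = n / s - n / p - w" using s p unfolding t'e by (simp add: field_simps)
      finally have "a * (1 / t') * (1 / s) = n / s - n / p - w" .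
      then show ?thesis by (simp only: powr_mult c_def powr_powr)
    qed
    also have "1 / t * (1 / s) = 1 / p" using s by (simp add: t_def)
    finally show ?thesis unfolding F_def .
  qed
  moreover have "0 < c" using k by (simp add: c_def)
  ultimately show ?thesis using that unfolding n_def by blast
qed

text \<open>
  Hardy's inequality.  The strict inequalities for the weight leave room for auxiliary power weights
  \<open>norm z powr \<eta>\<close> and \<open>norm y powr \<tau>\<close>, which turn each application of Hoelder's inequality into one
  with a convergent power integral; Fubini's theorem does the rest.
\<close>

lemma hardy_potential_bound:
  fixes \<alpha> p q s l :: real
  assumes \<alpha>: "0 < \<alpha>" and s: "0 < s" "s < p" and pq: "1 < q" "p < q"
    and q: "1 / q = 1 / p - \<alpha> / DIM('a)"
    and l: "- (DIM('a) / q) < l" "l < DIM('a) / s - DIM('a) / p"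
  obtains c where "0 < c"
    "\<And>g :: 'a::euclidean_space \<Rightarrow> ennreal. g \<in> borel_measurable borel \<Longrightarrow>
      (\<integral>\<^sup>+x. ennreal (norm x powr (l * q)) * epow (hardy_potential \<alpha> s g x) q \<partial>lborel)
      \<le> ennreal c * epow (\<integral>\<^sup>+z. ennreal (norm z powr (l * p)) * epow (g z) p \<partial>lborel) (q / p)"
proof -
  define n where "n = real DIM('a)"
  have n: "0 < n" by (simp add: n_def)
  have p: "0 < p" and q0: "0 < q" using s pq by simp_all
  define \<eta> where "\<eta> = (n / s - n / p - l) / 2"
  define \<tau> where "\<tau> = (l + n / q) / 2"
  define w where "w = l + \<eta>"
  have \<eta>: "0 < \<eta>" and w: "w < n / s - n / p" using l unfolding w_def \<eta>_def n_def by argo+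
  have \<tau>: "0 < \<tau>" and lt: "\<tau> < l + n / q" using l by (auto simp: \<tau>_def n_def)
  have \<alpha>e: "\<alpha> = n / p - n / q"
  proof -
    have "n * (1 / q) = n * (1 / p - \<alpha> / n)" using q by (simp add: n_def)
    then show ?thesis using n by (simp add: right_diff_distrib)
  qed
  obtain c1 where c1: "0 < c1"
    "\<And>(g :: 'a \<Rightarrow> ennreal) \<rho>. g \<in> borel_measurable borel \<Longrightarrow> 0 < \<rho> \<Longrightarrow>
      epow (ball_int (\<lambda>z. epow (g z) s) 0 \<rho>) (1 / s)
      \<le> ennreal (c1 * \<rho> powr (n / s - n / p - w))
        * epow (ball_int (\<lambda>z. ennreal (norm z powr (w * p)) * epow (g z) p) 0 \<rho>) (1 / p)"
    by (rule ball_int_weighted_Hoelder[OF s w[unfolded n_def], folded n_def]) (rule that)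
  define q' where "q' = q / (q - 1)"
  have q': "1 < q'" "1 / q + 1 / q' = 1" "1 / q' + 1 / q = 1" "1 / q' = 1 - 1 / q" "0 < q'"
    using pq by (simp_all add: q'_def field_simps)
  have \<tau>q'_pos: "0 < \<tau> * q'" using \<tau> q' by simp
  obtain k2 where k2: "0 < k2"
    "\<And>R. 0 < R \<Longrightarrow> (\<integral>\<^sup>+(y::'a). ennreal (norm y powr (- (\<tau> * q') - DIM('a))) * indicator {y. R \<le> norm y} y \<partial>lborel)
       \<le> ennreal (k2 * R powr - (\<tau> * q'))"
    by (rule nn_integral_norm_powr_outside[OF \<tau>q'_pos]) (rule that)
  define b where "b = (l - \<tau>) * q + n"
  have b: "0 < b" using lt q0 by (simp add: b_def field_simps)
  obtain k3 where k3: "0 < k3"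
    "\<And>R. 0 < R \<Longrightarrow> (\<integral>\<^sup>+(y::'a). ennreal (norm y powr (b - DIM('a))) * indicator (cball 0 R) y \<partial>lborel)
       \<le> ennreal (k3 * R powr b)"
    by (rule nn_integral_norm_powr_cball[OF b]) (rule that)
  have \<eta>p_pos: "0 < \<eta> * p" using \<eta> p by simp
  obtain k4 where k4: "0 < k4"
    "\<And>R. 0 < R \<Longrightarrow> (\<integral>\<^sup>+(y::'a). ennreal (norm y powr (- (\<eta> * p) - DIM('a))) * indicator {y. R \<le> norm y} y \<partial>lborel)
       \<le> ennreal (k4 * R powr - (\<eta> * p))"
    by (rule nn_integral_norm_powr_outside[OF \<eta>p_pos]) (rule that)
  \<comment> \<open>The constants that arise in the estimates \<open>mean\<close>, \<open>pointwise\<close>, \<open>inner\<close>, \<open>F_split\<close> and \<open>last\<close>.\<close>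
  define d1 where "d1 = c1 * 6 powr (n / s - n / p - w)"
  define d2 where "d2 = (d1 * k2 powr (1 / q') * 4 powr \<tau>) powr q"
  define d3 where "d3 = k3 * 4 powr b"
  define d4 where "d4 = 6 powr (\<eta> * (q - p))"
  define d5 where "d5 = k4 * 6 powr (\<eta> * p)"
  have d: "0 < d1" "0 < d2" "0 < d3" "0 < d4" "0 < d5"
    using c1 k2 k3 k4 by (simp_all add: d1_def d2_def d3_def d4_def d5_def)
  define c where "c = d2 * (d3 * (d4 * d5))"
  have "(\<integral>\<^sup>+x. ennreal (norm x powr (l * q)) * epow (hardy_potential \<alpha> s g x) q \<partial>lborel)
      \<le> ennreal c * epow (\<integral>\<^sup>+z. ennreal (norm z powr (l * p)) * epow (g z) p \<partial>lborel) (q / p)"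
    if g[measurable]: "g \<in> borel_measurable borel" for g :: "'a \<Rightarrow> ennreal"
  proof -
    define F where "F \<rho> = ball_int (\<lambda>z. ennreal (norm z powr (w * p)) * epow (g z) p) (0::'a) \<rho>" for \<rho>
    have [measurable]: "F \<in> borel_measurable borel" unfolding F_def by measurable
    define P where "P = (\<integral>\<^sup>+z. ennreal (norm z powr (l * p)) * epow (g z) p \<partial>lborel)"

    have mean: "ennreal (norm y powr (\<alpha> - n)) * epow (ennreal (norm y powr - n) * ball_int (\<lambda>z. epow (g z) s) 0 (6 * norm y)) (1 / s)
        \<le> ennreal d1 * (ennreal (norm y powr (- n - n / q - w)) * epow (F (6 * norm y)) (1 / p))" for y :: 'a
    proof (cases "y = 0")
      case False
      have e: "norm y powr (\<alpha> - n) * (norm y powr (- n / s) * (6 * norm y) powr (n / s - n / p - w))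
          = 6 powr (n / s - n / p - w) * norm y powr (- n - n / q - w)"
      proof -
        have "norm y powr (\<alpha> - n) * (norm y powr (- n / s) * norm y powr (n / s - n / p - w))
          = norm y powr (- n - n / q - w)"
          unfolding powr_add[symmetric] \<alpha>e by (rule arg_cong[of _ _ "(powr) (norm y)"]) simp
        then show ?thesis by (simp add: powr_mult mult_ac)
      qed
      have "epow (ennreal (norm y powr - n) * ball_int (\<lambda>z. epow (g z) s) 0 (6 * norm y)) (1 / s)
        = ennreal (norm y powr (- n / s)) * epow (ball_int (\<lambda>z. epow (g z) s) 0 (6 * norm y)) (1 / s)"
        by (simp add: epow_mult epow_ennreal powr_powr)
      also have "\<dots> \<le> ennreal (norm y powr (- n / s)) * (ennreal (c1 * (6 * norm y) powr (n / s - n / p - w)) * epow (F (6 * norm y)) (1 / p))"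
        unfolding F_def using False by (intro mult_left_mono c1 g) auto
      finally have "ennreal (norm y powr (\<alpha> - n)) * epow (ennreal (norm y powr - n) * ball_int (\<lambda>z. epow (g z) s) 0 (6 * norm y)) (1 / s)
        \<le> ennreal (norm y powr (\<alpha> - n)) * (ennreal (norm y powr (- n / s)) * (ennreal (c1 * (6 * norm y) powr (n / s - n / p - w)) * epow (F (6 * norm y)) (1 / p)))"
        by (intro mult_left_mono) auto
      also have "\<dots> = ennreal (c1 * (norm y powr (\<alpha> - n) * (norm y powr (- n / s) * (6 * norm y) powr (n / s - n / p - w)))) * epow (F (6 * norm y)) (1 / p)"
        using c1 by (simp add: ennreal_mult mult_ac)
      also have "\<dots> = ennreal d1 * (ennreal (norm y powr (- n - n / q - w)) * epow (F (6 * norm y)) (1 / p))"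
        unfolding e using c1 by (simp add: d1_def ennreal_mult mult_ac)
      finally show ?thesis .
    qed simp

    define K where "K y = ennreal (norm y powr (- 2 * n - w * q + \<tau> * q)) * epow (F (6 * norm y)) (q / p)" for y :: 'a
    have [measurable]: "K \<in> borel_measurable borel" unfolding K_def by measurable
    have pointwise: "ennreal (norm x powr (l * q)) * epow (hardy_potential \<alpha> s g x) q
        \<le> ennreal d2 * (ennreal (norm x powr (b - n)) * (\<integral>\<^sup>+y. K y * indicator {y. norm x / 4 \<le> norm y} y \<partial>lborel))" for x :: 'a
    proof (cases "x = 0")
      case False
      define S where "S = {y::'a. norm x / 4 \<le> norm y}"
      have [measurable]: "S \<in> sets borel" unfolding S_def by measurable
      define u where "u y = ennreal (norm y powr (- n / q' - \<tau>)) * indicator S y" for y :: 'a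
      define v where "v y = ennreal (norm y powr (\<tau> - 2 * n / q - w)) * epow (F (6 * norm y)) (1 / p) * indicator S y" for y :: 'a
      have [measurable]: "u \<in> borel_measurable borel" "v \<in> borel_measurable borel"
        unfolding u_def v_def by measurable
      have e: "- n - n / q - w = (- n / q' - \<tau>) + (\<tau> - 2 * n / q - w)"
      proof -
        have "n / q' = n - n / q" using arg_cong[OF q'(4), of "\<lambda>z. n * z"] by (simp add: right_diff_distrib)
        then show ?thesis by simp
      qed
      have uv: "ennreal (norm y powr (- n - n / q - w)) * epow (F (6 * norm y)) (1 / p) * indicator S y = u y * v y" for y
        unfolding e powr_add by (simp add: u_def v_def ennreal_mult mult_ac indicator_def)
      have "hardy_potential \<alpha> s g x
          \<le> (\<integral>\<^sup>+y. ennreal d1 * (ennreal (norm y powr (- n - n / q - w)) * epow (F (6 * norm y)) (1 / p)) * indicator S y \<partial>lborel)"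
        unfolding hardy_potential_def S_def n_def[symmetric] by (intro nn_integral_mono mult_right_mono mean) auto
      also have "\<dots> = ennreal d1 * (\<integral>\<^sup>+y. u y * v y \<partial>lborel)"
        unfolding uv[symmetric] mult.assoc by (rule nn_integral_cmult) measurable
      also have "\<dots> \<le> ennreal d1 * (epow (\<integral>\<^sup>+y. epow (u y) q' \<partial>lborel) (1 / q') * epow (\<integral>\<^sup>+y. epow (v y) q \<partial>lborel) (1 / q))"
        using pq q' by (intro mult_left_mono nn_integral_Hoelder) measurable
      also have "(\<integral>\<^sup>+y. epow (u y) q' \<partial>lborel) = (\<integral>\<^sup>+(y::'a). ennreal (norm y powr (- (\<tau> * q') - DIM('a))) * indicator {y. norm x / 4 \<le> norm y} y \<partial>lborel)"
      proof (intro nn_integral_cong)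
        fix y :: 'a
        have "(- n / q' - \<tau>) * q' = - (\<tau> * q') - DIM('a)" using q' by (simp add: n_def field_simps)
        then show "epow (u y) q' = ennreal (norm y powr (- (\<tau> * q') - DIM('a))) * indicator {y. norm x / 4 \<le> norm y} y"
          by (cases "y \<in> S") (auto simp: u_def epow_ennreal powr_powr S_def)
      qed
      also have "\<dots> \<le> ennreal (k2 * (norm x / 4) powr - (\<tau> * q'))" using False by (intro k2) auto
      also have "(\<integral>\<^sup>+y. epow (v y) q \<partial>lborel) = (\<integral>\<^sup>+y. K y * indicator S y \<partial>lborel)"
      proof (intro nn_integral_cong)
        fix y :: 'a
        have "(\<tau> - 2 * n / q - w) * q = - 2 * n - w * q + \<tau> * q" using q0 by (simp add: field_simps)
        then show "epow (v y) q = K y * indicator S y"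
          by (cases "y \<in> S") (auto simp: v_def K_def epow_mult epow_ennreal powr_powr epow_epow)
      qed
      finally have "hardy_potential \<alpha> s g x
          \<le> ennreal d1 * (epow (ennreal (k2 * (norm x / 4) powr - (\<tau> * q'))) (1 / q') * epow (\<integral>\<^sup>+y. K y * indicator S y \<partial>lborel) (1 / q))"
        using \<open>0 < q'\<close> by (simp add: epow_mono mult_left_mono mult_right_mono)
      also have "epow (ennreal (k2 * (norm x / 4) powr - (\<tau> * q'))) (1 / q')
          = ennreal (k2 powr (1 / q') * 4 powr \<tau> * norm x powr - \<tau>)"
      proof -
        have "- (\<tau> * q') * (1 / q') = - \<tau>" using \<open>0 < q'\<close> by simp
        then have "(k2 * (norm x / 4) powr - (\<tau> * q')) powr (1 / q') = k2 powr (1 / q') * (norm x / 4) powr - \<tau>"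
          by (simp only: powr_mult powr_powr)
        also have "(norm x / 4) powr - \<tau> = 4 powr \<tau> * norm x powr - \<tau>"
          by (simp only: powr_divide powr_minus) (simp add: divide_inverse)
        finally show ?thesis using k2 by (simp add: epow_ennreal mult_ac)
      qed
      finally have "epow (hardy_potential \<alpha> s g x) q
          \<le> epow (ennreal d1 * (ennreal (k2 powr (1 / q') * 4 powr \<tau> * norm x powr - \<tau>) * epow (\<integral>\<^sup>+y. K y * indicator S y \<partial>lborel) (1 / q))) q"
        using q0 by (intro epow_mono) auto
      also have "\<dots> = epow (ennreal ((d1 * k2 powr (1 / q') * 4 powr \<tau>) * norm x powr - \<tau>)) q * (\<integral>\<^sup>+y. K y * indicator S y \<partial>lborel)"
        using d q0 by (simp add: epow_mult[symmetric] epow_epow ennreal_mult mult.assoc) (simp add: epow_mult epow_epow mult.assoc)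
      also have "epow (ennreal ((d1 * k2 powr (1 / q') * 4 powr \<tau>) * norm x powr - \<tau>)) q = ennreal (d2 * norm x powr (- \<tau> * q))"
        using d by (subst epow_ennreal) (simp_all only: powr_mult powr_powr d2_def, simp)
      finally have "ennreal (norm x powr (l * q)) * epow (hardy_potential \<alpha> s g x) q
          \<le> ennreal (norm x powr (l * q)) * (ennreal (d2 * norm x powr (- \<tau> * q)) * (\<integral>\<^sup>+y. K y * indicator S y \<partial>lborel))"
        by (intro mult_left_mono) auto
      also have "\<dots> = ennreal d2 * (ennreal (norm x powr (l * q) * norm x powr (- \<tau> * q)) * (\<integral>\<^sup>+y. K y * indicator S y \<partial>lborel))"
        using d by (simp add: ennreal_mult mult_ac)
      also have "norm x powr (l * q) * norm x powr (- \<tau> * q) = norm x powr (b - n)"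
        unfolding powr_add[symmetric] by (simp add: b_def algebra_simps)
      finally show ?thesis unfolding S_def .
    qed simp

    have inner: "(\<integral>\<^sup>+x. ennreal (norm x powr (b - n)) * (K y * indicator {y. norm x / 4 \<le> norm y} y) \<partial>(lborel::'a measure))
        \<le> ennreal d3 * (ennreal (norm y powr (- n - \<eta> * q)) * epow (F (6 * norm y)) (q / p))" for y :: 'a
    proof (cases "y = 0")
      case False
      have [measurable]: "cball 0 (4 * norm y) \<in> sets (borel :: 'a measure)" by simp
      have "(\<integral>\<^sup>+x. ennreal (norm x powr (b - n)) * (K y * indicator {y. norm x / 4 \<le> norm y} y) \<partial>(lborel::'a measure))
        = (\<integral>\<^sup>+x. K y * (ennreal (norm x powr (b - n)) * indicator (cball 0 (4 * norm y)) x) \<partial>(lborel::'a measure))"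
        by (intro nn_integral_cong) (auto simp: indicator_def mult_ac)
      also have "\<dots> = K y * (\<integral>\<^sup>+(x::'a). ennreal (norm x powr (b - n)) * indicator (cball 0 (4 * norm y)) x \<partial>lborel)"
        by (rule nn_integral_cmult) measurable
      also have "\<dots> \<le> K y * ennreal (k3 * (4 * norm y) powr b)"
        unfolding n_def using False by (intro mult_left_mono k3) auto
      also have "\<dots> = ennreal (norm y powr (- 2 * n - w * q + \<tau> * q) * (k3 * (4 * norm y) powr b)) * epow (F (6 * norm y)) (q / p)"
        using k3 by (simp add: K_def ennreal_mult mult_ac)
      also have "norm y powr (- 2 * n - w * q + \<tau> * q) * (k3 * (4 * norm y) powr b) = d3 * norm y powr (- n - \<eta> * q)"
      proof -
        have "norm y powr (- 2 * n - w * q + \<tau> * q) * norm y powr b = norm y powr (- n - \<eta> * q)"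
          unfolding powr_add[symmetric] by (simp add: b_def w_def algebra_simps)
        then show ?thesis by (simp add: powr_mult d3_def mult_ac)
      qed
      finally show ?thesis using d by (simp add: ennreal_mult mult_ac)
    qed (simp add: K_def)

    have F_le: "F \<rho> \<le> ennreal (\<rho> powr (\<eta> * p)) * P" if "0 < \<rho>" for \<rho>
    proof -
      have "F \<rho> \<le> (\<integral>\<^sup>+z. ennreal (\<rho> powr (\<eta> * p)) * (ennreal (norm z powr (l * p)) * epow (g z) p) \<partial>lborel)"
        unfolding F_def ball_int_def
      proof (intro nn_integral_mono)
        fix z :: 'a
        have "norm z powr (w * p) = norm z powr (\<eta> * p) * norm z powr (l * p)"
          unfolding powr_add[symmetric] by (simp add: w_def algebra_simps)
        also have "\<dots> \<le> \<rho> powr (\<eta> * p) * norm z powr (l * p)" if "norm z < \<rho>"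
          using that \<eta> p by (intro mult_right_mono powr_mono2) auto
        finally show "ennreal (norm z powr (w * p)) * epow (g z) p * indicator (ball 0 \<rho>) z
            \<le> ennreal (\<rho> powr (\<eta> * p)) * (ennreal (norm z powr (l * p)) * epow (g z) p)"
          by (cases "norm z < \<rho>") (auto simp: mult.assoc[symmetric] ennreal_mult[symmetric] intro!: mult_right_mono)
      qed
      also have "\<dots> = ennreal (\<rho> powr (\<eta> * p)) * P"
        unfolding P_def by (rule nn_integral_cmult) measurable
      finally show ?thesis .
    qed
    have F_split: "ennreal (norm y powr (- n - \<eta> * q)) * epow (F (6 * norm y)) (q / p)
        \<le> ennreal d4 * (ennreal (norm y powr (- (\<eta> * p) - n)) * F (6 * norm y)) * epow P (q / p - 1)" for y :: 'a
    proof (cases "y = 0")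
      case False
      have e1: "q / p = 1 + (q / p - 1)" by simp
      have e2: "\<eta> * p * (q / p - 1) = \<eta> * (q - p)" using p by (simp add: field_simps)
      have "epow (F (6 * norm y)) (q / p) = F (6 * norm y) * epow (F (6 * norm y)) (q / p - 1)"
        by (subst e1, subst epow_add_exp) simp
      also have "\<dots> \<le> F (6 * norm y) * epow (ennreal ((6 * norm y) powr (\<eta> * p)) * P) (q / p - 1)"
        using False pq p by (intro mult_left_mono epow_mono F_le) (auto simp: field_simps)
      also have "\<dots> = F (6 * norm y) * (ennreal (d4 * norm y powr (\<eta> * (q - p))) * epow P (q / p - 1))"
        by (simp add: epow_mult epow_ennreal powr_powr powr_mult e2 d4_def del: times_divide_eq_right)
      finally have "ennreal (norm y powr (- n - \<eta> * q)) * epow (F (6 * norm y)) (q / p)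
          \<le> ennreal (norm y powr (- n - \<eta> * q)) * (F (6 * norm y) * (ennreal (d4 * norm y powr (\<eta> * (q - p))) * epow P (q / p - 1)))"
        by (intro mult_left_mono) auto
      also have "\<dots> = ennreal d4 * (ennreal (norm y powr (- n - \<eta> * q) * norm y powr (\<eta> * (q - p))) * F (6 * norm y)) * epow P (q / p - 1)"
        using d by (simp add: ennreal_mult mult_ac)
      also have "norm y powr (- n - \<eta> * q) * norm y powr (\<eta> * (q - p)) = norm y powr (- (\<eta> * p) - n)"
        unfolding powr_add[symmetric] by (rule arg_cong[of _ _ "(powr) (norm y)"]) (simp add: algebra_simps)
      finally show ?thesis .
    qed simp

    have last: "(\<integral>\<^sup>+(y::'a). ennreal (norm y powr (- (\<eta> * p) - n)) * F (6 * norm y) \<partial>lborel) \<le> ennreal d5 * P"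
    proof -
      have "(\<integral>\<^sup>+(y::'a). ennreal (norm y powr (- (\<eta> * p) - n)) * F (6 * norm y) \<partial>lborel)
        = (\<integral>\<^sup>+(y::'a). (\<integral>\<^sup>+z. ennreal (norm y powr (- (\<eta> * p) - n)) * (ennreal (norm z powr (w * p)) * epow (g z) p * indicator {z. norm z < 6 * norm y} z) \<partial>lborel) \<partial>lborel)"
        unfolding F_def ball_int_def
        by (intro nn_integral_cong, subst nn_integral_cmult[symmetric], measurable) (auto intro!: nn_integral_cong simp: indicator_def)
      also have "\<dots> = (\<integral>\<^sup>+z. (\<integral>\<^sup>+(y::'a). ennreal (norm y powr (- (\<eta> * p) - n)) * (ennreal (norm z powr (w * p)) * epow (g z) p * indicator {z. norm z < 6 * norm y} z) \<partial>lborel) \<partial>lborel)"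
        by (rule lborel_pair.Fubini') measurable
      also have "\<dots> \<le> (\<integral>\<^sup>+z. ennreal d5 * (ennreal (norm z powr (l * p)) * epow (g z) p) \<partial>lborel)"
      proof (rule nn_integral_mono_AE)
        show "AE z in lborel. (\<integral>\<^sup>+(y::'a). ennreal (norm y powr (- (\<eta> * p) - n)) * (ennreal (norm z powr (w * p)) * epow (g z) p * indicator {z. norm z < 6 * norm y} z) \<partial>lborel)
          \<le> ennreal d5 * (ennreal (norm z powr (l * p)) * epow (g z) p)"
          using AE_lborel_nonzero
        proof eventually_elim
          case (elim z)
          have "(\<integral>\<^sup>+(y::'a). ennreal (norm y powr (- (\<eta> * p) - n)) * (ennreal (norm z powr (w * p)) * epow (g z) p * indicator {z. norm z < 6 * norm y} z) \<partial>lborel)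
            \<le> (\<integral>\<^sup>+(y::'a). (ennreal (norm z powr (w * p)) * epow (g z) p) * (ennreal (norm y powr (- (\<eta> * p) - n)) * indicator {y. norm z / 6 \<le> norm y} y) \<partial>lborel)"
            by (intro nn_integral_mono) (auto simp: indicator_def mult_ac)
          also have "\<dots> = (ennreal (norm z powr (w * p)) * epow (g z) p) * (\<integral>\<^sup>+(y::'a). ennreal (norm y powr (- (\<eta> * p) - n)) * indicator {y. norm z / 6 \<le> norm y} y \<partial>lborel)"
            by (rule nn_integral_cmult) measurable
          also have "\<dots> \<le> (ennreal (norm z powr (w * p)) * epow (g z) p) * ennreal (k4 * (norm z / 6) powr - (\<eta> * p))"
            unfolding n_def using elim by (intro mult_left_mono k4) auto
          also have "\<dots> = ennreal (norm z powr (w * p) * (k4 * (norm z / 6) powr - (\<eta> * p))) * epow (g z) p"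
            using k4 by (simp add: ennreal_mult mult_ac)
          also have "norm z powr (w * p) * (k4 * (norm z / 6) powr - (\<eta> * p)) = d5 * norm z powr (l * p)"
          proof -
            have "(norm z / 6) powr - (\<eta> * p) = 6 powr (\<eta> * p) * norm z powr - (\<eta> * p)"
              by (simp only: powr_divide powr_minus) (simp add: divide_inverse)
            moreover have "norm z powr (w * p) * norm z powr - (\<eta> * p) = norm z powr (l * p)"
              unfolding powr_add[symmetric] by (simp add: w_def algebra_simps)
            ultimately show ?thesis by (simp add: d5_def mult_ac)
          qed
          finally show ?case using d by (simp add: ennreal_mult mult_ac)
        qed
      qed
      also have "\<dots> = ennreal d5 * P" unfolding P_def by (rule nn_integral_cmult) measurable
      finally show ?thesis .
    qed

    have "(\<integral>\<^sup>+x. ennreal (norm x powr (l * q)) * epow (hardy_potential \<alpha> s g x) q \<partial>lborel)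
      \<le> (\<integral>\<^sup>+(x::'a). ennreal d2 * (\<integral>\<^sup>+y. ennreal (norm x powr (b - n)) * (K y * indicator {y. norm x / 4 \<le> norm y} y) \<partial>lborel) \<partial>lborel)"
    proof (rule nn_integral_mono)
      fix x :: 'a
      have "ennreal (norm x powr (b - n)) * (\<integral>\<^sup>+y. K y * indicator {y. norm x / 4 \<le> norm y} y \<partial>lborel)
        = (\<integral>\<^sup>+y. ennreal (norm x powr (b - n)) * (K y * indicator {y. norm x / 4 \<le> norm y} y) \<partial>lborel)"
        by (rule nn_integral_cmult[symmetric]) measurable
      with pointwise[of x] show "ennreal (norm x powr (l * q)) * epow (hardy_potential \<alpha> s g x) q
        \<le> ennreal d2 * (\<integral>\<^sup>+y. ennreal (norm x powr (b - n)) * (K y * indicator {y. norm x / 4 \<le> norm y} y) \<partial>lborel)"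
        by simp
    qed
    also have "\<dots> = ennreal d2 * (\<integral>\<^sup>+(x::'a). (\<integral>\<^sup>+y. ennreal (norm x powr (b - n)) * (K y * indicator {y. norm x / 4 \<le> norm y} y) \<partial>lborel) \<partial>lborel)"
      by (rule nn_integral_cmult) measurable
    also have "(\<integral>\<^sup>+(x::'a). (\<integral>\<^sup>+y. ennreal (norm x powr (b - n)) * (K y * indicator {y. norm x / 4 \<le> norm y} y) \<partial>lborel) \<partial>lborel)
      = (\<integral>\<^sup>+y. (\<integral>\<^sup>+(x::'a). ennreal (norm x powr (b - n)) * (K y * indicator {y. norm x / 4 \<le> norm y} y) \<partial>lborel) \<partial>lborel)"
      by (rule lborel_pair.Fubini') measurable
    also have "\<dots> \<le> (\<integral>\<^sup>+(y::'a). ennreal d3 * (ennreal d4 * (ennreal (norm y powr (- (\<eta> * p) - n)) * F (6 * norm y)) * epow P (q / p - 1)) \<partial>lborel)"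
      by (intro nn_integral_mono order_trans[OF inner] mult_left_mono F_split) simp
    also have "\<dots> = ennreal d3 * (ennreal d4 * (\<integral>\<^sup>+(y::'a). ennreal (norm y powr (- (\<eta> * p) - n)) * F (6 * norm y) \<partial>lborel) * epow P (q / p - 1))"
      by (subst nn_integral_cmult, measurable, subst nn_integral_multc, measurable, subst nn_integral_cmult, measurable)
    also have "\<dots> \<le> ennreal d3 * (ennreal d4 * (ennreal d5 * P) * epow P (q / p - 1))"
      by (intro mult_left_mono mult_right_mono last) auto
    also have "\<dots> = ennreal (d3 * (d4 * d5)) * (epow P 1 * epow P (q / p - 1))"
      using d by (simp add: ennreal_mult mult_ac)
    also have "epow P 1 * epow P (q / p - 1) = epow P (q / p)"
      unfolding epow_add_exp[symmetric] by simp
    finally show ?thesis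
      unfolding P_def using d by (simp add: c_def ennreal_mult mult_left_mono mult.assoc)
  qed
  moreover have "0 < c" using d by (simp add: c_def)
  ultimately show ?thesis using that by blast
qed

section \<open>The weighted bound for the potential\<close>

text \<open>
  For \<open>norm y < norm x / 4\<close> the weight is comparable to its value at \<open>x\<close> throughout the ball, so it may be
  moved inside the potential.
\<close>

lemma weighted_ball_potential_split:
  fixes \<alpha> s l :: real and g :: "'a::euclidean_space \<Rightarrow> ennreal"
  assumes s: "0 < s" and [measurable]: "g \<in> borel_measurable borel"
  shows "ennreal (norm x powr l) * ball_potential \<alpha> s g x
    \<le> ennreal (2 powr \<bar>l\<bar>) * ball_potential \<alpha> s (\<lambda>z. ennreal (norm z powr l) * g z) x
      + ennreal (norm x powr l) * hardy_potential \<alpha> s g x"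
proof (cases "x = 0")
  case False
  define n where "n = real DIM('a)"
  define G where "G z = ennreal (norm z powr l) * g z" for z
  have [measurable]: "G \<in> borel_measurable borel" unfolding G_def by measurable
  define A where "A y = ennreal (norm y powr (\<alpha> - n))" for y :: 'a
  define B where "B y = epow (ennreal (norm y powr - n) * ball_int (\<lambda>z. epow (g z) s) x (2 * norm y)) (1 / s)" for y :: 'a
  define D where "D y = epow (ennreal (norm y powr - n) * ball_int (\<lambda>z. epow (G z) s) x (2 * norm y)) (1 / s)" for y :: 'a
  define E where "E y = epow (ennreal (norm y powr - n) * ball_int (\<lambda>z. epow (g z) s) 0 (6 * norm y)) (1 / s)" for y :: 'a
  have [measurable]: "A \<in> borel_measurable borel" "B \<in> borel_measurable borel"
    "D \<in> borel_measurable borel" "E \<in> borel_measurable borel"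
    unfolding A_def B_def D_def E_def by measurable
  define S where "S = {y::'a. norm x / 4 \<le> norm y}"
  have [measurable]: "S \<in> sets borel" unfolding S_def by measurable
  have near: "ennreal (norm x powr l) * B y \<le> ennreal (2 powr \<bar>l\<bar>) * D y" if y: "norm y < norm x / 4" for y
  proof -
    have "ball_int (\<lambda>z. epow (ennreal (norm x powr l) * g z) s) x (2 * norm y)
        \<le> ball_int (\<lambda>z. epow (ennreal (2 powr \<bar>l\<bar>) * G z) s) x (2 * norm y)"
      unfolding ball_int_def
    proof (intro nn_integral_mono)
      fix z
      have "norm x powr l \<le> 2 powr \<bar>l\<bar> * norm z powr l" if "dist x z < 2 * norm y"
      proof -
        have z: "norm x / 2 \<le> norm z" "norm z \<le> 2 * norm x"
          using that y norm_triangle_ineq2[of x z] norm_triangle_ineq2[of z x]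
          by (simp_all add: dist_norm norm_minus_commute)
        have pos: "0 < norm x" "0 < norm z" using z False by (smt (verit) field_sum_of_halves zero_less_norm_iff)+
        show ?thesis
        proof (cases "0 \<le> l")
          case True
          then have "norm x powr l \<le> (2 * norm z) powr l" using z by (intro powr_mono2) auto
          then show ?thesis using True by (simp add: powr_mult)
        next
          case l: False
          then have "norm x powr l \<le> (norm z / 2) powr l" using z pos by (intro powr_mono2') auto
          also have "\<dots> = 2 powr \<bar>l\<bar> * norm z powr l"
            using l by (simp only: powr_divide) (simp add: powr_minus divide_inverse)
          finally show ?thesis .
        qed
      qed
      then have "ennreal (norm x powr l) * g z \<le> ennreal (2 powr \<bar>l\<bar>) * G z" if "dist x z < 2 * norm y"
        using that by (simp add: G_def mult.assoc[symmetric] ennreal_mult[symmetric] mult_right_mono ennreal_leI)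
      then show "epow (ennreal (norm x powr l) * g z) s * indicator (ball x (2 * norm y)) z
          \<le> epow (ennreal (2 powr \<bar>l\<bar>) * G z) s * indicator (ball x (2 * norm y)) z"
        using s by (auto simp: indicator_def intro!: epow_mono)
    qed
    then have "epow (ennreal (norm y powr - n) * ball_int (\<lambda>z. epow (ennreal (norm x powr l) * g z) s) x (2 * norm y)) (1 / s)
      \<le> epow (ennreal (norm y powr - n) * ball_int (\<lambda>z. epow (ennreal (2 powr \<bar>l\<bar>) * G z) s) x (2 * norm y)) (1 / s)"
      using s by (intro epow_mono mult_left_mono) auto
    moreover have scale: "epow (ennreal (norm y powr - n) * ball_int (\<lambda>z. epow (ennreal c * h z) s) x (2 * norm y)) (1 / s)
       = ennreal c * epow (ennreal (norm y powr - n) * ball_int (\<lambda>z. epow (h z) s) x (2 * norm y)) (1 / s)"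
      if [measurable]: "h \<in> borel_measurable borel" and "0 \<le> c" for c :: real and h :: "'a \<Rightarrow> ennreal"
    proof -
      have [measurable]: "ball x (2 * norm y) \<in> sets borel" by simp
      have "ball_int (\<lambda>z. epow (ennreal c * h z) s) x (2 * norm y)
          = epow (ennreal c) s * ball_int (\<lambda>z. epow (h z) s) x (2 * norm y)"
        unfolding ball_int_def epow_mult mult.assoc by (rule nn_integral_cmult) measurable
      then show ?thesis using s by (simp add: epow_mult epow_epow mult_ac)
    qed
    ultimately show ?thesis by (simp add: B_def D_def scale)
  qed
  have far: "B y \<le> E y" if "norm x / 4 \<le> norm y" for y
  proof -
    have "ball x (2 * norm y) \<subseteq> ball 0 (6 * norm y)"
      using that by (simp add: ball_subset_ball_iff dist_norm)
    then show ?thesis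
      unfolding B_def E_def using s by (intro epow_mono mult_left_mono ball_int_mono_ball) auto
  qed
  have "ennreal (norm x powr l) * ball_potential \<alpha> s g x = (\<integral>\<^sup>+y. A y * (ennreal (norm x powr l) * B y) \<partial>lborel)"
    unfolding ball_potential_def A_def[symmetric] B_def[symmetric] n_def[symmetric]
    by (subst nn_integral_cmult[symmetric]) (auto simp: mult_ac)
  also have "\<dots> \<le> (\<integral>\<^sup>+y. ennreal (2 powr \<bar>l\<bar>) * (A y * D y) + ennreal (norm x powr l) * (A y * E y * indicator S y) \<partial>lborel)"
  proof (intro nn_integral_mono)
    fix y :: 'a
    show "A y * (ennreal (norm x powr l) * B y) \<le> ennreal (2 powr \<bar>l\<bar>) * (A y * D y) + ennreal (norm x powr l) * (A y * E y * indicator S y)"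
    proof (cases "norm x / 4 \<le> norm y")
      case True
      have "A y * (ennreal (norm x powr l) * B y) \<le> A y * (ennreal (norm x powr l) * E y)"
        using far[OF True] by (intro mult_left_mono) auto
      also have "\<dots> = ennreal (norm x powr l) * (A y * E y * indicator S y)"
        using True by (simp add: S_def indicator_def mult_ac)
      finally show ?thesis by (rule add_increasing[rotated]) simp
    next
      case False
      have "A y * (ennreal (norm x powr l) * B y) \<le> A y * (ennreal (2 powr \<bar>l\<bar>) * D y)"
        using near[of y] False by (intro mult_left_mono) auto
      also have "\<dots> = ennreal (2 powr \<bar>l\<bar>) * (A y * D y)" by (simp add: mult_ac)
      finally show ?thesis by (rule add_increasing2[rotated]) simp
    qed
  qed
  also have "\<dots> = ennreal (2 powr \<bar>l\<bar>) * (\<integral>\<^sup>+y. A y * D y \<partial>lborel) + ennreal (norm x powr l) * (\<integral>\<^sup>+y. A y * E y * indicator S y \<partial>lborel)"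
    by (subst nn_integral_add, measurable, subst nn_integral_cmult, measurable, subst nn_integral_cmult, measurable)
  also have "\<dots> = ennreal (2 powr \<bar>l\<bar>) * ball_potential \<alpha> s G x + ennreal (norm x powr l) * hardy_potential \<alpha> s g x"
    by (simp add: ball_potential_def hardy_potential_def A_def D_def E_def S_def n_def)
  finally show ?thesis by (simp add: G_def[abs_def])
qed simp

proposition weighted_ball_potential_bound:
  fixes \<alpha> p q s l :: real
  assumes \<alpha>: "0 < \<alpha>" and s: "0 < s" "s < p" and p: "1 < p" and p\<alpha>: "\<alpha> < DIM('a) / p"
    and q: "1 / q = 1 / p - \<alpha> / DIM('a)"
    and l: "- (DIM('a) / q) < l" "l < DIM('a) / s - DIM('a) / p"
  obtains c where "0 < c"
    "\<And>g :: 'a::euclidean_space \<Rightarrow> ennreal. g \<in> borel_measurable borel \<Longrightarrow>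
      (\<integral>\<^sup>+x. epow (ennreal (norm x powr l) * ball_potential \<alpha> s g x) q \<partial>lborel)
      \<le> ennreal c * epow (\<integral>\<^sup>+z. epow (ennreal (norm z powr l) * g z) p \<partial>lborel) (q / p)"
proof -
  define n where "n = real DIM('a)"
  have n: "0 < n" by (simp add: n_def)
  have "\<alpha> / n < 1 / p"
  proof -
    have "\<alpha> / n < (n / p) / n" using p\<alpha> n unfolding n_def by (intro divide_strict_right_mono) auto
    then show ?thesis using n by simp
  qed
  then have "0 < 1 / q" and lt: "1 / q < 1 / p" using q n \<alpha> by (simp_all add: n_def)
  then have q0: "0 < q" by simp
  then have pq: "p < q" using lt p by (simp add: field_simps)
  then have q1: "1 < q" using p by simp
  obtain c1 where c1: "0 < c1"
    "\<And>g :: 'a \<Rightarrow> ennreal. g \<in> borel_measurable borel \<Longrightarrow>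
      (\<integral>\<^sup>+x. epow (ball_potential \<alpha> s g x) q \<partial>lborel) \<le> ennreal c1 * epow (\<integral>\<^sup>+z. epow (g z) p \<partial>lborel) (q / p)"
    by (rule ball_potential_bound[OF \<alpha> s p\<alpha> q]) (rule that)
  obtain c2 where c2: "0 < c2"
    "\<And>g :: 'a \<Rightarrow> ennreal. g \<in> borel_measurable borel \<Longrightarrow>
      (\<integral>\<^sup>+x. ennreal (norm x powr (l * q)) * epow (hardy_potential \<alpha> s g x) q \<partial>lborel)
      \<le> ennreal c2 * epow (\<integral>\<^sup>+z. ennreal (norm z powr (l * p)) * epow (g z) p \<partial>lborel) (q / p)"
    by (rule hardy_potential_bound[OF \<alpha> s q1 pq q l]) (rule that)
  define K where "K = (2 powr \<bar>l\<bar>) powr q"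
  have K: "0 < K" by (simp add: K_def)
  define c where "c = 2 powr q * (K * c1 + c2)"
  have c: "0 < c" unfolding c_def using K c1 c2 by (intro mult_pos_pos add_pos_pos) auto
  have "(\<integral>\<^sup>+x. epow (ennreal (norm x powr l) * ball_potential \<alpha> s g x) q \<partial>lborel)
      \<le> ennreal c * epow (\<integral>\<^sup>+z. epow (ennreal (norm z powr l) * g z) p \<partial>lborel) (q / p)"
    if g[measurable]: "g \<in> borel_measurable borel" for g :: "'a \<Rightarrow> ennreal"
  proof -
    define G where "G z = ennreal (norm z powr l) * g z" for z
    have G[measurable]: "G \<in> borel_measurable borel" unfolding G_def by measurable
    define P where "P = (\<integral>\<^sup>+z. epow (G z) p \<partial>lborel)"
    have P: "P = (\<integral>\<^sup>+z. ennreal (norm z powr (l * p)) * epow (g z) p \<partial>lborel)"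
      by (simp add: P_def G_def epow_mult epow_ennreal powr_powr)
    have "(\<integral>\<^sup>+x. epow (ennreal (norm x powr l) * ball_potential \<alpha> s g x) q \<partial>lborel)
      \<le> (\<integral>\<^sup>+x. ennreal (2 powr q) * (ennreal K * epow (ball_potential \<alpha> s G x) q
          + ennreal (norm x powr (l * q)) * epow (hardy_potential \<alpha> s g x) q) \<partial>lborel)"
    proof (intro nn_integral_mono)
      fix x :: 'a
      have "epow (ennreal (norm x powr l) * ball_potential \<alpha> s g x) q
        \<le> epow (ennreal (2 powr \<bar>l\<bar>) * ball_potential \<alpha> s G x + ennreal (norm x powr l) * hardy_potential \<alpha> s g x) q"
        unfolding G_def[abs_def] using q0 by (intro epow_mono weighted_ball_potential_split s g) auto
      also have "\<dots> \<le> ennreal (2 powr q) * (epow (ennreal (2 powr \<bar>l\<bar>) * ball_potential \<alpha> s G x) q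
          + epow (ennreal (norm x powr l) * hardy_potential \<alpha> s g x) q)"
        by (rule epow_add_le[OF q0])
      finally show "epow (ennreal (norm x powr l) * ball_potential \<alpha> s g x) q
        \<le> ennreal (2 powr q) * (ennreal K * epow (ball_potential \<alpha> s G x) q
          + ennreal (norm x powr (l * q)) * epow (hardy_potential \<alpha> s g x) q)"
        by (simp add: epow_mult epow_ennreal powr_powr K_def)
    qed
    also have "\<dots> = ennreal (2 powr q) * (ennreal K * (\<integral>\<^sup>+x. epow (ball_potential \<alpha> s G x) q \<partial>lborel)
          + (\<integral>\<^sup>+x. ennreal (norm x powr (l * q)) * epow (hardy_potential \<alpha> s g x) q \<partial>lborel))"
      by (subst nn_integral_cmult, measurable, subst nn_integral_add, measurable, subst nn_integral_cmult, measurable)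
    also have "\<dots> \<le> ennreal (2 powr q) * (ennreal K * (ennreal c1 * epow P (q / p)) + ennreal c2 * epow P (q / p))"
      using c1(2)[OF G] c2(2)[OF g] by (intro mult_left_mono add_mono) (auto simp: P_def[symmetric] P[symmetric])
    also have "\<dots> = ennreal c * epow P (q / p)"
      using K c1 c2 by (simp add: c_def ennreal_mult distrib_left distrib_right mult_ac)
    finally show ?thesis by (simp add: P_def G_def)
  qed
  with c show ?thesis using that by blast
qed

section \<open>Morrey's inequality\<close>

text \<open>
  The gradient enters Morrey's inequality only through a continuous bound \<open>G\<close> for the operator norm of the derivative.
\<close>

definition derivative_dominated ::
    "('a::euclidean_space \<Rightarrow> 'b::euclidean_space) \<Rightarrow> ('a \<Rightarrow> 'a \<Rightarrow> 'b) \<Rightarrow> ('a \<Rightarrow> real) \<Rightarrow> bool" where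
  "derivative_dominated f f' G \<longleftrightarrow> (\<forall>x. (f has_derivative f' x) (at x)) \<and>
     (\<forall>x v. norm (f' x v) \<le> G x * norm v) \<and> continuous_on UNIV G"

lemma norm_difference_le_line_integral:
  fixes f :: "'a::euclidean_space \<Rightarrow> 'b::euclidean_space"
  assumes dom: "derivative_dominated f f' G"
  shows "ennreal (norm (f z - f x))
    \<le> ennreal (norm (z - x)) * (\<integral>\<^sup>+t. ennreal (G (x + t *\<^sub>R (z - x))) * indicator {0..1} t \<partial>lborel)"
proof -
  have der: "(f has_derivative f' x) (at x)" and bound: "norm (f' x v) \<le> G x * norm v"
    and G: "continuous_on UNIV G" for x v
    using dom by (auto simp: derivative_dominated_def)
  let ?v = "z - x"
  have G0: "0 \<le> G y" for y
  proof -
    obtain v :: 'a where "norm v = 1" using vector_choose_size[of 1] by auto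
    then show ?thesis using order_trans[OF norm_ge_zero bound[of y v]] by simp
  qed
  have 1: "((\<lambda>t. f' (x + t *\<^sub>R ?v) ?v) has_integral f (x + 1 *\<^sub>R ?v) - f (x + 0 *\<^sub>R ?v)) {0..1}"
  proof (rule fundamental_theorem_of_calculus)
    fix t :: real
    have "((\<lambda>t. x + t *\<^sub>R ?v) has_derivative (\<lambda>h. h *\<^sub>R ?v)) (at t within {0..1})"
      by (auto intro!: derivative_eq_intros)
    then have "((\<lambda>t. f (x + t *\<^sub>R ?v)) has_derivative (\<lambda>h. f' (x + t *\<^sub>R ?v) (h *\<^sub>R ?v))) (at t within {0..1})"
      by (rule has_derivative_compose[OF _ der])
    moreover have "f' (x + t *\<^sub>R ?v) (h *\<^sub>R ?v) = h *\<^sub>R f' (x + t *\<^sub>R ?v) ?v" for h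
      using has_derivative_linear[OF der] by (simp add: linear_cmul)
    ultimately show "((\<lambda>t. f (x + t *\<^sub>R ?v)) has_vector_derivative f' (x + t *\<^sub>R ?v) ?v) (at t within {0..1})"
      by (simp add: has_vector_derivative_def)
  qed simp
  have "continuous_on {0..1} (\<lambda>t. G (x + t *\<^sub>R ?v) * norm ?v)"
    by (intro continuous_intros continuous_on_compose2[OF G]) auto
  then have i: "(\<lambda>t. G (x + t *\<^sub>R ?v) * norm ?v) integrable_on {0..1}"
    by (rule integrable_continuous_real)
  have "norm (f z - f x) = norm (integral {0..1} (\<lambda>t. f' (x + t *\<^sub>R ?v) ?v))"
    using integral_unique[OF 1] by simp
  also have "\<dots> \<le> integral {0..1} (\<lambda>t. G (x + t *\<^sub>R ?v) * norm ?v)"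
    using 1 i bound by (intro integral_norm_bound_integral) auto
  finally have "ennreal (norm (f z - f x)) \<le> ennreal (integral {0..1} (\<lambda>t. G (x + t *\<^sub>R ?v) * norm ?v))"
    by (rule ennreal_leI)
  also have "\<dots> = (\<integral>\<^sup>+t. ennreal (indicator {0..1} t * (G (x + t *\<^sub>R ?v) * norm ?v)) \<partial>lborel)"
    using i G0 by (intro nn_integral_has_integral_lebesgue[symmetric] integrable_integral) auto
  also have "\<dots> = (\<integral>\<^sup>+t. ennreal (norm ?v) * (ennreal (G (x + t *\<^sub>R ?v)) * indicator {0..1} t) \<partial>lborel)"
    using G0 by (intro nn_integral_cong) (auto simp: indicator_def ennreal_mult mult_ac)
  also have "\<dots> = ennreal (norm ?v) * (\<integral>\<^sup>+t. ennreal (G (x + t *\<^sub>R ?v)) * indicator {0..1} t \<partial>lborel)"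
  proof (rule nn_integral_cmult)
    have [measurable]: "(\<lambda>t. G (x + t *\<^sub>R ?v)) \<in> borel_measurable borel"
      by (intro borel_measurable_continuous_onI continuous_on_compose2[OF G] continuous_intros) auto
    show "(\<lambda>t. ennreal (G (x + t *\<^sub>R ?v)) * indicator {0..1} t) \<in> borel_measurable lborel"
      by measurable
  qed
  finally show ?thesis .
qed

lemma nn_integral_lborel_affine:
  fixes h :: "'a::euclidean_space \<Rightarrow> ennreal"
  assumes [measurable]: "h \<in> borel_measurable borel" and c: "0 < c"
  shows "(\<integral>\<^sup>+z. h (a + c *\<^sub>R z) \<partial>lborel) = ennreal (c powr - real DIM('a)) * (\<integral>\<^sup>+z. h z \<partial>lborel)"
proof -
  have "(\<integral>\<^sup>+z. h z \<partial>lborel) = (\<integral>\<^sup>+z. h z \<partial>(density (distr lborel borel (\<lambda>x. a + c *\<^sub>R x)) (\<lambda>_. \<bar>c\<bar>^DIM('a))))"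
    using c by (subst lborel_affine[of c a]) auto
  also have "\<dots> = ennreal (c ^ DIM('a)) * (\<integral>\<^sup>+z. h (a + c *\<^sub>R z) \<partial>lborel)"
    using c by (simp add: nn_integral_density nn_integral_distr nn_integral_cmult)
  finally have "ennreal (c powr - real DIM('a)) * (\<integral>\<^sup>+z. h z \<partial>lborel)
      = (ennreal (c powr - real DIM('a)) * ennreal (c ^ DIM('a))) * (\<integral>\<^sup>+z. h (a + c *\<^sub>R z) \<partial>lborel)"
    by (simp only: mult.assoc)
  also have "ennreal (c powr - real DIM('a)) * ennreal (c ^ DIM('a)) = 1"
    using c by (simp add: ennreal_mult[symmetric] powr_minus powr_realpow)
  finally show ?thesis by simp
qed

text \<open>
  Integrating the fundamental theorem of calculus over a ball \<open>W\<close> near \<open>x\<close> and substituting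
  \<open>x + t (z - x)\<close> for \<open>z\<close> costs a factor \<open>t powr - n\<close>, of which Hoelder's inequality leaves
  \<open>t powr - (n / s)\<close>; this is integrable because \<open>n < s\<close>.
\<close>

lemma integral_difference_over_ball:
  fixes s :: real
  assumes s: "real DIM('a) < s"
  obtains k where "0 < k"
    "\<And>(f :: 'a::euclidean_space \<Rightarrow> 'b::euclidean_space) f' G x m \<rho> r.
      derivative_dominated f f' G \<Longrightarrow> 0 < \<rho> \<Longrightarrow> ball m \<rho> \<subseteq> ball x r \<Longrightarrow>
      (\<integral>\<^sup>+z. ennreal (norm (f z - f x)) * indicator (ball m \<rho>) z \<partial>lborel)
      \<le> ennreal (k * r * \<rho> powr (DIM('a) * (1 - 1 / s)))
        * epow (ball_int (\<lambda>z. epow (ennreal (G z)) s) x r) (1 / s)"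
proof -
  define n where "n = real DIM('a)"
  have n: "1 \<le> n" unfolding n_def using DIM_positive[where 'a = 'a] by linarith
  have s0: "0 < s" "1 < s" and sn: "n < s" using s n unfolding n_def by linarith+
  have "0 < 1 - n / s" using s s0 by (simp add: n_def)
  then obtain j where j: "0 < j"
    "\<And>R. 0 < R \<Longrightarrow> (\<integral>\<^sup>+(t::real). ennreal (norm t powr (1 - n / s - DIM(real))) * indicator (cball 0 R) t \<partial>lborel)
       \<le> ennreal (j * R powr (1 - n / s))"
    by (rule nn_integral_norm_powr_cball[where 'a = real]) (rule that)
  define V where "V = unit_ball_vol n powr (1 - 1 / s)"
  have "unit_ball_vol n \<noteq> 0" unfolding n_def by (metis less_irrefl of_nat_0_le_iff unit_ball_vol_pos)
  then have V: "0 < V" by (simp add: V_def)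
  define k where "k = V * j"
  have "(\<integral>\<^sup>+z. ennreal (norm (f z - f x)) * indicator (ball m \<rho>) z \<partial>lborel)
      \<le> ennreal (k * r * \<rho> powr (n * (1 - 1 / s)))
        * epow (ball_int (\<lambda>z. epow (ennreal (G z)) s) x r) (1 / s)"
    if dom: "derivative_dominated f f' G" and \<rho>: "0 < \<rho>" and sub: "ball m \<rho> \<subseteq> ball x r"
    for f :: "'a \<Rightarrow> 'b" and f' G x m \<rho> r
  proof -
    have "continuous_on UNIV G" using dom by (simp add: derivative_dominated_def)
    then have [measurable]: "G \<in> borel_measurable borel"
      by (rule borel_measurable_continuous_onI)
    have [measurable]: "ball m \<rho> \<in> sets borel" "ball x r \<in> sets borel" by simp_all
    have "m \<in> ball x r" using sub \<rho> by (meson centre_in_ball subsetD)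
    then have r: "0 < r" by (metis ball_eq_empty empty_iff not_le)
    define H where "H = ball_int (\<lambda>z. epow (ennreal (G z)) s) x r"
    have inner: "(\<integral>\<^sup>+z. ennreal (G (x + t *\<^sub>R (z - x))) * indicator (ball m \<rho>) z \<partial>lborel)
        \<le> ennreal (V * \<rho> powr (n * (1 - 1 / s)) * t powr - (n / s)) * epow H (1 / s)"
      if t: "0 < t" "t \<le> 1" for t
    proof -
      define h where "h z = epow (ennreal (G (x + t *\<^sub>R (z - x)))) s * indicator (ball m \<rho>) z" for z
      have [measurable]: "h \<in> borel_measurable borel" unfolding h_def by measurable
      have "(\<integral>\<^sup>+z. ennreal (G (x + t *\<^sub>R (z - x))) * indicator (ball m \<rho>) z \<partial>lborel)
          = ball_int (\<lambda>z. epow (h z) (1 / s)) m \<rho>"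
        unfolding ball_int_def using s0
        by (intro nn_integral_cong) (auto simp: h_def epow_epow indicator_def)
      also have "\<dots> \<le> ennreal (unit_ball_vol n powr (1 - 1 / s) * \<rho> powr (n * (1 - 1 / s)))
          * epow (\<integral>\<^sup>+y. epow (epow (h y) (1 / s)) s \<partial>lborel) (1 / s)"
        unfolding n_def using s0 \<rho> by (intro ball_int_Hoelder) auto
      also have "(\<integral>\<^sup>+y. epow (epow (h y) (1 / s)) s \<partial>lborel) = (\<integral>\<^sup>+y. h y \<partial>lborel)"
        using s0 by (simp add: epow_epow)
      also have "\<dots> \<le> (\<integral>\<^sup>+z. epow (ennreal (G ((x - t *\<^sub>R x) + t *\<^sub>R z))) s * indicator (ball x r) ((x - t *\<^sub>R x) + t *\<^sub>R z) \<partial>lborel)"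
      proof (intro nn_integral_mono)
        fix z :: 'a
        have e: "x + t *\<^sub>R (z - x) = (x - t *\<^sub>R x) + t *\<^sub>R z" by (simp add: algebra_simps)
        have "x + t *\<^sub>R (z - x) \<in> ball x r" if "z \<in> ball m \<rho>"
        proof -
          have "norm (z - x) < r" using sub that by (auto simp: dist_norm norm_minus_commute)
          moreover have "t * norm (z - x) \<le> norm (z - x)" using t by (simp add: mult_left_le_one_le)
          ultimately show ?thesis using t by (simp add: dist_norm)
        qed
        then show "h z \<le> epow (ennreal (G ((x - t *\<^sub>R x) + t *\<^sub>R z))) s * indicator (ball x r) ((x - t *\<^sub>R x) + t *\<^sub>R z)"
          unfolding h_def e by (auto simp: indicator_def)
      qed
      also have "\<dots> = ennreal (t powr - n) * H"
        unfolding H_def ball_int_def n_def using t by (intro nn_integral_lborel_affine) auto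
      finally have "(\<integral>\<^sup>+z. ennreal (G (x + t *\<^sub>R (z - x))) * indicator (ball m \<rho>) z \<partial>lborel)
          \<le> ennreal (V * \<rho> powr (n * (1 - 1 / s))) * epow (ennreal (t powr - n) * H) (1 / s)"
        using s0 by (simp add: epow_mono mult_left_mono V_def)
      also have "\<dots> = ennreal (V * \<rho> powr (n * (1 - 1 / s)) * t powr - (n / s)) * epow H (1 / s)"
        using V by (simp add: epow_mult epow_ennreal powr_powr ennreal_mult mult_ac)
      finally show ?thesis .
    qed
    have "(\<integral>\<^sup>+z. ennreal (norm (f z - f x)) * indicator (ball m \<rho>) z \<partial>lborel)
        \<le> (\<integral>\<^sup>+z. ennreal r * (\<integral>\<^sup>+t. ennreal (G (x + t *\<^sub>R (z - x))) * indicator {0..1} t * indicator (ball m \<rho>) z \<partial>lborel) \<partial>lborel)"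
    proof (rule nn_integral_mono)
      fix z :: 'a
      show "ennreal (norm (f z - f x)) * indicator (ball m \<rho>) z
        \<le> ennreal r * (\<integral>\<^sup>+t. ennreal (G (x + t *\<^sub>R (z - x))) * indicator {0..1} t * indicator (ball m \<rho>) z \<partial>lborel)"
      proof (cases "z \<in> ball m \<rho>")
        case True
        then have "norm (z - x) \<le> r" using sub by (auto simp: dist_norm norm_minus_commute)
        have "ennreal (norm (f z - f x)) \<le> ennreal (norm (z - x)) * (\<integral>\<^sup>+t. ennreal (G (x + t *\<^sub>R (z - x))) * indicator {0..1} t \<partial>lborel)"
          by (rule norm_difference_le_line_integral[OF dom])
        also have "\<dots> \<le> ennreal r * (\<integral>\<^sup>+t. ennreal (G (x + t *\<^sub>R (z - x))) * indicator {0..1} t \<partial>lborel)"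
          using \<open>norm (z - x) \<le> r\<close> by (intro mult_right_mono ennreal_leI) auto
        finally show ?thesis using True by simp
      qed simp
    qed
    also have "\<dots> = ennreal r * (\<integral>\<^sup>+z. \<integral>\<^sup>+t. ennreal (G (x + t *\<^sub>R (z - x))) * indicator {0..1} t * indicator (ball m \<rho>) z \<partial>lborel \<partial>lborel)"
      by (rule nn_integral_cmult) measurable
    also have "(\<integral>\<^sup>+z. \<integral>\<^sup>+t. ennreal (G (x + t *\<^sub>R (z - x))) * indicator {0..1} t * indicator (ball m \<rho>) z \<partial>lborel \<partial>lborel)
      = (\<integral>\<^sup>+t. \<integral>\<^sup>+z. ennreal (G (x + t *\<^sub>R (z - x))) * indicator {0..1} t * indicator (ball m \<rho>) z \<partial>lborel \<partial>lborel)"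
      by (rule lborel_pair.Fubini') measurable
    also have "\<dots> \<le> (\<integral>\<^sup>+(t::real). ennreal (V * \<rho> powr (n * (1 - 1 / s))) * epow H (1 / s) *
        (ennreal (norm t powr (1 - n / s - DIM(real))) * indicator (cball 0 1) t) \<partial>lborel)"
    proof (rule nn_integral_mono_AE)
      show "AE t in lborel. (\<integral>\<^sup>+z. ennreal (G (x + t *\<^sub>R (z - x))) * indicator {0..1} t * indicator (ball m \<rho>) z \<partial>lborel)
        \<le> ennreal (V * \<rho> powr (n * (1 - 1 / s))) * epow H (1 / s) *
          (ennreal (norm t powr (1 - n / s - DIM(real))) * indicator (cball 0 1) t)"
        using AE_lborel_nonzero[where 'a = real]
      proof eventually_elim
        case (elim t)
        show ?case
        proof (cases "0 < t \<and> t \<le> 1")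
          case True
          then have "(\<integral>\<^sup>+z. ennreal (G (x + t *\<^sub>R (z - x))) * indicator {0..1} t * indicator (ball m \<rho>) z \<partial>lborel)
            \<le> ennreal (V * \<rho> powr (n * (1 - 1 / s)) * t powr - (n / s)) * epow H (1 / s)"
            using inner[of t] by simp
          also have "\<dots> = ennreal (V * \<rho> powr (n * (1 - 1 / s))) * epow H (1 / s) *
            (ennreal (norm t powr (1 - n / s - DIM(real))) * indicator (cball 0 1) t)"
            using True V by (simp add: ennreal_mult mult_ac)
          finally show ?thesis .
        next
          case False
          then have "indicator {0..1} t = (0::ennreal)" using elim by (auto simp: indicator_def)
          then show ?thesis by simp
        qed
      qed
    qed
    also have "\<dots> = ennreal (V * \<rho> powr (n * (1 - 1 / s))) * epow H (1 / s) *
        (\<integral>\<^sup>+(t::real). ennreal (norm t powr (1 - n / s - DIM(real))) * indicator (cball 0 1) t \<partial>lborel)"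
      by (intro nn_integral_cmult borel_measurable_times_ennreal borel_measurable_indicator) auto
    also have "\<dots> \<le> ennreal (V * \<rho> powr (n * (1 - 1 / s))) * epow H (1 / s) * ennreal (j * 1 powr (1 - n / s))"
      by (intro mult_left_mono j) auto
    finally have "(\<integral>\<^sup>+z. ennreal (norm (f z - f x)) * indicator (ball m \<rho>) z \<partial>lborel)
      \<le> ennreal r * (ennreal (V * \<rho> powr (n * (1 - 1 / s))) * epow H (1 / s) * ennreal (j * 1 powr (1 - n / s)))"
      by (simp add: mult_left_mono)
    also have "\<dots> = ennreal (k * r * \<rho> powr (n * (1 - 1 / s))) * epow H (1 / s)"
      using V j r by (simp add: k_def ennreal_mult mult_ac)
    finally show ?thesis unfolding H_def .
  qed
  moreover have "0 < k" using V j by (simp add: k_def)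
  ultimately show ?thesis using that unfolding n_def by blast
qed

text \<open>
  Both \<open>f x\<close> and \<open>f (x - y)\<close> are compared with the values of \<open>f\<close> on the ball whose diameter joins the two
  points.
\<close>

proposition Morrey_inequality:
  fixes s :: real
  assumes s: "real DIM('a) < s"
  obtains c where "0 < c"
    "\<And>(f :: 'a::euclidean_space \<Rightarrow> 'b::euclidean_space) f' G x y.
      derivative_dominated f f' G \<Longrightarrow>
      ennreal (norm (f (x - y) - f x)) \<le> ennreal (c * norm y) *
        epow (ennreal (norm y powr - real DIM('a)) * ball_int (\<lambda>z. epow (ennreal (G z)) s) x (2 * norm y)) (1 / s)"
proof -
  define n where "n = real DIM('a)"
  have n: "1 \<le> n" unfolding n_def using DIM_positive[where 'a = 'a] by linarith
  have s0: "0 < s" using s n by (simp add: n_def)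
  obtain k where k: "0 < k"
    "\<And>(f :: 'a::euclidean_space \<Rightarrow> 'b::euclidean_space) f' G x m \<rho> r.
      derivative_dominated f f' G \<Longrightarrow> 0 < \<rho> \<Longrightarrow> ball m \<rho> \<subseteq> ball x r \<Longrightarrow>
      (\<integral>\<^sup>+z. ennreal (norm (f z - f x)) * indicator (ball m \<rho>) z \<partial>lborel)
      \<le> ennreal (k * r * \<rho> powr (n * (1 - 1 / s)))
        * epow (ball_int (\<lambda>z. epow (ennreal (G z)) s) x r) (1 / s)"
    by (rule integral_difference_over_ball[OF s, folded n_def]) (rule that)
  define V where "V = unit_ball_vol n"
  have "unit_ball_vol n \<noteq> 0" unfolding n_def by (metis less_irrefl of_nat_0_le_iff unit_ball_vol_pos)
  then have V: "0 < V" using unit_ball_vol_nonneg[of n] n unfolding V_def by linarith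
  define c where "c = 2 * k * 2 powr (n / s) / V"
  have "ennreal (norm (f (x - y) - f x)) \<le> ennreal (c * norm y) *
        epow (ennreal (norm y powr - n) * ball_int (\<lambda>z. epow (ennreal (G z)) s) x (2 * norm y)) (1 / s)"
    if dom: "derivative_dominated f f' G"
    for f :: "'a \<Rightarrow> 'b" and f' G x y
  proof (cases "y = 0")
    case False
    define r where "r = norm y"
    define \<rho> where "\<rho> = r / 2"
    define u where "u = x - y"
    define m where "m = x - y /\<^sub>R 2"
    have r: "0 < r" "0 < \<rho>" using False by (auto simp: r_def \<rho>_def)
    define W where "W = ball m \<rho>"
    have [measurable]: "W \<in> sets borel" by (simp add: W_def)
    have cf: "continuous_on UNIV f"
      using dom unfolding derivative_dominated_def by (meson continuous_at_imp_continuous_on has_derivative_continuous)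
    have [measurable]: "f \<in> borel_measurable borel" using cf by (rule borel_measurable_continuous_onI)
    define H where "H = ball_int (\<lambda>z. epow (ennreal (G z)) s) x (2 * r)"
    define A where "A = \<rho> powr (n * (1 - 1 / s))"
    have d: "dist m x = \<rho>" "dist m u = \<rho>" "dist x u = r"
    proof -
      have "m - x = - (y /\<^sub>R 2)" by (simp add: m_def)
      then show "dist m x = \<rho>" by (simp add: dist_norm \<rho>_def r_def)
      have "m - u = y /\<^sub>R 2"
        using scaleR_half_double[of y] by (simp add: m_def u_def algebra_simps)
      then show "dist m u = \<rho>" by (simp add: dist_norm \<rho>_def r_def)
      show "dist x u = r" by (simp add: u_def dist_norm r_def)
    qed
    have W: "W \<subseteq> ball x r" "W \<subseteq> ball u r"
      unfolding W_def using d r by (auto simp: ball_subset_ball_iff \<rho>_def)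
    have u2: "ball u r \<subseteq> ball x (2 * r)" "ball x r \<subseteq> ball x (2 * r)"
      using d r by (auto simp: ball_subset_ball_iff dist_commute)
    have part: "(\<integral>\<^sup>+z. ennreal (norm (f z - f w)) * indicator W z \<partial>lborel) \<le> ennreal (k * r * A) * epow H (1 / s)"
      if "W \<subseteq> ball w r" "ball w r \<subseteq> ball x (2 * r)" for w
    proof -
      have "(\<integral>\<^sup>+z. ennreal (norm (f z - f w)) * indicator W z \<partial>lborel)
        \<le> ennreal (k * r * A) * epow (ball_int (\<lambda>z. epow (ennreal (G z)) s) w r) (1 / s)"
        using k(2)[OF dom r(2), of m w r] that(1) unfolding W_def A_def by blast
      also have "\<dots> \<le> ennreal (k * r * A) * epow H (1 / s)"
        unfolding H_def using s0 that(2) by (intro mult_left_mono epow_mono ball_int_mono_ball) auto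
      finally show ?thesis .
    qed
    have vol: "emeasure lborel W = ennreal (V * \<rho> ^ DIM('a))"
      using r by (simp add: W_def emeasure_ball V_def n_def)
    have "ennreal (norm (f u - f x)) * emeasure lborel W = (\<integral>\<^sup>+z. ennreal (norm (f u - f x)) * indicator W z \<partial>lborel)"
      by (simp add: nn_integral_cmult_indicator)
    also have "\<dots> \<le> (\<integral>\<^sup>+z. ennreal (norm (f z - f u)) * indicator W z + ennreal (norm (f z - f x)) * indicator W z \<partial>lborel)"
    proof (intro nn_integral_mono)
      fix z
      have "norm (f u - f x) \<le> norm (f z - f u) + norm (f z - f x)"
        using norm_triangle_ineq4[of "f z - f x" "f z - f u"] by simp
      then show "ennreal (norm (f u - f x)) * indicator W z
        \<le> ennreal (norm (f z - f u)) * indicator W z + ennreal (norm (f z - f x)) * indicator W z"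
        by (auto simp: indicator_def ennreal_plus[symmetric] intro!: ennreal_leI simp del: ennreal_plus)
    qed
    also have "\<dots> = (\<integral>\<^sup>+z. ennreal (norm (f z - f u)) * indicator W z \<partial>lborel) + (\<integral>\<^sup>+z. ennreal (norm (f z - f x)) * indicator W z \<partial>lborel)"
      by (rule nn_integral_add) measurable
    also have "\<dots> \<le> ennreal (k * r * A) * epow H (1 / s) + ennreal (k * r * A) * epow H (1 / s)"
      using W u2 by (intro add_mono part) auto
    also have "\<dots> = ennreal (2 * k * r * A) * epow H (1 / s)"
    proof -
      have "ennreal (2 * (k * r * A)) = 2 * ennreal (k * r * A)" using ennreal_mult[of 2 "k * r * A"] k r by (simp add: A_def)
      then show ?thesis by (simp add: mult_2[symmetric] mult.assoc)
    qed
    finally have main: "ennreal (norm (f u - f x)) * ennreal (V * \<rho> ^ DIM('a)) \<le> ennreal (2 * k * r * A) * epow H (1 / s)"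
      unfolding vol .
    define v where "v = V * \<rho> ^ DIM('a)"
    have v: "0 < v" using V r by (simp add: v_def)
    have "ennreal (norm (f u - f x)) = ennreal (norm (f u - f x)) * ennreal v * ennreal (1 / v)"
      using v by (simp add: ennreal_mult[symmetric])
    also have "\<dots> \<le> ennreal (2 * k * r * A) * epow H (1 / s) * ennreal (1 / v)"
      using main unfolding v_def by (rule mult_right_mono) simp
    also have "\<dots> = ennreal (2 * k * r * A * (1 / v)) * epow H (1 / s)"
    proof -
      have "0 \<le> 2 * k * r * A" using k r by (simp add: A_def)
      then have "ennreal (2 * k * r * A * (1 / v)) = ennreal (2 * k * r * A) * ennreal (1 / v)"
        using v by (intro ennreal_mult) auto
      then show ?thesis by (simp only: mult_ac)
    qed
    also have "2 * k * r * A * (1 / v) = (c * r) * (r powr - n) powr (1 / s)"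
    proof -
      have "A = \<rho> ^ DIM('a) * \<rho> powr - (n / s)"
        unfolding A_def using r by (simp add: powr_realpow[symmetric] n_def powr_add[symmetric] algebra_simps)
      then have "A * (1 / v) = \<rho> powr - (n / s) / V" using r V by (simp add: v_def)
      also have "\<rho> powr - (n / s) = 2 powr (n / s) * r powr - (n / s)"
        unfolding \<rho>_def by (simp only: powr_divide powr_minus) (simp add: divide_inverse)
      finally have "2 * k * r * (A * (1 / v)) = 2 * k * r * (2 powr (n / s) * r powr - (n / s) / V)"
        by (rule arg_cong)
      then show ?thesis by (simp add: c_def powr_powr mult_ac)
    qed
    also have "ennreal ((c * r) * (r powr - n) powr (1 / s)) = ennreal (c * r) * epow (ennreal (r powr - n)) (1 / s)"
      using k V r by (simp add: c_def epow_ennreal ennreal_mult[symmetric])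
    finally show ?thesis by (simp add: u_def r_def H_def epow_mult mult.assoc)
  qed simp
  moreover have "0 < c" using k V by (simp add: c_def)
  ultimately show ?thesis using that unfolding n_def by blast
qed

section \<open>Uniqueness of the rotation invariant measure on the sphere\<close>

text \<open>
  These are the uniformly distributed measures of geometric measure theory.  Rotation invariance on the sphere
  implies the condition on balls, and the uniqueness proof works with balls alone.
\<close>

definition uniform_on :: "'a::euclidean_space set \<Rightarrow> 'a measure \<Rightarrow> bool" where
  "uniform_on S \<mu> \<longleftrightarrow> sets \<mu> = sets borel \<and> finite_measure \<mu> \<and> emeasure \<mu> (- S) = 0 \<and>
     (\<forall>x\<in>S. \<forall>y\<in>S. \<forall>r>0. emeasure \<mu> (ball x r) = emeasure \<mu> (ball y r))"

text \<open>
  Finitely many balls of the same radius cover \<open>S\<close>, so if one is a null set, all are and the measure vanishes.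
\<close>

lemma uniform_on_ball_pos:
  assumes \<mu>: "uniform_on S \<mu>" and S: "compact S" and pos: "emeasure \<mu> UNIV \<noteq> 0"
    and x: "x \<in> S" and r: "0 < r"
  shows "emeasure \<mu> (ball x r) \<noteq> 0"
proof
  assume 0: "emeasure \<mu> (ball x r) = 0"
  have sets: "sets \<mu> = sets borel" using \<mu> by (simp add: uniform_on_def)
  have z: "emeasure \<mu> (ball y r) = 0" if "y \<in> S" for y
    using \<mu> that x r 0 unfolding uniform_on_def by metis
  obtain C where C: "finite C" "C \<subseteq> S" "S \<subseteq> (\<Union>y\<in>C. ball y r)"
    using S r compactE_image[OF S, of S "\<lambda>y. ball y r"] by (metis UN_I centre_in_ball open_ball subsetI)
  have "UNIV \<subseteq> - S \<union> (\<Union>y\<in>C. ball y r)" using C by auto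
  have Sb: "- S \<in> sets \<mu>"
    using compact_imp_closed[OF S] by (simp add: sets)
  have "(\<Union>y\<in>C. ball y r) \<in> null_sets \<mu>"
    using C z by (intro null_sets.finite_UN) (auto simp: null_sets_def sets)
  moreover have "- S \<in> null_sets \<mu>"
    using \<mu> Sb by (auto simp: null_sets_def uniform_on_def)
  ultimately have "- S \<union> (\<Union>y\<in>C. ball y r) \<in> null_sets \<mu>" by (rule null_sets.Un[rotated])
  moreover have "- S \<union> (\<Union>y\<in>C. ball y r) = UNIV" using C by auto
  ultimately show False using pos by (auto simp: null_sets_def)
qed

text \<open>Fubini's theorem for the set of pairs at distance less than \<open>r\<close>.\<close>

lemma nn_integral_ball_swap:
  fixes \<mu> \<nu> :: "'a::euclidean_space measure"
  assumes \<mu>: "sets \<mu> = sets borel" "finite_measure \<mu>" and \<nu>: "sets \<nu> = sets borel" "finite_measure \<nu>"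
    and U[measurable]: "U \<in> sets borel"
  shows "(\<integral>\<^sup>+x. indicator U x * emeasure \<nu> (U \<inter> ball x r) \<partial>\<mu>) = (\<integral>\<^sup>+y. indicator U y * emeasure \<mu> (U \<inter> ball y r) \<partial>\<nu>)"
proof -
  note [measurable_cong] = \<mu>(1) \<nu>(1)
  interpret \<mu>: finite_measure \<mu> by fact
  interpret \<nu>: finite_measure \<nu> by fact
  interpret P: pair_sigma_finite \<mu> \<nu> ..
  have [measurable]: "ball x r \<in> sets borel" for x :: 'a by simp
  have 1: "indicator U x * emeasure \<nu> (U \<inter> ball x r) = (\<integral>\<^sup>+y. indicator U x * indicator U y * indicator {y. dist x y < r} y \<partial>\<nu>)" for x
  proof -
    have "(\<integral>\<^sup>+y. indicator U x * indicator U y * indicator {y. dist x y < r} y \<partial>\<nu>)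
      = (\<integral>\<^sup>+y. indicator U x * indicator (U \<inter> ball x r) y \<partial>\<nu>)"
      by (intro nn_integral_cong) (auto simp: indicator_def)
    also have "\<dots> = indicator U x * emeasure \<nu> (U \<inter> ball x r)"
      by (rule nn_integral_cmult_indicator) (simp add: \<nu>)
    finally show ?thesis by simp
  qed
  have 2: "indicator U y * emeasure \<mu> (U \<inter> ball y r) = (\<integral>\<^sup>+x. indicator U x * indicator U y * indicator {y. dist x y < r} y \<partial>\<mu>)" for y
  proof -
    have "(\<integral>\<^sup>+x. indicator U x * indicator U y * indicator {y. dist x y < r} y \<partial>\<mu>)
      = (\<integral>\<^sup>+x. indicator U y * indicator (U \<inter> ball y r) x \<partial>\<mu>)"
      by (intro nn_integral_cong) (auto simp: indicator_def dist_commute)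
    also have "\<dots> = indicator U y * emeasure \<mu> (U \<inter> ball y r)"
      by (rule nn_integral_cmult_indicator) (simp add: \<mu>)
    finally show ?thesis by simp
  qed
  show ?thesis unfolding 1 2 by (rule P.Fubini'[symmetric]) measurable
qed

text \<open>
  Both sides are the mass, for the product of the two measures, of the pairs at distance less than \<open>r\<close>.
\<close>

lemma uniform_on_ball_ratio:
  assumes \<mu>: "uniform_on S \<mu>" and \<nu>: "uniform_on S \<nu>" and S: "compact S" and x: "x \<in> S" and r: "0 < r"
  shows "emeasure \<nu> (ball x r) * emeasure \<mu> UNIV = emeasure \<mu> (ball x r) * emeasure \<nu> UNIV"
proof -
  have int: "(\<integral>\<^sup>+y. indicator UNIV y * emeasure \<nu> (UNIV \<inter> ball y r) \<partial>\<mu>) = emeasure \<nu> (ball x r) * emeasure \<mu> UNIV"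
    if \<mu>: "uniform_on S \<mu>" and \<nu>: "uniform_on S \<nu>" for \<mu> \<nu>
  proof -
    have sets: "sets \<mu> = sets borel" "space \<mu> = UNIV"
      using \<mu> sets_eq_imp_space_eq[of \<mu> borel] by (auto simp: uniform_on_def)
    have "- S \<in> null_sets \<mu>"
      using \<mu> compact_imp_closed[OF S] by (auto simp: null_sets_def uniform_on_def)
    then have "AE y in \<mu>. y \<in> S" by (auto dest: AE_not_in)
    then have "AE y in \<mu>. indicator UNIV y * emeasure \<nu> (UNIV \<inter> ball y r) = emeasure \<nu> (ball x r)"
    proof eventually_elim
      case (elim y)
      then show ?case using \<nu> x r unfolding uniform_on_def by (metis Int_UNIV_left UNIV_I indicator_simps(1) mult_1)
    qed
    then have "(\<integral>\<^sup>+y. indicator UNIV y * emeasure \<nu> (UNIV \<inter> ball y r) \<partial>\<mu>) = (\<integral>\<^sup>+y. emeasure \<nu> (ball x r) \<partial>\<mu>)"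
      by (rule nn_integral_cong_AE)
    then show ?thesis by (simp add: sets)
  qed
  have "(\<integral>\<^sup>+y. indicator UNIV y * emeasure \<nu> (UNIV \<inter> ball y r) \<partial>\<mu>) = (\<integral>\<^sup>+y. indicator UNIV y * emeasure \<mu> (UNIV \<inter> ball y r) \<partial>\<nu>)"
    using \<mu> \<nu> by (intro nn_integral_ball_swap) (auto simp: uniform_on_def)
  then show ?thesis by (simp only: int[OF \<mu> \<nu>] int[OF \<nu> \<mu>])
qed

text \<open>
  For \<open>x\<close> in an open set \<open>U\<close> the quotient \<open>\<nu> (U \<inter> ball x r) / \<nu> (ball x r)\<close> tends to one as \<open>r\<close> tends to
  zero.  Integrate this over \<open>U\<close> with respect to \<open>\<mu>\<close>, apply Fatou's lemma and interchange the integrals.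
\<close>

lemma uniform_on_open_le:
  assumes \<mu>: "uniform_on S \<mu>" and \<nu>: "uniform_on S \<nu>" and S: "compact S"
    and pos: "emeasure \<mu> UNIV \<noteq> 0" "emeasure \<nu> UNIV \<noteq> 0" and U: "open U"
  shows "emeasure \<mu> U * emeasure \<nu> UNIV \<le> emeasure \<mu> UNIV * emeasure \<nu> U"
proof (cases "S = {}")
  case True
  then show ?thesis using \<mu> pos by (simp add: uniform_on_def)
next
  case False
  then obtain x0 where x0: "x0 \<in> S" by blast
  have fin: "finite_measure \<mu>" "finite_measure \<nu>" and sets: "sets \<mu> = sets borel" "sets \<nu> = sets borel"
    using \<mu> \<nu> by (auto simp: uniform_on_def)
  note [measurable_cong] = sets
  have sp: "space \<mu> = UNIV" "space \<nu> = UNIV" using sets_eq_imp_space_eq[OF sets(1)] sets_eq_imp_space_eq[OF sets(2)] by simp_all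
  have [measurable]: "U \<in> sets borel" using U by simp
  have [measurable]: "ball x r \<in> sets borel" for x :: 'a and r by simp
  interpret \<mu>: finite_measure \<mu> by fact
  interpret \<nu>: finite_measure \<nu> by fact
  define M where "M = emeasure \<mu> UNIV"
  define N where "N = emeasure \<nu> UNIV"
  define r where "r k = 1 / real (Suc k)" for k
  have r: "0 < r k" for k by (simp add: r_def)
  define g where "g k = emeasure \<mu> (ball x0 (r k))" for k
  define h where "h k = emeasure \<nu> (ball x0 (r k))" for k
  have h0: "h k \<noteq> 0" "h k \<noteq> top" for k
    using uniform_on_ball_pos[OF \<nu> S pos(2) x0 r] \<nu>.emeasure_finite by (auto simp: h_def)
  have N0: "N \<noteq> 0" "N \<noteq> top" using pos \<nu>.emeasure_finite by (auto simp: N_def)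
  have gh: "h k * M = g k * N" for k
    unfolding h_def g_def M_def N_def by (rule uniform_on_ball_ratio[OF \<mu> \<nu> S x0 r])
  define \<phi> where "\<phi> k x = indicator U x * emeasure \<nu> (U \<inter> ball x (r k)) / h k" for k x
  have [measurable]: "(\<lambda>x. emeasure \<nu> (U \<inter> ball x (r k))) \<in> borel_measurable borel" for k
  proof -
    have "(\<lambda>x. \<integral>\<^sup>+y. indicator U y * indicator {y. dist x y < r k} y \<partial>\<nu>) \<in> borel_measurable borel"
      by measurable
    moreover have "emeasure \<nu> (U \<inter> ball x (r k)) = (\<integral>\<^sup>+y. indicator U y * indicator {y. dist x y < r k} y \<partial>\<nu>)" for x
    proof -
      have "emeasure \<nu> (U \<inter> ball x (r k)) = (\<integral>\<^sup>+y. indicator (U \<inter> ball x (r k)) y \<partial>\<nu>)"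
        by (simp add: sets)
      also have "\<dots> = (\<integral>\<^sup>+y. indicator U y * indicator {y. dist x y < r k} y \<partial>\<nu>)"
        by (intro nn_integral_cong) (auto simp: indicator_def)
      finally show ?thesis .
    qed
    ultimately show ?thesis by simp
  qed
  have [measurable]: "\<phi> k \<in> borel_measurable \<mu>" for k
    unfolding \<phi>_def by measurable
  have "- S \<in> null_sets \<mu>" "- S \<in> null_sets \<nu>"
    using \<mu> \<nu> compact_imp_closed[OF S] by (auto simp: null_sets_def uniform_on_def)
  then have AE: "AE x in \<mu>. x \<in> S" "AE x in \<nu>. x \<in> S"
    by (auto dest: AE_not_in)
  have "emeasure \<mu> U = (\<integral>\<^sup>+x. indicator U x \<partial>\<mu>)" by (simp add: sets)
  also have "\<dots> \<le> (\<integral>\<^sup>+x. liminf (\<lambda>k. \<phi> k x) \<partial>\<mu>)"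
  proof (rule nn_integral_mono_AE, use AE(1) in eventually_elim)
    case (elim x)
    show ?case
    proof (cases "x \<in> U")
      case True
      then obtain e where e: "0 < e" "ball x e \<subseteq> U" using U open_contains_ball by blast
      have "r \<longlonglongrightarrow> 0" unfolding r_def by (rule LIMSEQ_Suc[OF lim_1_over_n])
      then have "eventually (\<lambda>k. r k < e) sequentially" using e(1) by (rule order_tendstoD(2))
      then have "eventually (\<lambda>k. \<phi> k x = 1) sequentially"
      proof eventually_elim
        case (elim k)
        then have "U \<inter> ball x (r k) = ball x (r k)" using e by (auto simp: subset_eq)
        moreover have "emeasure \<nu> (ball x (r k)) = h k"
          using \<nu> \<open>x \<in> S\<close> x0 r[of k] unfolding uniform_on_def h_def by blast
        ultimately show ?case using True h0[of k] by (simp add: \<phi>_def ennreal_divide_self less_top)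
      qed
      then have "liminf (\<lambda>k. \<phi> k x) = liminf (\<lambda>k. 1 :: ennreal)" by (rule Liminf_eq)
      also have "\<dots> = 1" by (simp add: Liminf_const)
      finally show ?thesis using True by simp
    qed simp
  qed
  also have "\<dots> \<le> liminf (\<lambda>k. \<integral>\<^sup>+x. \<phi> k x \<partial>\<mu>)"
    by (rule nn_integral_liminf) measurable
  also have "\<dots> \<le> liminf (\<lambda>k. M / N * emeasure \<nu> U)"
  proof (rule Liminf_mono, rule always_eventually, rule allI)
    fix k
    have "(\<integral>\<^sup>+x. \<phi> k x \<partial>\<mu>) = (\<integral>\<^sup>+x. indicator U x * emeasure \<nu> (U \<inter> ball x (r k)) \<partial>\<mu>) / h k"
      unfolding \<phi>_def by (rule nn_integral_divide) measurable
    also have "(\<integral>\<^sup>+x. indicator U x * emeasure \<nu> (U \<inter> ball x (r k)) \<partial>\<mu>)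
        = (\<integral>\<^sup>+y. indicator U y * emeasure \<mu> (U \<inter> ball y (r k)) \<partial>\<nu>)"
      by (intro nn_integral_ball_swap sets fin) measurable
    also have "\<dots> \<le> (\<integral>\<^sup>+y. g k * indicator U y \<partial>\<nu>)"
    proof (rule nn_integral_mono_AE, use AE(2) in eventually_elim)
      case (elim y)
      have "emeasure \<mu> (U \<inter> ball y (r k)) \<le> emeasure \<mu> (ball y (r k))"
        by (intro emeasure_mono) (auto simp: sets)
      also have "\<dots> = g k"
        using \<mu> elim x0 r[of k] unfolding uniform_on_def g_def by blast
      finally show ?case by (auto simp: indicator_def)
    qed
    also have "\<dots> = g k * emeasure \<nu> U" by (rule nn_integral_cmult_indicator) measurable
    finally have "(\<integral>\<^sup>+x. \<phi> k x \<partial>\<mu>) \<le> g k * emeasure \<nu> U / h k"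
      by (simp add: divide_right_mono_ennreal)
    also have "\<dots> = M / N * emeasure \<nu> U"
    proof -
      have "g k / h k = M / N"
      proof -
        have "g k = g k * N / N" using N0 by (simp add: ennreal_mult_divide_eq)
        also have "\<dots> = h k * M / N" by (simp add: gh)
        finally have "g k = h k * (M / N)" by (simp add: ennreal_times_divide)
        then show ?thesis using h0[of k] by (metis ennreal_mult_divide_eq mult.commute)
      qed
      then show ?thesis by (metis divide_ennreal_def mult.assoc mult.commute)
    qed
    finally show "(\<integral>\<^sup>+x. \<phi> k x \<partial>\<mu>) \<le> M / N * emeasure \<nu> U" .
  qed
  also have "\<dots> = M / N * emeasure \<nu> U" by (simp add: Liminf_const)
  finally have "emeasure \<mu> U * N \<le> M / N * emeasure \<nu> U * N" by (rule mult_right_mono) simp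
  also have "\<dots> = M * emeasure \<nu> U"
    using N0 by (metis divide_ennreal_def ennreal_mult_divide_eq mult.assoc mult.commute)
  finally show ?thesis by (simp add: M_def N_def)
qed

proposition uniform_on_unique:
  assumes \<mu>: "uniform_on S \<mu>" and \<nu>: "uniform_on S \<nu>" and S: "compact S"
    and pos: "emeasure \<nu> UNIV \<noteq> 0"
  obtains c where "c \<noteq> top" "emeasure \<mu> UNIV = c * emeasure \<nu> UNIV" "\<mu> = scale_measure c \<nu>"
proof (cases "emeasure \<mu> UNIV = 0")
  case True
  have sets: "sets \<mu> = sets \<nu>" "space \<mu> = UNIV" "sets \<mu> = sets borel"
    using \<mu> \<nu> sets_eq_imp_space_eq[of \<mu> borel] by (auto simp: uniform_on_def)
  have "\<mu> = scale_measure 0 \<nu>"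
  proof (rule measure_eqI)
    fix A assume "A \<in> sets \<mu>"
    have "emeasure \<mu> A \<le> emeasure \<mu> UNIV" using sets by (intro emeasure_mono) auto
    then show "emeasure \<mu> A = emeasure (scale_measure 0 \<nu>) A" using True by simp
  qed (simp add: sets)
  then show ?thesis using that[of 0] True by simp
next
  case False
  have sets: "sets \<mu> = sets borel" "sets \<nu> = sets borel" using \<mu> \<nu> by (auto simp: uniform_on_def)
  interpret \<mu>: finite_measure \<mu> using \<mu> by (simp add: uniform_on_def)
  interpret \<nu>: finite_measure \<nu> using \<nu> by (simp add: uniform_on_def)
  define c where "c = emeasure \<mu> UNIV / emeasure \<nu> UNIV"
  have c: "c \<noteq> top" using pos by (simp add: c_def ennreal_divide_eq_top_iff)
  have tot: "emeasure \<mu> UNIV = c * emeasure \<nu> UNIV"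
    unfolding c_def using pos \<nu>.emeasure_finite
    by (metis divide_ennreal_def ennreal_mult_divide_eq mult.assoc mult.commute)
  have eq: "emeasure \<mu> U = emeasure (scale_measure c \<nu>) U" if "open U" for U
  proof -
    have "emeasure \<mu> U * emeasure \<nu> UNIV = emeasure \<mu> UNIV * emeasure \<nu> U"
      using uniform_on_open_le[OF \<mu> \<nu> S False pos that] uniform_on_open_le[OF \<nu> \<mu> S pos False that]
      by (intro antisym) (simp_all add: mult.commute)
    also have "\<dots> = c * emeasure \<nu> U * emeasure \<nu> UNIV" by (simp add: tot mult_ac)
    finally have "emeasure \<mu> U = c * emeasure \<nu> U"
      using pos by (metis \<nu>.emeasure_finite ennreal_mult_divide_eq)
    then show ?thesis by simp
  qed
  have "\<mu> = scale_measure c \<nu>"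
  proof (rule measure_eqI_generator_eq[where E = "{U. open U}" and \<Omega> = UNIV and A = "\<lambda>_. UNIV"])
    show "sets \<mu> = sigma_sets UNIV {U. open U}" "sets (scale_measure c \<nu>) = sigma_sets UNIV {U. open U}"
      by (auto simp: sets borel_def)
    show "Int_stable {U :: 'a set. open U}" by (auto simp: Int_stable_def)
  qed (use eq tot \<mu>.emeasure_finite[of UNIV] in auto)
  with c tot show ?thesis using that by blast
qed

section \<open>Hausdorff measure of the sphere\<close>

lemma diameter_isometry_image:
  assumes "\<And>x y. dist (f x) (f y) = dist x y"
  shows "diameter (f ` S) = diameter S"
proof -
  have "f ` S \<times> f ` S = map_prod f f ` (S \<times> S)" by auto
  then have "(SUP (x, y)\<in>f ` S \<times> f ` S. dist x y) = (SUP (x, y)\<in>S \<times> S. dist x y)"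
    using assms by (simp add: image_image case_prod_unfold)
  then show ?thesis by (simp add: diameter_def)
qed

lemma hausdorff_outer_isometry_image_le:
  fixes f :: "'a::metric_space \<Rightarrow> 'b::metric_space"
  assumes f: "\<And>x y. dist (f x) (f y) = dist x y"
  shows "hausdorff_outer d (f ` A) \<le> hausdorff_outer d A"
  unfolding hausdorff_outer_def
proof (rule SUP_mono)
  fix \<delta> :: real assume \<delta>: "\<delta> \<in> {0<..}"
  have "hausdorff_pre d \<delta> (f ` A) \<le> hausdorff_pre d \<delta> A"
    unfolding hausdorff_pre_def[of d \<delta> A]
  proof (rule INF_greatest)
    fix U :: "nat \<Rightarrow> 'a set"
    assume "U \<in> {U. A \<subseteq> (\<Union>i. U i) \<and> (\<forall>i. bounded (U i) \<and> diameter (U i) \<le> \<delta>)}"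
    then have U: "A \<subseteq> (\<Union>i. U i)" "\<And>i. bounded (U i)" "\<And>i. diameter (U i) \<le> \<delta>" by auto
    have "bounded (f ` U i)" for i
    proof -
      obtain x e where "\<And>y. y \<in> U i \<Longrightarrow> dist x y \<le> e" using U(2)[of i] unfolding bounded_def by blast
      then show ?thesis unfolding bounded_def using f by (intro exI[of _ "f x"] exI[of _ e]) auto
    qed
    moreover have dia: "diameter (f ` U i) = diameter (U i)" for i
      by (rule diameter_isometry_image) (rule f)
    then have gauge: "hausdorff_gauge d (f ` U i) = hausdorff_gauge d (U i)" for i
      by (auto simp: hausdorff_gauge_def)
    moreover have "f ` A \<subseteq> (\<Union>i. f ` U i)" using U(1) by blast
    ultimately have "hausdorff_pre d \<delta> (f ` A) \<le> (\<Sum>i. hausdorff_gauge d (f ` U i))"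
      unfolding hausdorff_pre_def using U f
      by (intro INF_lower) (auto simp: dia)
    then show "hausdorff_pre d \<delta> (f ` A) \<le> (\<Sum>i. hausdorff_gauge d (U i))"
      by (simp add: gauge)
  qed
  with \<delta> show "\<exists>\<epsilon>\<in>{0<..}. hausdorff_pre d \<delta> (f ` A) \<le> hausdorff_pre d \<epsilon> A" by blast
qed

lemma unit_ball_vol_DIM_pos: "0 < unit_ball_vol (real n)"
  by (rule unit_ball_vol_pos) simp

lemma power_difference_le:
  fixes a b :: real
  assumes "0 \<le> b" "b \<le> a" "a \<le> 2"
  shows "a ^ n - b ^ n \<le> (a - b) * (n * 2 ^ n)"
proof -
  have "a ^ n - b ^ n = (a - b) * (\<Sum>i<n. b ^ (n - Suc i) * a ^ i)" by (rule power_diff_sumr2)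
  also have "\<dots> \<le> (a - b) * (\<Sum>i<n. 2 ^ n)"
  proof (intro mult_left_mono sum_mono)
    fix i assume "i \<in> {..<n}"
    have "b ^ (n - Suc i) * a ^ i \<le> 2 ^ (n - Suc i) * 2 ^ i"
      using assms by (intro mult_mono power_mono) auto
    also have "\<dots> = 2 ^ (n - Suc i + i)" by (simp add: power_add)
    also have "\<dots> \<le> 2 ^ n" using \<open>i \<in> {..<n}\<close> by (intro power_increasing) auto
    finally show "b ^ (n - Suc i) * a ^ i \<le> 2 ^ n" .
  qed (use assms in auto)
  finally show ?thesis by simp
qed

text \<open>
  Vitali's lemma covers the sphere by balls of radius \<open>5 \<rho>\<close> such that the balls of radius \<open>\<rho>\<close> are disjoint.
  As these lie in a shell of thickness \<open>2 \<rho>\<close>, there are at most \<open>O (\<rho> powr (1 - n))\<close> of them.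
\<close>

lemma hausdorff_outer_sphere_finite:
  "hausdorff_outer (DIM('a) - 1) (sphere (0::'a::euclidean_space) 1) \<noteq> top"
proof -
  define n where "n = DIM('a)"
  have n: "1 \<le> n" using DIM_positive[where 'a = 'a] by (simp add: n_def Suc_leI)
  define S where "S = sphere (0::'a) 1"
  define V where "V = unit_ball_vol (real n)"
  have V: "0 < V" unfolding V_def by (rule unit_ball_vol_DIM_pos)
  define K where "K = 2 * (real n * 2 ^ n)"
  define B where "B = unit_ball_vol (real (n - 1)) * 5 ^ (n - 1) * K"
  have "hausdorff_pre (n - 1) \<delta> S \<le> ennreal B" if \<delta>: "0 < \<delta>" for \<delta>
  proof -
    define \<rho> where "\<rho> = min \<delta> 1 / 10"
    have \<rho>: "0 < \<rho>" "\<rho> \<le> 1" "10 * \<rho> \<le> \<delta>" using \<delta> by (auto simp: \<rho>_def)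
    have "S \<subseteq> (\<Union>x\<in>S. cball x \<rho>)" using \<rho> by auto
    then obtain C where C: "countable C" "C \<subseteq> S"
      "pairwise (\<lambda>i j. disjnt (cball i \<rho>) (cball j \<rho>)) C" "S \<subseteq> (\<Union>i\<in>C. cball i (5 * \<rho>))"
      by (rule Vitali_covering_lemma_cballs[where a = "\<lambda>x. x" and r = "\<lambda>_. \<rho>" and B = \<rho>]) (use \<rho> in auto)
    have count: "real (card F) * \<rho> ^ n \<le> K * \<rho>" if F: "F \<subseteq> C" "finite F" for F
    proof -
      have "(\<Union>x\<in>F. cball x \<rho>) \<union> ball 0 (1 - \<rho>) \<subseteq> cball (0::'a) (1 + \<rho>)"
      proof -
        have "norm y \<le> 1 + \<rho>" if "x \<in> F" "dist x y \<le> \<rho>" for x y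
          using that F C(2) norm_triangle_ineq2[of y x] by (auto simp: S_def dist_norm norm_minus_commute)
        then show ?thesis using \<rho> by auto
      qed
      then have "emeasure lborel ((\<Union>x\<in>F. cball x \<rho>) \<union> ball 0 (1 - \<rho>)) \<le> emeasure lborel (cball (0::'a) (1 + \<rho>))"
        by (intro emeasure_mono) auto
      also have "emeasure lborel ((\<Union>x\<in>F. cball x \<rho>) \<union> ball 0 (1 - \<rho>))
          = emeasure lborel (\<Union>x\<in>F. cball x \<rho>) + emeasure lborel (ball (0::'a) (1 - \<rho>))"
      proof (rule plus_emeasure[symmetric])
        show "(\<Union>x\<in>F. cball x \<rho>) \<inter> ball 0 (1 - \<rho>) = {}"
        proof -
          have "1 - \<rho> \<le> norm y" if "x \<in> F" "dist x y \<le> \<rho>" for x y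
            using that F C(2) norm_triangle_ineq2[of x y] by (auto simp: S_def dist_norm)
          then show ?thesis by fastforce
        qed
        show "(\<Union>x\<in>F. cball x \<rho>) \<in> sets lborel"
          using F by (intro sets.finite_UN) auto
      qed simp
      also have "emeasure lborel (\<Union>x\<in>F. cball x \<rho>) = (\<Sum>x\<in>F. emeasure lborel (cball x \<rho>))"
        using F C(3) by (intro sum_emeasure[symmetric]) (auto simp: disjoint_family_on_def pairwise_def disjnt_def)
      also have "\<dots> = ennreal (real (card F) * (V * \<rho> ^ n))"
        using \<rho> V by (simp add: emeasure_cball V_def n_def ennreal_mult ennreal_of_nat_eq_real_of_nat)
      finally have "ennreal (real (card F) * (V * \<rho> ^ n)) + ennreal (V * (1 - \<rho>) ^ n) \<le> ennreal (V * (1 + \<rho>) ^ n)"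
        using \<rho> by (simp add: emeasure_cball emeasure_ball V_def n_def)
      then have "real (card F) * (V * \<rho> ^ n) + V * (1 - \<rho>) ^ n \<le> V * (1 + \<rho>) ^ n"
        using \<rho> V by (simp add: ennreal_plus[symmetric] del: ennreal_plus)
      then have "V * (real (card F) * \<rho> ^ n) \<le> V * ((1 + \<rho>) ^ n - (1 - \<rho>) ^ n)"
        by (simp add: algebra_simps)
      then have "real (card F) * \<rho> ^ n \<le> (1 + \<rho>) ^ n - (1 - \<rho>) ^ n"
        using V by (rule mult_left_le_imp_le)
      also have "\<dots> \<le> ((1 + \<rho>) - (1 - \<rho>)) * (n * 2 ^ n)"
        using \<rho> by (intro power_difference_le) auto
      also have "\<dots> = K * \<rho>" by (simp add: K_def)
      finally show ?thesis .
    qed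
    have "card F \<le> nat \<lceil>K * \<rho> / \<rho> ^ n\<rceil>" if "F \<subseteq> C" "finite F" for F
    proof -
      have "real (card F) \<le> K * \<rho> / \<rho> ^ n" using count[OF that] \<rho> by (simp add: pos_le_divide_eq)
      then show ?thesis by linarith
    qed
    then have fC: "finite C" using finite_if_finite_subsets_card_bdd by blast
    have card: "real (card C) * \<rho> ^ (n - 1) \<le> K"
    proof -
      have "real (card C) * \<rho> ^ (n - 1) * \<rho> \<le> K * \<rho>"
        using count[OF order_refl fC] n by (simp add: mult.assoc flip: power_Suc2)
      then show ?thesis using \<rho> by simp
    qed
    obtain e where e: "bij_betw e {0..<card C} C" using ex_bij_betw_nat_finite[OF fC] by blast
    define U where "U i = (if i < card C then cball (e i) (5 * \<rho>) else {})" for i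
    have g: "hausdorff_gauge (n - 1) (U i) = (if i < card C then ennreal (unit_ball_vol (real (n - 1)) * (5 * \<rho>) ^ (n - 1)) else 0)" for i
      using \<rho> by (auto simp: U_def hausdorff_gauge_def diameter_cball)
    have "hausdorff_pre (n - 1) \<delta> S \<le> (\<Sum>i. hausdorff_gauge (n - 1) (U i))"
      unfolding hausdorff_pre_def
    proof (rule INF_lower, clarsimp, intro conjI)
      show "S \<subseteq> (\<Union>i. U i)"
      proof
        fix x assume "x \<in> S"
        then obtain c where c: "c \<in> C" "x \<in> cball c (5 * \<rho>)" using C(4) by blast
        then obtain i where "i < card C" "e i = c" using e by (metis atLeastLessThan_iff bij_betw_iff_bijections)
        then show "x \<in> (\<Union>i. U i)" using c by (auto simp: U_def)
      qed
      show "\<forall>i. bounded (U i) \<and> diameter (U i) \<le> \<delta>"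
        using \<rho> \<delta> by (auto simp: U_def diameter_cball)
    qed
    also have "\<dots> = (\<Sum>i<card C. hausdorff_gauge (n - 1) (U i))"
      by (rule suminf_finite) (auto simp: g[simplified])
    also have "\<dots> = ennreal (real (card C) * (unit_ball_vol (real (n - 1)) * (5 * \<rho>) ^ (n - 1)))"
    proof -
      have "(\<Sum>i<card C. hausdorff_gauge (n - 1) (U i))
          = (\<Sum>i<card C. ennreal (unit_ball_vol (real (n - 1)) * (5 * \<rho>) ^ (n - 1)))"
        by (intro sum.cong) (auto simp: g[simplified])
      then show ?thesis using \<rho> by (simp add: ennreal_mult ennreal_of_nat_eq_real_of_nat)
    qed
    also have "\<dots> = ennreal (unit_ball_vol (real (n - 1)) * 5 ^ (n - 1) * (real (card C) * \<rho> ^ (n - 1)))"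
      by (simp add: power_mult_distrib mult_ac)
    also have "\<dots> \<le> ennreal B"
      unfolding B_def by (intro ennreal_leI mult_left_mono card) simp
    finally show ?thesis .
  qed
  then have "hausdorff_outer (n - 1) S \<le> ennreal B"
    unfolding hausdorff_outer_def by (intro SUP_least) auto
  then show ?thesis by (auto simp: S_def n_def top_unique)
qed

definition shell_cone :: "'a::euclidean_space set \<Rightarrow> 'a set" where
  "shell_cone T = (\<lambda>(r, u). r *\<^sub>R u) ` ({1..2} \<times> T)"

lemma compact_shell_cone: "compact T \<Longrightarrow> compact (shell_cone T)"
  unfolding shell_cone_def case_prod_unfold
  by (intro compact_continuous_image compact_Times continuous_intros) auto

text \<open>
  A truncated cone over a set of diameter less than \<open>e\<close> is covered by \<open>O (1 / e)\<close> balls of radius \<open>3 e\<close>.  Finally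
  \<open>e\<close> tends to the diameter; this also covers single points, whose diameter is zero.
\<close>

lemma emeasure_shell_cone_le:
  fixes T :: "'a::euclidean_space set"
  assumes T: "compact T" "T \<subseteq> sphere 0 1" "diameter T \<le> 1"
  shows "emeasure lborel (shell_cone T)
    \<le> ennreal (3 * unit_ball_vol DIM('a) * 3 ^ DIM('a) * diameter T ^ (DIM('a) - 1))"
proof (cases "T = {}")
  case True
  then show ?thesis by (simp add: shell_cone_def)
next
  case False
  then obtain u0 where u0: "u0 \<in> T" by blast
  define n where "n = DIM('a)"
  have n: "1 \<le> n" using DIM_positive[where 'a = 'a] by (simp add: n_def Suc_leI)
  define V where "V = unit_ball_vol (real n)"
  have V: "0 < V" unfolding V_def by (rule unit_ball_vol_DIM_pos)
  define d where "d = diameter T"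
  have bT: "bounded T" using T compact_imp_bounded by blast
  have d: "0 \<le> d" "d \<le> 1" using T bT by (auto simp: d_def diameter_ge_0)
  have bound: "emeasure lborel (shell_cone T) \<le> ennreal (3 * V * 3 ^ n * e ^ (n - 1))" if e: "d < e" "e < 2" for e
  proof -
    have e0: "0 < e" using d e by simp
    define J where "J = nat \<lfloor>1 / e\<rfloor>"
    have "shell_cone T \<subseteq> (\<Union>j\<in>{..J}. cball ((1 + real j * e) *\<^sub>R u0) (3 * e))"
    proof
      fix y assume "y \<in> shell_cone T"
      then obtain r u where r: "1 \<le> r" "r \<le> 2" and u: "u \<in> T" and y: "y = r *\<^sub>R u"
        by (auto simp: shell_cone_def)
      define j where "j = nat \<lfloor>(r - 1) / e\<rfloor>"
      have f0: "0 \<le> \<lfloor>(r - 1) / e\<rfloor>" using r e0 by simp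
      have "(r - 1) / e \<le> 1 / e" using r e0 by (intro divide_right_mono) auto
      then have jJ: "j \<le> J" unfolding j_def J_def by (intro nat_mono floor_mono)
      have "real j \<le> (r - 1) / e" "(r - 1) / e < real j + 1"
        using f0 unfolding j_def by linarith+
      then have rj: "real j * e \<le> r - 1" "r - 1 < (real j + 1) * e"
        using e0 by (simp_all add: pos_le_divide_eq pos_divide_less_eq)
      then have "\<bar>(1 + real j * e) - r\<bar> \<le> e" by (simp add: algebra_simps)
      moreover have "dist u0 u \<le> e"
        using diameter_bounded_bound[OF bT u0 u] e by (simp add: d_def)
      moreover have "norm u0 = 1" using T u0 by auto
      moreover have "dist ((1 + real j * e) *\<^sub>R u0) y \<le> \<bar>(1 + real j * e) - r\<bar> * norm u0 + r * dist u0 u"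
      proof -
        have "(1 + real j * e) *\<^sub>R u0 - y = ((1 + real j * e) - r) *\<^sub>R u0 + r *\<^sub>R (u0 - u)"
          by (simp add: y algebra_simps)
        then have "dist ((1 + real j * e) *\<^sub>R u0) y \<le> norm (((1 + real j * e) - r) *\<^sub>R u0) + norm (r *\<^sub>R (u0 - u))"
          by (simp only: dist_norm norm_triangle_ineq)
        then show ?thesis using r by (simp add: dist_norm)
      qed
      moreover have "r * dist u0 u \<le> 2 * e"
        using r \<open>dist u0 u \<le> e\<close> by (intro mult_mono) auto
      ultimately have "dist ((1 + real j * e) *\<^sub>R u0) y \<le> 3 * e" by simp
      then show "y \<in> (\<Union>j\<in>{..J}. cball ((1 + real j * e) *\<^sub>R u0) (3 * e))" using jJ by auto
    qed
    then have "emeasure lborel (shell_cone T) \<le> emeasure lborel (\<Union>j\<in>{..J}. cball ((1 + real j * e) *\<^sub>R u0) (3 * e))"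
      by (intro emeasure_mono) auto
    also have "\<dots> \<le> (\<Sum>j\<in>{..J}. emeasure lborel (cball ((1 + real j * e) *\<^sub>R u0) (3 * e)))"
      by (intro emeasure_subadditive_finite) auto
    also have "\<dots> = ennreal (real (Suc J) * (V * (3 * e) ^ n))"
      using e0 V by (simp add: emeasure_cball V_def n_def ennreal_mult ennreal_of_nat_eq_real_of_nat del: of_nat_Suc)
    also have "\<dots> \<le> ennreal (3 / e * (V * (3 * e) ^ n))"
    proof (intro ennreal_leI mult_right_mono)
      have "real J \<le> 1 / e" using e0 by (simp add: J_def)
      moreover have "1 \<le> 2 / e" using e e0 by simp
      ultimately show "real (Suc J) \<le> 3 / e" by (simp add: field_simps)
    qed (use V e0 in auto)
    also have "3 / e * (V * (3 * e) ^ n) = 3 * V * 3 ^ n * e ^ (n - 1)"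
    proof -
      have "e ^ n = e ^ (n - 1) * e" using n by (simp flip: power_Suc2)
      then show ?thesis using e0 by (simp add: power_mult_distrib)
    qed
    finally show ?thesis .
  qed
  have "emeasure lborel (shell_cone T) < \<infinity>"
    using compact_imp_bounded[OF compact_shell_cone[OF T(1)]] by (rule emeasure_bounded_finite)
  then obtain m where m: "0 \<le> m" "emeasure lborel (shell_cone T) = ennreal m"
    by (cases "emeasure lborel (shell_cone T)") auto
  have "m \<le> 3 * V * 3 ^ n * d ^ (n - 1)"
  proof (rule tendsto_lowerbound)
    show "((\<lambda>e. 3 * V * 3 ^ n * e ^ (n - 1)) \<longlongrightarrow> 3 * V * 3 ^ n * d ^ (n - 1)) (at_right d)"
      by (intro tendsto_intros)
    show "\<forall>\<^sub>F e in at_right d. m \<le> 3 * V * 3 ^ n * e ^ (n - 1)"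
    proof (rule eventually_at_rightI[of d 2])
      fix e assume e: "e \<in> {d<..<2}"
      then have "0 \<le> 3 * V * 3 ^ n * e ^ (n - 1)" using V d by simp
      then show "m \<le> 3 * V * 3 ^ n * e ^ (n - 1)" using bound[of e] e m by simp
    qed (use d in simp)
  qed simp
  then show ?thesis by (simp add: m V_def n_def d_def ennreal_leI)
qed

text \<open>
  Given a cover of the sphere, the truncated cones over its members cover the shell between the radii one and two, and
  the volume of each cone is at most a constant times the gauge of the corresponding member.  So the total gauge is
  bounded below by the volume of the shell.
\<close>

lemma hausdorff_outer_sphere_nonzero:
  "hausdorff_outer (DIM('a) - 1) (sphere (0::'a::euclidean_space) 1) \<noteq> 0"
proof
  define n where "n = DIM('a)"
  have n: "1 \<le> n" using DIM_positive[where 'a = 'a] by (simp add: n_def Suc_leI)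
  define S where "S = sphere (0::'a) 1"
  define V where "V = unit_ball_vol (real n)"
  have V: "0 < V" unfolding V_def by (rule unit_ball_vol_DIM_pos)
  define W where "W = unit_ball_vol (real (n - 1))"
  have W: "0 < W" unfolding W_def by (rule unit_ball_vol_DIM_pos)
  define K where "K = 3 * V * 3 ^ n * 2 ^ (n - 1) / W"
  have K: "0 < K" using V W by (simp add: K_def)
  have lower: "ennreal (V * (2 ^ n - 1)) \<le> ennreal K * (\<Sum>i. hausdorff_gauge (n - 1) (U i))"
    if U: "S \<subseteq> (\<Union>i. U i)" "\<And>i. bounded (U i)" "\<And>i. diameter (U i) \<le> 1" for U :: "nat \<Rightarrow> 'a set"
  proof -
    define T where "T i = closure (U i) \<inter> S" for i
    have T: "compact (T i)" "T i \<subseteq> sphere 0 1" for i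
      unfolding T_def S_def using U(2) by (auto intro!: closed_Int_compact)
    have dT: "diameter (T i) \<le> diameter (U i)" for i
      using diameter_subset[of "T i" "closure (U i)"] U(2)[of i]
      bounded_closure[OF U(2)[of i]] by (auto simp: T_def diameter_closure)
    have part: "emeasure lborel (shell_cone (T i)) \<le> ennreal K * hausdorff_gauge (n - 1) (U i)" for i
    proof (cases "T i = {}")
      case False
      then have ne: "U i \<noteq> {}" by (auto simp: T_def)
      have "emeasure lborel (shell_cone (T i)) \<le> ennreal (3 * V * 3 ^ n * diameter (T i) ^ (n - 1))"
        unfolding V_def n_def using T dT[of i] U(3)[of i] by (intro emeasure_shell_cone_le) auto
      also have "\<dots> \<le> ennreal (3 * V * 3 ^ n * diameter (U i) ^ (n - 1))"
        using V dT[of i] T(1)[of i]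
        by (intro ennreal_leI mult_left_mono power_mono) (auto intro: diameter_ge_0 compact_imp_bounded)
      also have "\<dots> = ennreal (K * (W * (diameter (U i) / 2) ^ (n - 1)))"
        using W by (simp add: K_def power_divide mult_ac)
      also have "\<dots> = ennreal K * hausdorff_gauge (n - 1) (U i)"
        using ne K W U(2)[of i] by (simp add: hausdorff_gauge_def ennreal_mult diameter_ge_0 W_def)
      finally show ?thesis .
    qed (simp add: shell_cone_def)
    have "V * (2 ^ n - 1) + V = V * 2 ^ n" by (simp add: algebra_simps)
    have sub: "cball (0::'a) 2 \<subseteq> ball 0 1 \<union> (\<Union>i. shell_cone (T i))"
    proof
      fix y :: 'a assume y: "y \<in> cball 0 2"
      show "y \<in> ball 0 1 \<union> (\<Union>i. shell_cone (T i))"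
      proof (cases "norm y < 1")
        case False
        then have "norm y \<noteq> 0" by linarith
        then have "y /\<^sub>R norm y \<in> S" by (simp add: S_def)
        then obtain i where "y /\<^sub>R norm y \<in> U i" using U(1) by blast
        then have "y /\<^sub>R norm y \<in> T i" using \<open>y /\<^sub>R norm y \<in> S\<close> closure_subset by (auto simp: T_def)
        moreover have "y = norm y *\<^sub>R (y /\<^sub>R norm y)" using \<open>norm y \<noteq> 0\<close> by simp
        ultimately have "y \<in> shell_cone (T i)"
          unfolding shell_cone_def using False y by (intro image_eqI[of _ _ "(norm y, y /\<^sub>R norm y)"]) auto
        then show ?thesis by blast
      qed simp
    qed
    have m: "shell_cone (T i) \<in> sets lborel" for i
      using compact_shell_cone[OF T(1)[of i]] by (simp add: compact_imp_closed)
    have "emeasure lborel (cball (0::'a) 2) \<le> emeasure lborel (ball (0::'a) 1 \<union> (\<Union>i. shell_cone (T i)))"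
      using m by (intro emeasure_mono sub sets.Un sets.countable_UN) auto
    also have "\<dots> \<le> emeasure lborel (ball (0::'a) 1) + emeasure lborel (\<Union>i. shell_cone (T i))"
      using m by (intro emeasure_subadditive sets.countable_UN) auto
    also have "emeasure lborel (\<Union>i. shell_cone (T i)) \<le> (\<Sum>i. emeasure lborel (shell_cone (T i)))"
      using m by (intro emeasure_subadditive_countably) auto
    also have "\<dots> \<le> (\<Sum>i. ennreal K * hausdorff_gauge (n - 1) (U i))"
      by (intro suminf_le part) auto
    also have "\<dots> = ennreal K * (\<Sum>i. hausdorff_gauge (n - 1) (U i))" by simp
    finally have "ennreal (V * 2 ^ n) \<le> ennreal V + ennreal K * (\<Sum>i. hausdorff_gauge (n - 1) (U i))"
      by (simp add: emeasure_cball emeasure_ball V_def n_def add_left_mono)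
    then have "ennreal V + ennreal (V * (2 ^ n - 1)) \<le> ennreal V + ennreal K * (\<Sum>i. hausdorff_gauge (n - 1) (U i))"
      using V by (simp add: ennreal_plus[symmetric] algebra_simps del: ennreal_plus)
    then show ?thesis by (simp add: ennreal_add_left_cancel_le)
  qed
  assume "hausdorff_outer (DIM('a) - 1) (sphere (0::'a) 1) = 0"
  then have "hausdorff_pre (n - 1) 1 S = 0"
    using hausdorff_pre_le_outer[of 1 "n - 1" S] by (simp add: n_def S_def)
  moreover have p: "0 < V * (2 ^ n - 1) / K" using V K n by simp
  ultimately have "hausdorff_pre (n - 1) 1 S < ennreal (V * (2 ^ n - 1) / K)" by simp
  then obtain U :: "nat \<Rightarrow> 'a set" where U: "S \<subseteq> (\<Union>i. U i)" "\<forall>i. bounded (U i) \<and> diameter (U i) \<le> 1"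
    and less: "(\<Sum>i. hausdorff_gauge (n - 1) (U i)) < ennreal (V * (2 ^ n - 1) / K)"
    unfolding hausdorff_pre_def INF_less_iff by auto
  have "ennreal (V * (2 ^ n - 1)) \<le> ennreal K * (\<Sum>i. hausdorff_gauge (n - 1) (U i))"
    using U by (intro lower) auto
  also have "\<dots> < ennreal K * ennreal (V * (2 ^ n - 1) / K)"
    using less K by (intro ennreal_mult_strict_left_mono) auto
  also have "\<dots> = ennreal (V * (2 ^ n - 1))" using K p by (simp add: ennreal_mult[symmetric])
  finally show False by simp
qed

section \<open>Integration of radial functions times angular functions\<close>

text \<open>
  Surface measure before completion, extended by zero to a Borel measure on the whole space, where it can be
  compared with images of Lebesgue measure.
\<close>

definition sphere_borel :: "'a::euclidean_space measure" where
  "sphere_borel = density (hausdorff_measure (DIM('a) - 1)) (indicator (sphere 0 1))"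

lemma sets_sphere_borel [simp, measurable_cong]: "sets sphere_borel = sets borel"
  and space_sphere_borel [simp]: "space sphere_borel = UNIV"
  by (simp_all add: sphere_borel_def)

lemma emeasure_sphere_borel:
  fixes A :: "'a::euclidean_space set"
  assumes [measurable]: "A \<in> sets borel"
  shows "emeasure sphere_borel A = hausdorff_outer (DIM('a) - 1) (A \<inter> sphere 0 1)"
proof -
  have [measurable]: "sphere 0 1 \<in> sets (borel :: 'a measure)" by simp
  have "emeasure sphere_borel A = (\<integral>\<^sup>+x. indicator (sphere 0 1) x * indicator A x \<partial>hausdorff_measure (DIM('a) - 1))"
    unfolding sphere_borel_def by (rule emeasure_density) measurable
  also have "\<dots> = (\<integral>\<^sup>+x. indicator (A \<inter> sphere 0 1) x \<partial>hausdorff_measure (DIM('a) - 1))"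
    by (intro nn_integral_cong) (auto simp: indicator_def)
  also have "\<dots> = hausdorff_outer (DIM('a) - 1) (A \<inter> sphere 0 1)"
    by (simp add: emeasure_hausdorff_measure)
  finally show ?thesis .
qed

lemma uniform_on_sphere_borel: "uniform_on (sphere 0 1) (sphere_borel :: (real ^ 'n) measure)"
  unfolding uniform_on_def
proof (intro conjI ballI allI impI)
  show "finite_measure (sphere_borel :: (real ^ 'n) measure)"
    using hausdorff_outer_sphere_finite[where 'a = "real ^ 'n"]
    by (intro finite_measureI) (simp add: emeasure_sphere_borel)
  show "emeasure sphere_borel (- sphere 0 1 :: (real ^ 'n) set) = 0"
    by (subst emeasure_sphere_borel) (auto simp: hausdorff_outer_empty)
  have le: "emeasure sphere_borel (ball y r) \<le> emeasure sphere_borel (ball x r)"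
    if "x \<in> sphere 0 1" "y \<in> sphere 0 1" for x y :: "real ^ 'n" and r
  proof -
    have "norm x = norm y" using that by simp
    then obtain f where f: "orthogonal_transformation f" "f x = y"
      by (rule orthogonal_transformation_exists)
    have d: "dist (f a) (f b) = dist a b" "norm (f a) = norm a" for a b
      using f(1) by (auto simp: orthogonal_transformation_isometry orthogonal_transformation_norm)
    have "ball y r \<inter> sphere 0 1 \<subseteq> f ` (ball x r \<inter> sphere 0 1)"
    proof
      fix z assume z: "z \<in> ball y r \<inter> sphere 0 1"
      obtain w where w: "z = f w" using f(1) orthogonal_transformation_surj by (metis surjD)
      have "w \<in> ball x r \<inter> sphere 0 1" using z d(1)[of x w] d(2)[of w] f(2) by (simp add: w)
      then show "z \<in> f ` (ball x r \<inter> sphere 0 1)" using w by blast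
    qed
    then have "hausdorff_outer (DIM(real ^ 'n) - 1) (ball y r \<inter> sphere 0 1)
        \<le> hausdorff_outer (DIM(real ^ 'n) - 1) (f ` (ball x r \<inter> sphere 0 1))"
      by (rule hausdorff_outer_mono)
    also have "\<dots> \<le> hausdorff_outer (DIM(real ^ 'n) - 1) (ball x r \<inter> sphere 0 1)"
      using d(1) by (rule hausdorff_outer_isometry_image_le)
    finally show ?thesis by (simp add: emeasure_sphere_borel)
  qed
  fix x y :: "real ^ 'n" and r :: real
  assume "x \<in> sphere 0 1" "y \<in> sphere 0 1"
  then show "emeasure sphere_borel (ball x r) = emeasure sphere_borel (ball y r)"
    using le by (intro antisym) auto
qed simp

lemma emeasure_sphere_borel_UNIV: "emeasure (sphere_borel :: (real ^ 'n) measure) UNIV \<noteq> 0"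
  "emeasure (sphere_borel :: (real ^ 'n) measure) UNIV \<noteq> top"
  using hausdorff_outer_sphere_nonzero[where 'a = "real ^ 'n"] hausdorff_outer_sphere_finite[where 'a = "real ^ 'n"]
  by (simp_all add: emeasure_sphere_borel)

text \<open>
  By Vitali's covering theorem an open set is, up to a null set, a disjoint union of balls; an isometry maps
  balls to balls of the same radius.
\<close>

lemma emeasure_open_le_orthogonal_vimage:
  fixes f :: "'a::euclidean_space \<Rightarrow> 'a"
  assumes f: "orthogonal_transformation f" and U: "open U"
  shows "emeasure lborel U \<le> emeasure lborel (f -` U)"
proof -
  have lin: "linear f" using f by (rule orthogonal_transformation_linear)
  have d: "dist (f a) (f b) = dist a b" for a b
    using f by (simp add: orthogonal_transformation_isometry)
  have fi: "f (inv f a) = a" for a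
    using orthogonal_transformation_surj[OF f] by (rule surj_f_inv_f)
  have "continuous_on UNIV f"
    using linear_continuous_on[OF linear_conv_bounded_linear[THEN iffD1, OF lin]] .
  then have fU: "open (f -` U)" using U by (simp add: open_vimage)
  define K where "K = {(a, r). 0 < r \<and> ball a r \<subseteq> U}"
  have ex: "\<exists>i. i \<in> K \<and> x \<in> ball (fst i) (snd i) \<and> snd i < d" if xd: "x \<in> U" "0 < d" for x d
  proof -
    obtain e where e: "0 < e" "ball x e \<subseteq> U" by (rule openE[OF U xd(1)])
    define r where "r = min e d / 2"
    have "0 < r" "r < d" "r \<le> e" using e xd by (auto simp: r_def)
    then show ?thesis
      using e by (intro exI[of _ "(x, r)"]) (auto simp: K_def)
  qed
  obtain C where C: "countable C" "C \<subseteq> K"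
    "pairwise (\<lambda>i j. disjnt (ball (fst i) (snd i)) (ball (fst j) (snd j))) C"
    "negligible (U - (\<Union>i\<in>C. ball (fst i) (snd i)))"
    by (rule Vitali_covering_theorem_balls[of U K fst snd, OF ex])
  have vim: "f -` ball a r = ball (inv f a) r" for a r
    using d[of "inv f a"] by (auto simp: fi)
  define B where "B = (\<Union>i\<in>C. ball (fst i) (snd i))"
  have [measurable]: "B \<in> sets borel" unfolding B_def by (simp add: open_UN)
  have [measurable]: "U \<in> sets borel" using U by simp
  have "U - B \<in> null_sets lborel"
    using C(4) unfolding B_def[symmetric] negligible_iff_null_sets
    by (subst (asm) null_sets_completion_iff) auto
  then have "emeasure lborel (B \<union> (U - B)) = emeasure lborel B"
    by (intro emeasure_Un_null_set) auto
  moreover have "emeasure lborel U \<le> emeasure lborel (B \<union> (U - B))"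
    by (intro emeasure_mono) auto
  ultimately have "emeasure lborel U \<le> emeasure lborel B" by simp
  also have "\<dots> = (\<integral>\<^sup>+i. emeasure lborel (ball (fst i) (snd i)) \<partial>count_space C)"
    unfolding B_def using C
    by (intro emeasure_UN_countable) (auto simp: disjoint_family_on_def pairwise_def disjnt_def)
  also have "\<dots> = (\<integral>\<^sup>+i. emeasure lborel (f -` ball (fst i) (snd i)) \<partial>count_space C)"
  proof (intro nn_integral_cong)
    fix i assume "i \<in> space (count_space C)"
    then have "0 < snd i" using C(2) by (auto simp: K_def)
    then show "emeasure lborel (ball (fst i) (snd i)) = emeasure lborel (f -` ball (fst i) (snd i))"
      by (simp add: vim emeasure_ball)
  qed
  also have "\<dots> = emeasure lborel (\<Union>i\<in>C. f -` ball (fst i) (snd i))"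
  proof (rule emeasure_UN_countable[symmetric])
    show "disjoint_family_on (\<lambda>i. f -` ball (fst i) (snd i)) C"
      using C(3) unfolding disjoint_family_on_def pairwise_def disjnt_def by blast
  qed (simp_all add: vim C)
  also have "\<dots> \<le> emeasure lborel (f -` U)"
  proof (rule emeasure_mono)
    show "(\<Union>i\<in>C. f -` ball (fst i) (snd i)) \<subseteq> f -` U"
      using C(2) unfolding K_def by fastforce
  qed (use fU in simp)
  finally show ?thesis .
qed

lemma distr_lborel_orthogonal:
  fixes f :: "'a::euclidean_space \<Rightarrow> 'a"
  assumes f: "orthogonal_transformation f"
  shows "distr lborel borel f = lborel"
proof (rule lborel_eqI[symmetric])
  have lin: "linear f" using f by (rule orthogonal_transformation_linear)
  have cont: "continuous_on UNIV f"
    using linear_continuous_on[OF linear_conv_bounded_linear[THEN iffD1, OF lin]] .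
  then have [measurable]: "f \<in> borel_measurable borel"
    by (rule borel_measurable_continuous_onI)
  fix l u :: 'a
  assume le: "\<And>b. b \<in> Basis \<Longrightarrow> l \<bullet> b \<le> u \<bullet> b"
  have bij: "bij f" using f by (rule orthogonal_transformation_bij)
  have "inv f -` (f -` box l u) = box l u"
    using bij by (auto simp: bij_is_surj surj_f_inv_f)
  moreover have "open (f -` box l u)" using cont by (simp add: open_vimage open_box)
  ultimately have "emeasure lborel (f -` box l u) \<le> emeasure lborel (box l u)"
    using emeasure_open_le_orthogonal_vimage[OF orthogonal_transformation_inv[OF f], of "f -` box l u"] by simp
  moreover have "emeasure lborel (box l u) \<le> emeasure lborel (f -` box l u)"
    by (rule emeasure_open_le_orthogonal_vimage[OF f open_box])
  ultimately have "emeasure (distr lborel borel f) (box l u) = emeasure lborel (box l u)"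
    by (subst emeasure_distr) auto
  also have "\<dots> = ennreal (\<Prod>b\<in>Basis. (u - l) \<bullet> b)" using le by (simp add: emeasure_lborel_box_eq inner_diff_left)
  finally show "emeasure (distr lborel borel f) (box l u) = ennreal (\<Prod>b\<in>Basis. (u - l) \<bullet> b)" .
qed simp

definition radial_projection :: "'a::euclidean_space \<Rightarrow> 'a" where
  "radial_projection y = y /\<^sub>R norm y"

lemma measurable_radial_projection [measurable]: "radial_projection \<in> borel_measurable borel"
  unfolding radial_projection_def[abs_def] by measurable

text \<open>
  The image of a rotation invariant finite measure under the radial projection is rotation invariant,
  hence a multiple of surface measure.
\<close>

lemma uniform_on_radial_image:
  fixes \<phi> :: "real \<Rightarrow> ennreal"
  assumes [measurable]: "\<phi> \<in> borel_measurable borel"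
    and fin: "(\<integral>\<^sup>+(y::real ^ 'n). \<phi> (norm y) \<partial>lborel) \<noteq> top"
  shows "uniform_on (sphere 0 1) (distr (density lborel (\<lambda>y::real ^ 'n. \<phi> (norm y))) borel radial_projection)"
    (is "uniform_on _ ?\<mu>")
proof -
  have em: "emeasure ?\<mu> A = (\<integral>\<^sup>+y. \<phi> (norm y) * indicator A (radial_projection y) \<partial>lborel)"
    if [measurable]: "A \<in> sets borel" for A
  proof -
    have [measurable]: "radial_projection -` A \<in> sets borel"
      using measurable_sets[OF measurable_radial_projection that] by simp
    have "emeasure ?\<mu> A = emeasure (density lborel (\<lambda>y::real ^ 'n. \<phi> (norm y))) (radial_projection -` A)"
      by (subst emeasure_distr) auto
    also have "\<dots> = (\<integral>\<^sup>+y. \<phi> (norm y) * indicator (radial_projection -` A) y \<partial>lborel)"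
      by (rule emeasure_density) measurable
    finally show ?thesis by (simp add: indicator_def)
  qed
  show ?thesis
    unfolding uniform_on_def
  proof (intro conjI ballI allI impI)
    have "emeasure ?\<mu> UNIV \<noteq> top" using em[of UNIV] fin by simp
    then show "finite_measure ?\<mu>" by (intro finite_measureI) simp
    have "emeasure ?\<mu> (- sphere 0 1) = (\<integral>\<^sup>+(y::real ^ 'n). 0 \<partial>lborel)"
      unfolding em[of "- sphere 0 1", simplified] using AE_lborel_nonzero
      by (intro nn_integral_cong_AE) (auto elim!: eventually_mono simp: radial_projection_def indicator_def)
    then show "emeasure ?\<mu> (- sphere 0 1) = 0" by simp
  next
    fix x y :: "real ^ 'n" and r :: real
    assume "x \<in> sphere 0 1" "y \<in> sphere 0 1"
    then have "norm x = norm y" by simp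
    then obtain f where f: "orthogonal_transformation f" "f x = y"
      by (rule orthogonal_transformation_exists)
    have lin: "linear f" using f(1) by (rule orthogonal_transformation_linear)
    have [measurable]: "f \<in> borel_measurable borel"
      using linear_continuous_on[OF linear_conv_bounded_linear[THEN iffD1, OF lin]]
      by (rule borel_measurable_continuous_onI)
    have d: "dist (f a) (f b) = dist a b" "norm (f a) = norm a" for a b
      using f(1) by (auto simp: orthogonal_transformation_isometry orthogonal_transformation_norm)
    have rp: "radial_projection (f z) = f (radial_projection z)" for z
      using lin by (simp add: radial_projection_def d linear_cmul)
    have [measurable]: "ball y r \<in> sets borel" "ball x r \<in> sets borel" by simp_all
    have "emeasure ?\<mu> (ball y r) = (\<integral>\<^sup>+z. \<phi> (norm z) * indicator (ball y r) (radial_projection z) \<partial>distr lborel borel f)"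
      by (simp add: em distr_lborel_orthogonal[OF f(1)])
    also have "\<dots> = (\<integral>\<^sup>+z. \<phi> (norm (f z)) * indicator (ball y r) (radial_projection (f z)) \<partial>lborel)"
      by (rule nn_integral_distr) measurable
    also have "\<dots> = (\<integral>\<^sup>+z. \<phi> (norm z) * indicator (ball x r) (radial_projection z) \<partial>lborel)"
    proof (intro nn_integral_cong)
      fix z
      have "f (radial_projection z) \<in> ball y r \<longleftrightarrow> radial_projection z \<in> ball x r"
        using d(1)[of x "radial_projection z"] f(2) by simp
      then show "\<phi> (norm (f z)) * indicator (ball y r) (radial_projection (f z))
          = \<phi> (norm z) * indicator (ball x r) (radial_projection z)"
        by (simp add: rp d indicator_def)
    qed
    also have "\<dots> = emeasure ?\<mu> (ball x r)" by (simp add: em)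
    finally show "emeasure ?\<mu> (ball x r) = emeasure ?\<mu> (ball y r)" by simp
  qed simp
qed

lemma radial_image_eq:
  fixes \<phi> :: "real \<Rightarrow> ennreal"
  assumes [measurable]: "\<phi> \<in> borel_measurable borel"
    and fin: "(\<integral>\<^sup>+(y::real ^ 'n). \<phi> (norm y) \<partial>lborel) \<noteq> top"
  obtains c where "c \<noteq> top"
    "(\<integral>\<^sup>+(y::real ^ 'n). \<phi> (norm y) \<partial>lborel) = c * emeasure (sphere_borel :: (real ^ 'n) measure) UNIV"
    "distr (density lborel (\<lambda>y::real ^ 'n. \<phi> (norm y))) borel radial_projection = scale_measure c sphere_borel"
proof -
  obtain c where c: "c \<noteq> top" "emeasure (distr (density lborel (\<lambda>y::real ^ 'n. \<phi> (norm y))) borel radial_projection) UNIV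
      = c * emeasure (sphere_borel :: (real ^ 'n) measure) UNIV"
    "distr (density lborel (\<lambda>y::real ^ 'n. \<phi> (norm y))) borel radial_projection = scale_measure c sphere_borel"
    by (rule uniform_on_unique[OF uniform_on_radial_image[OF assms] uniform_on_sphere_borel compact_sphere
        emeasure_sphere_borel_UNIV(1)]) (rule that)
  moreover have "emeasure (distr (density lborel (\<lambda>y::real ^ 'n. \<phi> (norm y))) borel radial_projection) UNIV
      = (\<integral>\<^sup>+(y::real ^ 'n). \<phi> (norm y) \<partial>lborel)"
    by (subst emeasure_distr, measurable) (simp add: emeasure_density)
  ultimately show ?thesis using that by simp
qed

text \<open>
  A substitute for polar coordinates: the constant of proportionality is found by comparing total masses.
\<close>

lemma nn_integral_angular_radial:
  fixes g :: "real ^ 'n \<Rightarrow> ennreal" and \<phi> :: "real \<Rightarrow> ennreal"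
  assumes [measurable]: "g \<in> borel_measurable borel" "\<phi> \<in> borel_measurable borel"
    and fin: "(\<integral>\<^sup>+(y::real ^ 'n). \<phi> (norm y) \<partial>lborel) \<noteq> top"
  shows "(\<integral>\<^sup>+y. g (radial_projection y) * \<phi> (norm y) \<partial>lborel) * emeasure (sphere_borel :: (real ^ 'n) measure) UNIV
    = (\<integral>\<^sup>+x. g x \<partial>sphere_borel) * (\<integral>\<^sup>+(y::real ^ 'n). \<phi> (norm y) \<partial>lborel)"
proof -
  obtain c where c: "c \<noteq> top"
    "(\<integral>\<^sup>+(y::real ^ 'n). \<phi> (norm y) \<partial>lborel) = c * emeasure (sphere_borel :: (real ^ 'n) measure) UNIV"
    "distr (density lborel (\<lambda>y::real ^ 'n. \<phi> (norm y))) borel radial_projection = scale_measure c sphere_borel"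
    by (rule radial_image_eq[OF assms(2) fin])
  have "(\<integral>\<^sup>+y. g (radial_projection y) * \<phi> (norm y) \<partial>lborel)
      = (\<integral>\<^sup>+x. g x \<partial>distr (density lborel (\<lambda>y::real ^ 'n. \<phi> (norm y))) borel radial_projection)"
    by (subst nn_integral_distr, measurable) (simp add: nn_integral_density mult.commute)
  also have "\<dots> = c * (\<integral>\<^sup>+x. g x \<partial>sphere_borel)"
    unfolding c(3) by (rule nn_integral_scale_measure) measurable
  finally show ?thesis unfolding c(2) by (simp add: mult_ac)
qed

text \<open>
  The constant is positive, so that the right hand side is infinite whenever the radial integral is; otherwise
  \<open>nn_integral_angular_radial\<close> applies.
\<close>

lemma nn_integral_angular_radial_le:
  fixes g :: "real ^ 'n \<Rightarrow> ennreal"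
  assumes g[measurable]: "g \<in> borel_measurable borel" and fin: "(\<integral>\<^sup>+x. g x \<partial>sphere_borel) \<noteq> top"
  obtains c :: real where "0 < c"
    "\<And>\<phi>. \<phi> \<in> borel_measurable borel \<Longrightarrow>
      (\<integral>\<^sup>+y. g (radial_projection y) * \<phi> (norm y) \<partial>lborel) \<le> ennreal c * (\<integral>\<^sup>+(y::real ^ 'n). \<phi> (norm y) \<partial>lborel)"
proof -
  define A where "A = emeasure (sphere_borel :: (real ^ 'n) measure) UNIV"
  obtain a where a: "A = ennreal a" "0 < a"
    using emeasure_sphere_borel_UNIV[where 'n = 'n] unfolding A_def[symmetric]
    by (metis ennreal_cases ennreal_eq_0_iff not_le)
  obtain b where b: "(\<integral>\<^sup>+x. g x \<partial>sphere_borel) = ennreal b" "0 \<le> b"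
    using fin by (metis ennreal_cases)
  define c where "c = b / a + 1"
  have c: "0 < c" using a b by (simp add: c_def add_nonneg_pos)
  have "(\<integral>\<^sup>+y. g (radial_projection y) * \<phi> (norm y) \<partial>lborel) \<le> ennreal c * (\<integral>\<^sup>+(y::real ^ 'n). \<phi> (norm y) \<partial>lborel)"
    if \<phi>: "\<phi> \<in> borel_measurable borel" for \<phi>
  proof (cases "(\<integral>\<^sup>+(y::real ^ 'n). \<phi> (norm y) \<partial>lborel) = top")
    case True
    then show ?thesis using c by (simp add: ennreal_mult_top)
  next
    case False
    have "(\<integral>\<^sup>+y. g (radial_projection y) * \<phi> (norm y) \<partial>lborel)
      = (\<integral>\<^sup>+y. g (radial_projection y) * \<phi> (norm y) \<partial>lborel) * ennreal a * ennreal (1 / a)"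
      using a by (simp add: mult.assoc ennreal_mult[symmetric])
    also have "\<dots> = ennreal b * (\<integral>\<^sup>+(y::real ^ 'n). \<phi> (norm y) \<partial>lborel) * ennreal (1 / a)"
      using nn_integral_angular_radial[OF g \<phi> False] a b by (simp add: A_def)
    also have "\<dots> = ennreal (b / a) * (\<integral>\<^sup>+(y::real ^ 'n). \<phi> (norm y) \<partial>lborel)"
      using a b by (simp add: mult_ac ennreal_mult[symmetric] mult.assoc[symmetric])
    also have "\<dots> \<le> ennreal c * (\<integral>\<^sup>+(y::real ^ 'n). \<phi> (norm y) \<partial>lborel)"
      by (intro mult_right_mono ennreal_leI) (auto simp: c_def)
    finally show ?thesis .
  qed
  with c show ?thesis using that by blast
qed

lemma radial_integral_mean_zero:
  fixes \<omega> :: "real ^ 'n \<Rightarrow> complex" and \<phi> :: "real \<Rightarrow> real"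
  assumes [measurable]: "\<omega> \<in> borel_measurable borel" "\<phi> \<in> borel_measurable borel"
    and nonneg: "\<And>r. 0 \<le> \<phi> r"
    and fin: "(\<integral>\<^sup>+(y::real ^ 'n). ennreal (\<phi> (norm y)) \<partial>lborel) \<noteq> top"
    and mean: "(\<integral>x. \<omega> x \<partial>sphere_borel) = 0"
  shows "(\<integral>y. \<phi> (norm y) *\<^sub>R \<omega> (radial_projection y) \<partial>lborel) = 0"
proof -
  obtain c where c: "c \<noteq> top"
    "distr (density lborel (\<lambda>y::real ^ 'n. ennreal (\<phi> (norm y)))) borel radial_projection = scale_measure c sphere_borel"
    by (rule radial_image_eq[of "\<lambda>r. ennreal (\<phi> r)", OF _ fin]) auto
  have "scale_measure c sphere_borel = density (sphere_borel :: (real ^ 'n) measure) (\<lambda>_. ennreal (enn2real c))"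
    using c(1) by (intro measure_eqI) (auto simp: emeasure_density nn_integral_cmult_indicator less_top)
  then have "(\<integral>x. \<omega> x \<partial>distr (density lborel (\<lambda>y::real ^ 'n. ennreal (\<phi> (norm y)))) borel radial_projection) = 0"
    unfolding c(2) using mean by (simp add: integral_density)
  then show ?thesis
    using nonneg by (simp add: integral_distr integral_density)
qed

section \<open>Angular functions that are measurable for the completed surface measure\<close>

lemma sphere_in_sets_hausdorff: "sphere 0 1 \<inter> space (hausdorff_measure d) \<in> sets (hausdorff_measure d :: 'a::euclidean_space measure)"
  by simp

lemma AE_surface_measure_iff:
  "(AE x in surface_measure. P x) \<longleftrightarrow> (AE x in (sphere_borel :: 'a::euclidean_space measure). P x)"
proof -
  have [measurable]: "sphere 0 1 \<in> sets (borel :: 'a measure)" by simp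
  have "(AE x in (surface_measure :: 'a measure). P x)
      \<longleftrightarrow> (AE x in hausdorff_measure (DIM('a) - 1). x \<in> sphere 0 1 \<longrightarrow> P x)"
    unfolding surface_measure_def AE_completion_iff
    by (rule AE_restrict_space_iff[OF sphere_in_sets_hausdorff])
  also have "\<dots> \<longleftrightarrow> (AE x in (sphere_borel :: 'a measure). P x)"
    unfolding sphere_borel_def by (subst AE_density, measurable) (simp add: indicator_def)
  finally show ?thesis .
qed

lemma nn_integral_surface_measure:
  fixes g :: "'a::euclidean_space \<Rightarrow> ennreal"
  assumes [measurable]: "g \<in> borel_measurable borel"
  shows "(\<integral>\<^sup>+x. g x \<partial>surface_measure) = (\<integral>\<^sup>+x. g x \<partial>sphere_borel)"
proof -
  have [measurable]: "sphere 0 1 \<in> sets (borel :: 'a measure)" by simp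
  show ?thesis
    unfolding surface_measure_def nn_integral_completion sphere_borel_def
    by (subst nn_integral_restrict_space[OF sphere_in_sets_hausdorff], subst nn_integral_density)
       (simp_all add: mult.commute)
qed

lemma integral_surface_measure:
  fixes g :: "'a::euclidean_space \<Rightarrow> complex"
  assumes [measurable]: "g \<in> borel_measurable borel"
  shows "(\<integral>x. g x \<partial>surface_measure) = (\<integral>x. g x \<partial>sphere_borel)"
proof -
  have [measurable]: "sphere 0 1 \<in> sets (borel :: 'a measure)" by simp
  have "(\<integral>x. g x \<partial>(surface_measure :: 'a measure)) = (\<integral>x. g x \<partial>restrict_space (hausdorff_measure (DIM('a) - 1)) (sphere 0 1))"
    unfolding surface_measure_def by (rule integral_completion) (intro measurable_restrict_space1, measurable)
  also have "\<dots> = (\<integral>x. indicator (sphere 0 1) x *\<^sub>R g x \<partial>hausdorff_measure (DIM('a) - 1))"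
    by (rule integral_restrict_space[OF sphere_in_sets_hausdorff])
  also have "\<dots> = (\<integral>x. g x \<partial>density (hausdorff_measure (DIM('a) - 1)) (\<lambda>x. ennreal (indicator (sphere 0 1) x)))"
    by (rule integral_density[symmetric]) auto
  also have "(\<lambda>x::'a. ennreal (indicator (sphere 0 1) x)) = indicator (sphere 0 1)"
    by (auto simp: fun_eq_iff indicator_def)
  finally show ?thesis by (simp add: sphere_borel_def)
qed

lemma borel_representative:
  fixes \<Omega> :: "'a::euclidean_space \<Rightarrow> complex"
  assumes "\<Omega> \<in> borel_measurable surface_measure"
  obtains \<omega> where "\<omega> \<in> borel_measurable borel" "AE x in sphere_borel. \<Omega> x = \<omega> x"
proof -
  let ?R = "restrict_space (hausdorff_measure (DIM('a) - 1)) (sphere (0::'a) 1)"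
  have *: "(\<lambda>x. Re (\<Omega> x)) \<in> borel_measurable (completion ?R)" "(\<lambda>x. Im (\<Omega> x)) \<in> borel_measurable (completion ?R)"
    using assms unfolding surface_measure_def by measurable
  obtain u where u: "u \<in> borel_measurable ?R" "AE x in ?R. Re (\<Omega> x) = u x"
    using completion_ex_borel_measurable_real[OF *(1)] by blast
  obtain v where v: "v \<in> borel_measurable ?R" "AE x in ?R. Im (\<Omega> x) = v x"
    using completion_ex_borel_measurable_real[OF *(2)] by blast
  define \<omega> where "\<omega> x = Complex (indicator (sphere 0 1) x *\<^sub>R u x) (indicator (sphere 0 1) x *\<^sub>R v x)" for x
  have [measurable]: "(\<lambda>x. indicator (sphere 0 1) x *\<^sub>R u x) \<in> borel_measurable borel"
    "(\<lambda>x. indicator (sphere 0 1) x *\<^sub>R v x) \<in> borel_measurable borel"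
    using u(1) v(1) by (simp_all add: borel_measurable_restrict_space_iff)
  have "\<omega> \<in> borel_measurable borel"
    unfolding \<omega>_def Complex_eq by measurable
  moreover have "AE x in (surface_measure :: 'a measure). \<Omega> x = \<omega> x"
    unfolding surface_measure_def AE_completion_iff
    using u(2) v(2) AE_space[of ?R]
  proof eventually_elim
    case (elim x)
    then show ?case by (simp add: \<omega>_def space_restrict_space complex_eq_iff)
  qed
  ultimately show ?thesis using that unfolding AE_surface_measure_iff by blast
qed

text \<open>
  By \<open>nn_integral_angular_radial\<close>, the part in each ball of the cone over a null set of the sphere is a null set.
\<close>

lemma AE_radial_projection:
  assumes "AE x in (sphere_borel :: (real ^ 'n) measure). P x"
  shows "AE y in lborel. P (radial_projection y)"
proof -
  obtain N where N: "N \<in> null_sets (sphere_borel :: (real ^ 'n) measure)" "{x. \<not> P x} \<subseteq> N"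
    using assms by (auto simp: eventually_ae_filter)
  then have [measurable]: "N \<in> sets borel" and N0: "emeasure (sphere_borel :: (real ^ 'n) measure) N = 0"
    by auto
  have "AE y in lborel. norm y \<le> real k \<longrightarrow> radial_projection y \<notin> N" for k :: nat
  proof -
    have [measurable]: "cball 0 (real k) \<in> sets (borel :: (real ^ 'n) measure)" by simp
    have "(\<integral>\<^sup>+(y::real ^ 'n). indicator {..real k} (norm y) \<partial>lborel) = (\<integral>\<^sup>+(y::real ^ 'n). indicator (cball 0 (real k)) y \<partial>lborel)"
      by (intro nn_integral_cong) (auto simp: indicator_def)
    also have "\<dots> = emeasure lborel (cball (0::real ^ 'n) (real k))" by simp
    also have "\<dots> \<noteq> top" by (simp add: emeasure_cball)
    finally have fin: "(\<integral>\<^sup>+(y::real ^ 'n). indicator {..real k} (norm y) \<partial>lborel) \<noteq> top" .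
    have "(\<integral>\<^sup>+y. indicator N (radial_projection y) * indicator {..real k} (norm y) \<partial>lborel) * emeasure (sphere_borel :: (real ^ 'n) measure) UNIV
      = (\<integral>\<^sup>+x. indicator N x \<partial>sphere_borel) * (\<integral>\<^sup>+(y::real ^ 'n). indicator {..real k} (norm y) \<partial>lborel)"
      using fin by (intro nn_integral_angular_radial) measurable
    then have "(\<integral>\<^sup>+y. indicator N (radial_projection y) * indicator {..real k} (norm y) \<partial>lborel) = (0::ennreal)"
      using emeasure_sphere_borel_UNIV(1)[where 'n = 'n] N0 by (simp add: nn_integral_indicator)
    then have "AE y in lborel. indicator N (radial_projection y) * indicator {..real k} (norm y) = (0::ennreal)"
      by (subst (asm) nn_integral_0_iff_AE) measurable
    then show ?thesis by eventually_elim (auto simp: indicator_def split: if_splits)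
  qed
  then have "AE y in lborel. \<forall>k::nat. norm y \<le> real k \<longrightarrow> radial_projection y \<notin> N"
    by (subst AE_all_countable) auto
  then show ?thesis
  proof eventually_elim
    case (elim y)
    obtain k :: nat where "norm y \<le> real k" using real_arch_simple by blast
    then show ?case using elim N(2) by blast
  qed
qed

text \<open>
  This lemma and \<open>integral_angular_radial_zero\<close> below turn the integrability and the mean value of \<open>\<Omega>\<close> into
  statements about integrals over the whole space.
\<close>

lemma angular_radial_le:
  fixes \<Omega> :: "real ^ 'n \<Rightarrow> complex"
  assumes \<Omega>: "\<Omega> \<in> borel_measurable surface_measure"
    and fin: "(\<integral>\<^sup>+x. ennreal (cmod (\<Omega> x)) \<partial>surface_measure) \<noteq> top"
  obtains c :: real where "0 < c"
    "\<And>\<phi>. \<phi> \<in> borel_measurable borel \<Longrightarrow>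
      (\<integral>\<^sup>+y. ennreal (cmod (\<Omega> (radial_projection y))) * \<phi> (norm y) \<partial>lborel)
      \<le> ennreal c * (\<integral>\<^sup>+(y::real ^ 'n). \<phi> (norm y) \<partial>lborel)"
proof -
  obtain \<omega> where \<omega>[measurable]: "\<omega> \<in> borel_measurable borel" and eq: "AE x in sphere_borel. \<Omega> x = \<omega> x"
    by (rule borel_representative[OF \<Omega>])
  have "(\<integral>\<^sup>+x. ennreal (cmod (\<omega> x)) \<partial>sphere_borel) = (\<integral>\<^sup>+x. ennreal (cmod (\<Omega> x)) \<partial>surface_measure)"
    unfolding nn_integral_surface_measure[symmetric, of "\<lambda>x. ennreal (cmod (\<omega> x))", simplified]
    using eq[folded AE_surface_measure_iff] by (intro nn_integral_cong_AE) (auto elim!: eventually_mono)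
  then have "(\<integral>\<^sup>+x. ennreal (cmod (\<omega> x)) \<partial>sphere_borel) \<noteq> top" using fin by simp
  then obtain c :: real where c: "0 < c" "\<And>\<phi>. \<phi> \<in> borel_measurable borel \<Longrightarrow>
      (\<integral>\<^sup>+y. ennreal (cmod (\<omega> (radial_projection y))) * \<phi> (norm y) \<partial>lborel)
      \<le> ennreal c * (\<integral>\<^sup>+(y::real ^ 'n). \<phi> (norm y) \<partial>lborel)"
    by (rule nn_integral_angular_radial_le[of "\<lambda>x. ennreal (cmod (\<omega> x))", rotated]) auto
  have "(\<integral>\<^sup>+y. ennreal (cmod (\<Omega> (radial_projection y))) * \<phi> (norm y) \<partial>lborel)
      = (\<integral>\<^sup>+y. ennreal (cmod (\<omega> (radial_projection y))) * \<phi> (norm y) \<partial>lborel)" for \<phi>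
    using AE_radial_projection[OF eq] by (intro nn_integral_cong_AE) (auto elim!: eventually_mono)
  then show ?thesis using that c by metis
qed

lemma measurable_angular:
  fixes \<Omega> :: "real ^ 'n \<Rightarrow> complex"
  assumes \<Omega>: "\<Omega> \<in> borel_measurable surface_measure"
  shows "(\<lambda>y. \<Omega> (radial_projection y)) \<in> borel_measurable lebesgue"
proof -
  obtain \<omega> where \<omega>[measurable]: "\<omega> \<in> borel_measurable borel" and eq: "AE x in sphere_borel. \<Omega> x = \<omega> x"
    by (rule borel_representative[OF \<Omega>])
  have "(\<lambda>y. \<omega> (radial_projection y)) \<in> borel_measurable lebesgue"
    by (intro measurable_completion) measurable
  moreover have "AE y in lebesgue. \<omega> (radial_projection y) = \<Omega> (radial_projection y)"
    using AE_completion[OF AE_radial_projection[OF eq]] by eventually_elim simp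
  ultimately show ?thesis by (rule borel_measurable_AE)
qed

lemma integral_angular_radial_zero:
  fixes \<Omega> :: "real ^ 'n \<Rightarrow> complex" and \<phi> :: "real \<Rightarrow> real"
  assumes \<Omega>: "\<Omega> \<in> borel_measurable surface_measure" and mean: "(\<integral>x. \<Omega> x \<partial>surface_measure) = 0"
    and [measurable]: "\<phi> \<in> borel_measurable borel" and nonneg: "\<And>r. 0 \<le> \<phi> r"
    and fin: "(\<integral>\<^sup>+(y::real ^ 'n). ennreal (\<phi> (norm y)) \<partial>lborel) \<noteq> top"
  shows "(\<integral>y. \<phi> (norm y) *\<^sub>R \<Omega> (radial_projection y) \<partial>lebesgue) = 0"
proof -
  obtain \<omega> where \<omega>[measurable]: "\<omega> \<in> borel_measurable borel" and eq: "AE x in sphere_borel. \<Omega> x = \<omega> x"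
    by (rule borel_representative[OF \<Omega>])
  have "(\<integral>x. \<omega> x \<partial>sphere_borel) = (\<integral>x. \<omega> x \<partial>surface_measure)"
    by (simp add: integral_surface_measure)
  also have "\<dots> = (\<integral>x. \<Omega> x \<partial>surface_measure)"
  proof (rule integral_cong_AE)
    have "(\<lambda>x. \<omega> x) \<in> borel_measurable (surface_measure :: (real ^ 'n) measure)"
      unfolding surface_measure_def by (intro measurable_completion measurable_restrict_space1) measurable
    then show "\<omega> \<in> borel_measurable surface_measure" .
  qed (use \<Omega> eq[folded AE_surface_measure_iff] in \<open>auto elim!: eventually_mono\<close>)
  finally have "(\<integral>x. \<omega> x \<partial>sphere_borel) = 0" using mean by simp
  then have 0: "(\<integral>y. \<phi> (norm y) *\<^sub>R \<omega> (radial_projection y) \<partial>lborel) = 0"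
    using fin nonneg by (intro radial_integral_mean_zero) auto
  have "(\<integral>y. \<phi> (norm y) *\<^sub>R \<Omega> (radial_projection y) \<partial>lebesgue) = (\<integral>y. \<phi> (norm y) *\<^sub>R \<omega> (radial_projection y) \<partial>lebesgue)"
  proof (rule integral_cong_AE)
    have [measurable]: "(\<lambda>y::real ^ 'n. \<phi> (norm y)) \<in> borel_measurable lebesgue"
      by (intro measurable_completion) measurable
    note [measurable] = measurable_angular[OF \<Omega>]
    show "(\<lambda>y. \<phi> (norm y) *\<^sub>R \<Omega> (radial_projection y)) \<in> borel_measurable lebesgue" by measurable
    show "(\<lambda>y. \<phi> (norm y) *\<^sub>R \<omega> (radial_projection y)) \<in> borel_measurable lebesgue"
      by (intro measurable_completion) measurable
    show "AE y in lebesgue. \<phi> (norm y) *\<^sub>R \<Omega> (radial_projection y) = \<phi> (norm y) *\<^sub>R \<omega> (radial_projection y)"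
      using AE_completion[OF AE_radial_projection[OF eq]] by eventually_elim simp
  qed
  also have "\<dots> = (\<integral>y. \<phi> (norm y) *\<^sub>R \<omega> (radial_projection y) \<partial>lborel)"
    by (rule integral_completion) measurable
  finally show ?thesis using 0 by simp
qed

text \<open>
  The Young function dominates the identity for large arguments, and surface measure is finite.
\<close>

lemma L_log_L_sphere_integrable:
  fixes \<Omega> :: "real ^ 'n \<Rightarrow> complex"
  assumes \<Omega>: "\<Omega> \<in> L_log_L_sphere a" and a: "0 \<le> a"
  shows "\<Omega> \<in> borel_measurable surface_measure" "(\<integral>\<^sup>+x. ennreal (cmod (\<Omega> x)) \<partial>surface_measure) \<noteq> top"
proof -
  show meas: "\<Omega> \<in> borel_measurable surface_measure"
    using \<Omega> by (simp add: L_log_L_sphere_def orlicz_space_def)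
  define \<Psi> where "\<Psi> t = t * ln (1 + t) powr a" for t :: real
  obtain k where k: "0 < k" "(\<integral>\<^sup>+x. ennreal (\<Psi> (cmod (\<Omega> x) / k)) \<partial>surface_measure) < \<infinity>"
    using \<Omega> by (auto simp: L_log_L_sphere_def orlicz_space_def \<Psi>_def)
  have \<Psi>0: "0 \<le> \<Psi> t" if "0 \<le> t" for t using that by (simp add: \<Psi>_def)
  have le: "t \<le> exp 1 + \<Psi> t" if "0 \<le> t" for t
  proof (cases "t \<le> exp 1")
    case True
    with \<Psi>0[OF that] show ?thesis by simp
  next
    case False
    then have "ln (exp 1) \<le> ln (1 + t)" using that by (subst ln_le_cancel_iff) auto
    then have "1 \<le> ln (1 + t) powr a" using a by (intro ge_one_powr_ge_zero) auto
    then have "t \<le> \<Psi> t" using that by (simp add: \<Psi>_def mult_le_cancel_left1)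
    then show ?thesis using exp_gt_zero[of "1::real"] by linarith
  qed
  have [measurable]: "(\<lambda>x. \<Psi> (cmod (\<Omega> x) / k)) \<in> borel_measurable surface_measure"
    using meas unfolding \<Psi>_def by measurable
  have "(\<integral>\<^sup>+x. ennreal (cmod (\<Omega> x)) \<partial>surface_measure)
      \<le> (\<integral>\<^sup>+x. ennreal k * (ennreal (exp 1) + ennreal (\<Psi> (cmod (\<Omega> x) / k))) \<partial>surface_measure)"
  proof (intro nn_integral_mono)
    fix x
    have n: "0 \<le> cmod (\<Omega> x) / k" using k by simp
    then have P: "0 \<le> \<Psi> (cmod (\<Omega> x) / k)" by (rule \<Psi>0)
    have "cmod (\<Omega> x) = k * (cmod (\<Omega> x) / k)" using k by simp
    also have "\<dots> \<le> k * (exp 1 + \<Psi> (cmod (\<Omega> x) / k))" using k le[OF n] by (intro mult_left_mono) auto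
    finally have "ennreal (cmod (\<Omega> x)) \<le> ennreal (k * (exp 1 + \<Psi> (cmod (\<Omega> x) / k)))" by (rule ennreal_leI)
    then show "ennreal (cmod (\<Omega> x)) \<le> ennreal k * (ennreal (exp 1) + ennreal (\<Psi> (cmod (\<Omega> x) / k)))"
      using k P by (simp add: ennreal_mult ennreal_plus)
  qed
  also have "\<dots> = ennreal k * (ennreal (exp 1) * emeasure (surface_measure :: (real ^ 'n) measure) (space surface_measure)
      + (\<integral>\<^sup>+x. ennreal (\<Psi> (cmod (\<Omega> x) / k)) \<partial>surface_measure))"
    by (subst nn_integral_cmult, measurable, subst nn_integral_add, measurable)
  also have "emeasure (surface_measure :: (real ^ 'n) measure) (space surface_measure) = emeasure (sphere_borel :: (real ^ 'n) measure) UNIV"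
    using nn_integral_surface_measure[of "\<lambda>_::real ^ 'n. 1"] by simp
  finally show "(\<integral>\<^sup>+x. ennreal (cmod (\<Omega> x)) \<partial>surface_measure) \<noteq> top"
    using k(2) emeasure_sphere_borel_UNIV(2)[where 'n = 'n]
    by (auto simp: top_unique ennreal_mult_eq_top_iff)
qed

section \<open>The operator on test functions\<close>

lemma Cc_infinityD:
  fixes f :: "'a::euclidean_space \<Rightarrow> complex"
  assumes "f \<in> Cc_infinity"
  shows "f differentiable (at x)" "continuous_on UNIV f"
    "b \<in> Basis \<Longrightarrow> continuous_on UNIV (\<lambda>x. frechet_derivative f (at x) b)"
    "compact (closure {x. f x \<noteq> 0})"
proof -
  have f: "C_k k f" for k using assms by (auto simp: Cc_infinity_def)
  have c: "compact (closure {x. f x \<noteq> 0})" using assms by (auto simp: Cc_infinity_def)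
  show "f differentiable (at x)" using f[of "Suc 0"] by simp
  show "continuous_on UNIV f" using f[of 0] by simp
  show "b \<in> Basis \<Longrightarrow> continuous_on UNIV (\<lambda>x. frechet_derivative f (at x) b)" using f[of "Suc 0"] by simp
  show "compact (closure {x. f x \<noteq> 0})" by (rule c)
qed

lemma derivative_dominated_gradient:
  fixes f :: "real ^ 'n \<Rightarrow> complex"
  assumes f: "f \<in> Cc_infinity"
  shows "derivative_dominated f (\<lambda>x. frechet_derivative f (at x)) (\<lambda>x. norm (gradient f x))"
  unfolding derivative_dominated_def
proof (intro conjI allI)
  fix x show D: "(f has_derivative frechet_derivative f (at x)) (at x)"
    using Cc_infinityD(1)[OF f] frechet_derivative_works by blast
  fix v :: "real ^ 'n"
  have lin: "linear (frechet_derivative f (at x))" using D by (rule has_derivative_linear)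
  have "v = (\<Sum>i\<in>UNIV. v $ i *\<^sub>R axis i 1)"
    using basis_expansion[of v] by (simp add: scalar_mult_eq_scaleR)
  then have "frechet_derivative f (at x) v = frechet_derivative f (at x) (\<Sum>i\<in>UNIV. v $ i *\<^sub>R axis i 1)"
    by (rule arg_cong)
  also have "\<dots> = (\<Sum>i\<in>UNIV. v $ i *\<^sub>R gradient f x $ i)"
    using lin by (simp add: linear_sum linear_cmul gradient_def)
  finally have "norm (frechet_derivative f (at x) v) \<le> (\<Sum>i\<in>UNIV. norm (v $ i *\<^sub>R gradient f x $ i))"
    by (simp only: norm_sum)
  also have "\<dots> = (\<Sum>i\<in>UNIV. \<bar>norm (gradient f x $ i)\<bar> * \<bar>norm (v $ i)\<bar>)"
    by (simp add: mult.commute)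
  also have "\<dots> \<le> L2_set (\<lambda>i. norm (gradient f x $ i)) UNIV * L2_set (\<lambda>i. norm (v $ i)) UNIV"
    by (rule L2_set_mult_ineq)
  finally show "norm (frechet_derivative f (at x) v) \<le> norm (gradient f x) * norm v"
    by (simp add: norm_vec_def)
next
  show "continuous_on UNIV (\<lambda>x. norm (gradient f x))"
    unfolding gradient_def
    by (intro continuous_intros Cc_infinityD(3)[OF f]) (simp add: axis_in_Basis_iff)
qed

lemma compact_support_bounded:
  fixes g :: "'a::euclidean_space \<Rightarrow> 'b::euclidean_space"
  assumes "continuous_on UNIV g" "compact K" "\<And>x. x \<notin> K \<Longrightarrow> g x = 0"
  obtains B where "0 < B" "\<And>x. norm (g x) \<le> B"
proof -
  have "compact (g ` K)" using assms(1,2) by (intro compact_continuous_image) (auto intro: continuous_on_subset)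
  then obtain B where "0 < B" "\<And>x. x \<in> K \<Longrightarrow> norm (g x) \<le> B"
    using compact_imp_bounded bounded_pos by (metis imageI)
  with assms(3) have "norm (g x) \<le> B" for x by (cases "x \<in> K") auto
  with \<open>0 < B\<close> show ?thesis using that by blast
qed

lemma Cc_infinity_bounds:
  fixes f :: "real ^ 'n \<Rightarrow> complex"
  assumes f: "f \<in> Cc_infinity"
  obtains B L where "0 < B" "0 < L" "\<And>x. cmod (f x) \<le> B" "\<And>x y. cmod (f (x - y) - f x) \<le> L * norm y"
proof -
  let ?K = "closure {x. f x \<noteq> 0}"
  have out: "f x = 0" if "x \<notin> ?K" for x using that subsetD[OF closure_subset, of x "{x. f x \<noteq> 0}"] by auto
  obtain B where B: "0 < B" "\<And>x. norm (f x) \<le> B"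
    by (rule compact_support_bounded[OF Cc_infinityD(2,4)[OF f]], rule out, assumption, rule that)
  have dom: "derivative_dominated f (\<lambda>x. frechet_derivative f (at x)) (\<lambda>x. norm (gradient f x))"
    by (rule derivative_dominated_gradient[OF f])
  have grad0: "norm (gradient f x) = 0" if x: "x \<notin> ?K" for x
  proof -
    have "open (- ?K)" by (rule open_Compl[OF closed_closure])
    moreover have "x \<in> - ?K" by (rule iffD2[OF Compl_iff x])
    moreover have "0 = f y" if "y \<in> - ?K" for y by (rule out[symmetric]) (rule ComplD[OF that])
    ultimately have "(f has_derivative (\<lambda>_. 0)) (at x)"
      by (intro has_derivative_transform_within_open[OF has_derivative_const[of 0]])
    then have "frechet_derivative f (at x) = (\<lambda>_. 0)" by (rule frechet_derivative_at[symmetric])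
    then show ?thesis by (simp add: gradient_def norm_vec_def L2_set_def)
  qed
  have cont: "continuous_on UNIV (\<lambda>x. norm (gradient f x))" using dom by (simp add: derivative_dominated_def)
  obtain L where L: "0 < L" "\<And>x. norm (norm (gradient f x)) \<le> L"
    by (rule compact_support_bounded[OF cont Cc_infinityD(4)[OF f]], rule grad0, assumption, rule that)
  have "cmod (f (x - y) - f x) \<le> L * norm (x - y - x)" for x y
  proof (rule differentiable_bound[of UNIV])
    fix z
    show "(f has_derivative frechet_derivative f (at z)) (at z within UNIV)"
      using dom by (simp add: derivative_dominated_def)
    show "onorm (frechet_derivative f (at z)) \<le> L"
    proof (rule onorm_le)
      fix v
      have "norm (frechet_derivative f (at z) v) \<le> norm (gradient f z) * norm v"
        using dom by (simp add: derivative_dominated_def)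
      also have "\<dots> \<le> L * norm v" using L(2)[of z] by (intro mult_right_mono) auto
      finally show "norm (frechet_derivative f (at z) v) \<le> L * norm v" .
    qed
  qed auto
  then show ?thesis using that[OF B(1) L(1)] B(2) by simp
qed

text \<open>
  As \<open>\<Omega>\<close> has mean zero, \<open>f x\<close> may be subtracted inside the truncated integrals, after which the integrand is
  dominated uniformly in \<open>\<epsilon>\<close>: by a multiple of \<open>\<bar>\<Omega>\<bar>\<close> times \<open>norm y powr (\<alpha> - n)\<close> near the origin and
  times \<open>norm y powr (\<alpha> - 1 - n)\<close> near infinity.
\<close>

lemma T_op_le_difference_integral:
  fixes \<Omega> :: "real ^ 'n \<Rightarrow> complex" and \<alpha> :: real
  assumes \<alpha>: "0 < \<alpha>" "\<alpha> < 1"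
    and \<Omega>: "\<Omega> \<in> borel_measurable surface_measure" "(\<integral>\<^sup>+x. ennreal (cmod (\<Omega> x)) \<partial>surface_measure) \<noteq> top"
      "(\<integral>x. \<Omega> x \<partial>surface_measure) = 0"
    and f: "f \<in> Cc_infinity"
  shows "ennreal (cmod (T_op \<Omega> \<alpha> f x)) \<le> (\<integral>\<^sup>+y. ennreal (cmod (\<Omega> (radial_projection y))) *
    ennreal (norm y powr (\<alpha> - 1 - real DIM(real ^ 'n)) * cmod (f (x - y) - f x)) \<partial>lborel)"
proof -
  define n where "n = real DIM(real ^ 'n)"
  obtain B L where BL: "0 < B" "0 < L" "\<And>x. cmod (f x) \<le> B" "\<And>x y. cmod (f (x - y) - f x) \<le> L * norm y"
    by (rule Cc_infinity_bounds[OF f]) (rule that)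
  define k where "k r = r powr (\<alpha> - 1 - n)" for r :: real
  define W where "W y = \<Omega> (radial_projection y)" for y
  define K where "K y = k (norm y) *\<^sub>R W y" for y
  define d where "d y = f (x - y) - f x" for y
  define F where "F y = K y * d y" for y
  have k0: "0 \<le> k r" for r by (simp add: k_def)
  have [measurable]: "k \<in> borel_measurable borel" unfolding k_def[abs_def] by measurable
  have [measurable]: "W \<in> borel_measurable lebesgue"
    unfolding W_def[abs_def] by (rule measurable_angular[OF \<Omega>(1)])
  have [measurable]: "(\<lambda>y::real ^ 'n. norm y) \<in> borel_measurable lebesgue"
    by (intro measurable_completion) measurable
  have outside: "{y::real ^ 'n. t < norm y} \<in> sets lebesgue" for t :: real
  proof -
    have "{y::real ^ 'n. t < norm y} \<in> sets lborel" by measurable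
    then show ?thesis by (rule sets_completionI_sets)
  qed
  have [measurable]: "K \<in> borel_measurable lebesgue" unfolding K_def[abs_def] by measurable
  have [measurable]: "f \<in> borel_measurable borel" using Cc_infinityD(2)[OF f] by (rule borel_measurable_continuous_onI)
  have fx[measurable]: "(\<lambda>y. f (x - y)) \<in> borel_measurable lebesgue"
    by (intro measurable_completion) measurable
  have [measurable]: "d \<in> borel_measurable lebesgue" unfolding d_def[abs_def] by measurable
  have [measurable]: "F \<in> borel_measurable lebesgue" unfolding F_def[abs_def] by measurable
  obtain c where c: "0 < c" "\<And>\<phi>. \<phi> \<in> borel_measurable borel \<Longrightarrow>
      (\<integral>\<^sup>+y. ennreal (cmod (\<Omega> (radial_projection y))) * \<phi> (norm y) \<partial>lborel)
      \<le> ennreal c * (\<integral>\<^sup>+(y::real ^ 'n). \<phi> (norm y) \<partial>lborel)"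
    by (rule angular_radial_le[OF \<Omega>(1,2)]) (rule that)
  obtain j1 where j1: "0 < j1" "\<And>R. 0 < R \<Longrightarrow> (\<integral>\<^sup>+(y::real ^ 'n). ennreal (norm y powr (\<alpha> - DIM(real ^ 'n))) * indicator (cball 0 R) y \<partial>lborel)
       \<le> ennreal (j1 * R powr \<alpha>)"
    by (rule nn_integral_norm_powr_cball[OF \<alpha>(1)]) (rule that)
  have "0 < 1 - \<alpha>" using \<alpha> by simp
  then obtain j2 where j2: "0 < j2" "\<And>R. 0 < R \<Longrightarrow> (\<integral>\<^sup>+(y::real ^ 'n). ennreal (norm y powr (- (1 - \<alpha>) - DIM(real ^ 'n))) * indicator {y. R \<le> norm y} y \<partial>lborel)
       \<le> ennreal (j2 * R powr - (1 - \<alpha>))"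
    by (rule nn_integral_norm_powr_outside) (rule that)
  have tail: "(\<integral>\<^sup>+(y::real ^ 'n). ennreal (k (norm y)) * indicator {R..} (norm y) \<partial>lborel) < top" if "0 < R" for R
  proof -
    have "(\<integral>\<^sup>+(y::real ^ 'n). ennreal (k (norm y)) * indicator {R..} (norm y) \<partial>lborel)
      = (\<integral>\<^sup>+(y::real ^ 'n). ennreal (norm y powr (- (1 - \<alpha>) - DIM(real ^ 'n))) * indicator {y. R \<le> norm y} y \<partial>lborel)"
      by (intro nn_integral_cong) (auto simp: k_def n_def indicator_def)
    also have "\<dots> \<le> ennreal (j2 * R powr - (1 - \<alpha>))" by (rule j2(2)[OF that])
    finally show ?thesis by (rule le_less_trans) simp
  qed
  have normK: "norm (K y) = cmod (W y) * k (norm y)" for y by (simp add: K_def k0)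
  have K_tail: "integrable lebesgue (\<lambda>y. indicator {y. \<epsilon> < norm y} y *\<^sub>R K y)" if \<epsilon>: "0 < \<epsilon>" for \<epsilon>
  proof (rule integrableI_bounded)
    have "(\<integral>\<^sup>+y. ennreal (norm (indicator {y. \<epsilon> < norm y} y *\<^sub>R K y)) \<partial>lebesgue)
      \<le> (\<integral>\<^sup>+y. ennreal (cmod (W y)) * (ennreal (k (norm y)) * indicator {\<epsilon>..} (norm y)) \<partial>lebesgue)"
      by (intro nn_integral_mono) (auto simp: normK indicator_def ennreal_mult k0)
    also have "\<dots> \<le> ennreal c * (\<integral>\<^sup>+(y::real ^ 'n). ennreal (k (norm y)) * indicator {\<epsilon>..} (norm y) \<partial>lborel)"
      unfolding nn_integral_completion W_def by (rule c(2)) measurable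
    also have "\<dots> < \<infinity>" using tail[OF \<epsilon>] by (simp add: ennreal_mult_less_top)
    finally show "(\<integral>\<^sup>+y. ennreal (norm (indicator {y. \<epsilon> < norm y} y *\<^sub>R K y)) \<partial>lebesgue) < \<infinity>" .
  qed measurable
  have F_int: "integrable lebesgue F"
  proof (rule integrableI_bounded)
    define \<phi> where "\<phi> r = ennreal L * (ennreal (r powr (\<alpha> - n)) * indicator {..1} r) + ennreal (2 * B) * (ennreal (k r) * indicator {1..} r)" for r :: real
    have [measurable]: "\<phi> \<in> borel_measurable borel" unfolding \<phi>_def[abs_def] by measurable
    have "ennreal (norm (F y)) \<le> ennreal (cmod (W y)) * \<phi> (norm y)" for y
    proof -
      have "ennreal (k (norm y) * cmod (d y)) \<le> \<phi> (norm y)"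
      proof (cases "norm y \<le> 1")
        case True
        show ?thesis
        proof (cases "y = 0")
          case False
          have "k (norm y) * cmod (d y) \<le> k (norm y) * (L * norm y)"
            using BL(4)[of x y] k0 by (intro mult_left_mono) (auto simp: d_def)
          also have "\<dots> = L * (norm y powr (\<alpha> - 1 - n) * norm y powr 1)" using False by (simp add: k_def)
          also have "\<dots> = L * norm y powr (\<alpha> - n)" unfolding powr_add[symmetric] by (simp add: algebra_simps)
          finally have "ennreal (k (norm y) * cmod (d y)) \<le> ennreal L * (ennreal (norm y powr (\<alpha> - n)) * indicator {..1} (norm y))"
            using True BL by (simp add: ennreal_mult[symmetric] ennreal_leI)
          then show ?thesis unfolding \<phi>_def by (rule add_increasing2[rotated]) simp
        qed (simp add: k_def)
      next
        case False
        have "cmod (d y) \<le> 2 * B"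
          using norm_triangle_ineq4[of "f (x - y)" "f x"] BL(3)[of x] BL(3)[of "x - y"] by (simp add: d_def)
        from mult_left_mono[OF this k0[of "norm y"]]
        have "k (norm y) * cmod (d y) \<le> 2 * B * k (norm y)" by (simp add: mult_ac)
        then have "ennreal (k (norm y) * cmod (d y)) \<le> ennreal (2 * B) * (ennreal (k (norm y)) * indicator {1..} (norm y))"
          using False BL k0 by (simp add: ennreal_mult[symmetric] ennreal_leI)
        then show ?thesis unfolding \<phi>_def by (rule add_increasing[rotated]) simp
      qed
      then have "ennreal (cmod (W y)) * ennreal (k (norm y) * cmod (d y)) \<le> ennreal (cmod (W y)) * \<phi> (norm y)"
        by (rule mult_left_mono) simp
      then show ?thesis using k0 by (simp add: F_def norm_mult normK ennreal_mult mult_ac)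
    qed
    then have "(\<integral>\<^sup>+y. ennreal (norm (F y)) \<partial>lebesgue) \<le> (\<integral>\<^sup>+y. ennreal (cmod (W y)) * \<phi> (norm y) \<partial>lebesgue)"
      by (intro nn_integral_mono)
    also have "\<dots> \<le> ennreal c * (\<integral>\<^sup>+(y::real ^ 'n). \<phi> (norm y) \<partial>lborel)"
      unfolding nn_integral_completion W_def by (rule c(2)) measurable
    also have "(\<integral>\<^sup>+(y::real ^ 'n). \<phi> (norm y) \<partial>lborel) = ennreal L * (\<integral>\<^sup>+(y::real ^ 'n). ennreal (norm y powr (\<alpha> - n)) * indicator {..1} (norm y) \<partial>lborel)
        + ennreal (2 * B) * (\<integral>\<^sup>+(y::real ^ 'n). ennreal (k (norm y)) * indicator {1..} (norm y) \<partial>lborel)"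
      unfolding \<phi>_def by (subst nn_integral_add, measurable, subst nn_integral_cmult, measurable, subst nn_integral_cmult, measurable)
    also have "(\<integral>\<^sup>+(y::real ^ 'n). ennreal (norm y powr (\<alpha> - n)) * indicator {..1} (norm y) \<partial>lborel)
        = (\<integral>\<^sup>+(y::real ^ 'n). ennreal (norm y powr (\<alpha> - DIM(real ^ 'n))) * indicator (cball 0 1) y \<partial>lborel)"
      by (intro nn_integral_cong) (auto simp: n_def indicator_def)
    also have "ennreal c * (ennreal L * \<dots> + ennreal (2 * B) * (\<integral>\<^sup>+(y::real ^ 'n). ennreal (k (norm y)) * indicator {1..} (norm y) \<partial>lborel)) < \<infinity>"
      using tail[of 1] le_less_trans[OF j1(2)[of 1]] by (simp add: ennreal_mult_less_top ennreal_add_less_top)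
    finally show "(\<integral>\<^sup>+y. ennreal (norm (F y)) \<partial>lebesgue) < \<infinity>" .
  qed measurable
  have trunc: "T_truncated \<Omega> \<alpha> \<epsilon> f x = (\<integral>y. indicator {y. \<epsilon> < norm y} y *\<^sub>R F y \<partial>lebesgue)" if \<epsilon>: "0 < \<epsilon>" for \<epsilon>
  proof -
    have [measurable]: "{y::real ^ 'n. \<epsilon> < norm y} \<in> sets lebesgue"
      by (rule outside)
    define \<psi> where "\<psi> r = k r * indicator {\<epsilon><..} r" for r
    have "(\<integral>\<^sup>+(y::real ^ 'n). ennreal (\<psi> (norm y)) \<partial>lborel) \<le> (\<integral>\<^sup>+(y::real ^ 'n). ennreal (k (norm y)) * indicator {\<epsilon>..} (norm y) \<partial>lborel)"
      by (intro nn_integral_mono) (auto simp: \<psi>_def indicator_def)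
    then have "(\<integral>\<^sup>+(y::real ^ 'n). ennreal (\<psi> (norm y)) \<partial>lborel) \<noteq> top" using tail[OF \<epsilon>] by auto
    then have "(\<integral>y. \<psi> (norm y) *\<^sub>R \<Omega> (radial_projection y) \<partial>lebesgue) = 0"
      using k0 by (intro integral_angular_radial_zero \<Omega>) (auto simp: \<psi>_def)
    moreover have "\<psi> (norm y) *\<^sub>R \<Omega> (radial_projection y) = indicator {y. \<epsilon> < norm y} y *\<^sub>R K y" for y
      by (simp add: \<psi>_def K_def W_def indicator_def)
    ultimately have K0: "(\<integral>y. indicator {y. \<epsilon> < norm y} y *\<^sub>R K y \<partial>lebesgue) = 0" by simp
    have pt: "indicator {y. norm y > \<epsilon>} y *\<^sub>R (\<Omega> (y /\<^sub>R norm y) / of_real (norm y powr (real DIM(real ^ 'n) + 1 - \<alpha>)) * f (x - y))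
      = indicator {y. \<epsilon> < norm y} y *\<^sub>R F y + (indicator {y. \<epsilon> < norm y} y *\<^sub>R K y) * f x" for y
    proof -
      have "\<Omega> (y /\<^sub>R norm y) / of_real (norm y powr (real DIM(real ^ 'n) + 1 - \<alpha>)) = K y"
      proof -
        have "k (norm y) = inverse (norm y powr (real DIM(real ^ 'n) + 1 - \<alpha>))"
          unfolding k_def n_def powr_minus[symmetric] by (rule arg_cong) simp
        then show ?thesis
          by (simp add: K_def W_def radial_projection_def scaleR_conv_of_real divide_inverse mult.commute)
      qed
      then show ?thesis by (simp add: F_def d_def indicator_def algebra_simps)
    qed
    have "T_truncated \<Omega> \<alpha> \<epsilon> f x = (\<integral>y. indicator {y. \<epsilon> < norm y} y *\<^sub>R F y + (indicator {y. \<epsilon> < norm y} y *\<^sub>R K y) * f x \<partial>lebesgue)"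
      unfolding T_truncated_def set_lebesgue_integral_def pt ..
    also have "\<dots> = (\<integral>y. indicator {y. \<epsilon> < norm y} y *\<^sub>R F y \<partial>lebesgue) + (\<integral>y. (indicator {y. \<epsilon> < norm y} y *\<^sub>R K y) * f x \<partial>lebesgue)"
      by (intro Bochner_Integration.integral_add integrable_mult_indicator F_int integrable_mult_left K_tail \<epsilon>) measurable
    also have "(\<integral>y. (indicator {y. \<epsilon> < norm y} y *\<^sub>R K y) * f x \<partial>lebesgue) = (\<integral>y. indicator {y. \<epsilon> < norm y} y *\<^sub>R K y \<partial>lebesgue) * f x"
      by (rule integral_mult_left_zero)
    finally show ?thesis by (simp add: K0)
  qed
  have "((\<lambda>\<epsilon>. T_truncated \<Omega> \<alpha> \<epsilon> f x) \<longlongrightarrow> (\<integral>y. F y \<partial>lebesgue)) (at_right 0)"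
    unfolding filterlim_at_right_to_top
  proof (rule Lim_transform_eventually)
    show "((\<lambda>t. \<integral>y. indicator {y. inverse t < norm y} y *\<^sub>R F y \<partial>lebesgue) \<longlongrightarrow> (\<integral>y. F y \<partial>lebesgue)) at_top"
    proof (rule integral_dominated_convergence_at_top[where w = "\<lambda>y. norm (F y)"])
      show "(\<lambda>y. indicator {y. inverse t < norm y} y *\<^sub>R F y) \<in> borel_measurable lebesgue" for t
        by (intro borel_measurable_scaleR borel_measurable_indicator outside) measurable
      show "\<forall>\<^sub>F t in at_top. AE y in lebesgue. norm (indicator {y. inverse t < norm y} y *\<^sub>R F y) \<le> norm (F y)"
        by (intro always_eventually allI AE_I2) (auto simp: indicator_def)
      show "AE y in lebesgue. ((\<lambda>t. indicator {y. inverse t < norm y} y *\<^sub>R F y) \<longlongrightarrow> F y) at_top"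
      proof (intro AE_I2)
        fix y :: "real ^ 'n"
        show "((\<lambda>t. indicator {y. inverse t < norm y} y *\<^sub>R F y) \<longlongrightarrow> F y) at_top"
        proof (cases "y = 0")
          case True
          then have "F y = 0" by (simp add: F_def K_def k_def)
          then show ?thesis by simp
        next
          case False
          have "(inverse \<longlongrightarrow> (0::real)) at_top" by (rule tendsto_inverse_0_at_top) (rule filterlim_ident)
          then have "\<forall>\<^sub>F t in at_top. inverse t < norm y" using False by (intro order_tendstoD(2)) auto
          then have "\<forall>\<^sub>F t in at_top. F y = indicator {y. inverse t < norm y} y *\<^sub>R F y"
            by eventually_elim simp
          then show ?thesis by (rule Lim_transform_eventually[OF tendsto_const])
        qed
      qed
    qed (use F_int in auto)
    show "\<forall>\<^sub>F t in at_top. (\<integral>y. indicator {y. inverse t < norm y} y *\<^sub>R F y \<partial>lebesgue) = T_truncated \<Omega> \<alpha> (inverse t) f x"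
      using eventually_gt_at_top[of "0::real"] by eventually_elim (simp add: trunc)
  qed
  then have "T_op \<Omega> \<alpha> f x = (\<integral>y. F y \<partial>lebesgue)"
    unfolding T_op_def by (intro tendsto_Lim) auto
  then have "ennreal (cmod (T_op \<Omega> \<alpha> f x)) \<le> (\<integral>\<^sup>+y. ennreal (norm (F y)) \<partial>lebesgue)"
    using integral_norm_bound_ennreal[OF F_int] by simp
  also have "\<dots> = (\<integral>\<^sup>+y. ennreal (cmod (\<Omega> (radial_projection y))) * ennreal (norm y powr (\<alpha> - 1 - real DIM(real ^ 'n)) * cmod (f (x - y) - f x)) \<partial>lborel)"
    unfolding nn_integral_completion
    by (intro nn_integral_cong) (simp add: F_def norm_mult normK W_def k_def n_def d_def ennreal_mult mult_ac)
  finally show ?thesis .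
qed

text \<open>
  Morrey's inequality bounds the difference by a radial function of \<open>y\<close>, so that the integral of \<open>\<bar>\<Omega>\<bar>\<close>
  over the sphere splits off as a constant factor.
\<close>

lemma T_op_le_ball_potential:
  fixes \<Omega> :: "real ^ 'n \<Rightarrow> complex" and \<alpha> s :: real
  assumes \<alpha>: "0 < \<alpha>" "\<alpha> < 1" and s: "real CARD('n) < s"
    and \<Omega>: "\<Omega> \<in> borel_measurable surface_measure" "(\<integral>\<^sup>+x. ennreal (cmod (\<Omega> x)) \<partial>surface_measure) \<noteq> top"
      "(\<integral>x. \<Omega> x \<partial>surface_measure) = 0"
  obtains C where "0 < C" "\<And>f x. f \<in> Cc_infinity \<Longrightarrow>
    ennreal (cmod (T_op \<Omega> \<alpha> f x)) \<le> ennreal C * ball_potential \<alpha> s (\<lambda>z. ennreal (norm (gradient f z))) x"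
proof -
  define n where "n = real DIM(real ^ 'n)"
  obtain c where c: "0 < c" "\<And>\<phi>. \<phi> \<in> borel_measurable borel \<Longrightarrow>
      (\<integral>\<^sup>+y. ennreal (cmod (\<Omega> (radial_projection y))) * \<phi> (norm y) \<partial>lborel)
      \<le> ennreal c * (\<integral>\<^sup>+(y::real ^ 'n). \<phi> (norm y) \<partial>lborel)"
    by (rule angular_radial_le[OF \<Omega>(1,2)]) (rule that)
  have s': "real DIM(real ^ 'n) < s" using s by simp
  obtain m where m: "0 < m" "\<And>(f :: real ^ 'n \<Rightarrow> complex) f' G x y. derivative_dominated f f' G \<Longrightarrow>
      ennreal (norm (f (x - y) - f x)) \<le> ennreal (m * norm y) *
        epow (ennreal (norm y powr - real DIM(real ^ 'n)) * ball_int (\<lambda>z. epow (ennreal (G z)) s) x (2 * norm y)) (1 / s)"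
    by (rule Morrey_inequality[OF s']) (rule that)
  have "ennreal (cmod (T_op \<Omega> \<alpha> f x)) \<le> ennreal (c * m) * ball_potential \<alpha> s (\<lambda>z. ennreal (norm (gradient f z))) x"
    if f: "f \<in> Cc_infinity" for f x
  proof -
    define G where "G z = norm (gradient f z)" for z
    have dom: "derivative_dominated f (\<lambda>x. frechet_derivative f (at x)) G"
      unfolding G_def[abs_def] by (rule derivative_dominated_gradient[OF f])
    then have [measurable]: "G \<in> borel_measurable borel"
      unfolding derivative_dominated_def by (auto intro: borel_measurable_continuous_onI)
    define \<phi> where "\<phi> r = ennreal m * (ennreal (r powr (\<alpha> - n)) *
      epow (ennreal (r powr - n) * ball_int (\<lambda>z. epow (ennreal (G z)) s) x (2 * r)) (1 / s))" for r
    have [measurable]: "\<phi> \<in> borel_measurable borel" unfolding \<phi>_def[abs_def] by measurable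
    have le: "ennreal (norm y powr (\<alpha> - 1 - n) * cmod (f (x - y) - f x)) \<le> \<phi> (norm y)" for y
    proof (cases "y = 0")
      case False
      have "ennreal (norm y powr (\<alpha> - 1 - n) * cmod (f (x - y) - f x))
        \<le> ennreal (norm y powr (\<alpha> - 1 - n)) * (ennreal (m * norm y) *
          epow (ennreal (norm y powr - n) * ball_int (\<lambda>z. epow (ennreal (G z)) s) x (2 * norm y)) (1 / s))"
        using m(2)[OF dom, of x y] by (simp add: ennreal_mult mult_left_mono n_def)
      also have "\<dots> = ennreal (m * (norm y powr (\<alpha> - 1 - n) * norm y powr 1)) *
          epow (ennreal (norm y powr - n) * ball_int (\<lambda>z. epow (ennreal (G z)) s) x (2 * norm y)) (1 / s)"
        using m False by (simp add: ennreal_mult mult_ac)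
      also have "norm y powr (\<alpha> - 1 - n) * norm y powr 1 = norm y powr (\<alpha> - n)"
        unfolding powr_add[symmetric] by (simp add: algebra_simps)
      finally show ?thesis using m by (simp add: \<phi>_def ennreal_mult mult.assoc)
    qed simp
    have "ennreal (cmod (T_op \<Omega> \<alpha> f x)) \<le> (\<integral>\<^sup>+y. ennreal (cmod (\<Omega> (radial_projection y))) *
        ennreal (norm y powr (\<alpha> - 1 - n) * cmod (f (x - y) - f x)) \<partial>lborel)"
      unfolding n_def by (rule T_op_le_difference_integral[OF \<alpha> \<Omega> f])
    also have "\<dots> \<le> (\<integral>\<^sup>+y. ennreal (cmod (\<Omega> (radial_projection y))) * \<phi> (norm y) \<partial>lborel)"
      by (intro nn_integral_mono mult_left_mono le) simp
    also have "\<dots> \<le> ennreal c * (\<integral>\<^sup>+(y::real ^ 'n). \<phi> (norm y) \<partial>lborel)"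
      by (rule c(2)) measurable
    also have "(\<integral>\<^sup>+(y::real ^ 'n). \<phi> (norm y) \<partial>lborel) = ennreal m * ball_potential \<alpha> s (\<lambda>z. ennreal (G z)) x"
      unfolding \<phi>_def ball_potential_def n_def by (rule nn_integral_cmult) measurable
    finally show ?thesis using c m by (simp add: ennreal_mult mult.assoc G_def)
  qed
  moreover have "0 < c * m" using c m by simp
  ultimately show ?thesis using that by blast
qed

lemma weighted_Lp_norm_eq_epow:
  "weighted_Lp_norm p l g = epow (\<integral>\<^sup>+x. epow (ennreal (norm x powr l) * ennreal (norm (g x))) p \<partial>lborel) (1 / p)"
proof -
  have "(\<integral>\<^sup>+x. ennreal ((norm x powr l * norm (g x)) powr p) \<partial>lebesgue)
      = (\<integral>\<^sup>+x. epow (ennreal (norm x powr l) * ennreal (norm (g x))) p \<partial>lborel)"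
    unfolding nn_integral_completion by (intro nn_integral_cong) (simp add: ennreal_mult[symmetric] epow_ennreal)
  then show ?thesis by (simp add: weighted_Lp_norm_def epow_def Let_def)
qed

theorem theorem1p9:
  fixes \<Omega> :: "real ^ 'n \<Rightarrow> complex" and \<alpha> p q l n :: real
  assumes "n = real CARD('n)"
    and "0 < \<alpha>" and "\<alpha> < 1"
    and "\<Omega> \<in> L_log_L_sphere (1 - 1 / n)"
    and "(\<integral>x. \<Omega> x \<partial>surface_measure) = 0"
    and "n < p" and "p < n / \<alpha>"
    and "1 / q = 1 / p - \<alpha> / n"
    and "\<alpha> - n / p < l" and "l < 1 - n / p"
  shows "\<exists>C::real. \<forall>f\<in>Cc_infinity.
           weighted_Lp_norm q l (T_op \<Omega> \<alpha> f) \<le> ennreal C * weighted_Lp_norm p l (gradient f)"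
proof -
  have n: "1 \<le> n" unfolding assms(1) by (simp add: Suc_leI)
  have p: "1 < p" "0 < p" using n assms(6) by simp_all
  have \<Omega>: "\<Omega> \<in> borel_measurable surface_measure" "(\<integral>\<^sup>+x. ennreal (cmod (\<Omega> x)) \<partial>surface_measure) \<noteq> top"
    using n by (intro L_log_L_sphere_integrable[OF assms(4)]; simp)+
  \<comment> \<open>The exponent \<open>s = n / \<theta>\<close> has to lie strictly between \<open>n\<close> and \<open>p\<close>, and so close to \<open>n\<close> that still \<open>l < n / s - n / p\<close>.\<close>
  define \<theta> where "\<theta> = (max l 0 + n / p + 1) / 2"
  have np: "0 < n / p" "n / p < 1" using n p assms(6) by simp_all
  have \<theta>: "0 < \<theta>" "\<theta> < 1" "n / p < \<theta>" "l < \<theta> - n / p"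
    using np assms(10) unfolding \<theta>_def max_def by argo+
  define s where "s = n / \<theta>"
  have s: "n < s" "s < p" "0 < s" "n / s = \<theta>"
    using \<theta> n p by (auto simp: s_def field_simps)
  have \<alpha>p: "\<alpha> < n / p" using assms(2,7) p by (simp add: field_simps)
  have nq: "n / q = n / p - \<alpha>"
  proof -
    have "n * (1 / q) = n * (1 / p - \<alpha> / n)" using assms(8) by simp
    then show ?thesis using n by (simp add: right_diff_distrib)
  qed
  then have "0 < n / q" using \<alpha>p by simp
  then have q: "0 < q" using n by (simp add: zero_less_divide_iff)
  have n': "n = real DIM(real ^ 'n)" by (simp add: assms(1))
  obtain c where c: "0 < c"
    "\<And>g :: real ^ 'n \<Rightarrow> ennreal. g \<in> borel_measurable borel \<Longrightarrow>
      (\<integral>\<^sup>+x. epow (ennreal (norm x powr l) * ball_potential \<alpha> s g x) q \<partial>lborel)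
      \<le> ennreal c * epow (\<integral>\<^sup>+z. epow (ennreal (norm z powr l) * g z) p \<partial>lborel) (q / p)"
  proof (rule weighted_ball_potential_bound[where 'a = "real ^ 'n" and \<alpha> = \<alpha> and s = s and p = p and q = q and l = l])
    show "\<alpha> < real DIM(real ^ 'n) / p" "1 / q = 1 / p - \<alpha> / real DIM(real ^ 'n)"
      "- (real DIM(real ^ 'n) / q) < l" "l < real DIM(real ^ 'n) / s - real DIM(real ^ 'n) / p"
      unfolding n'[symmetric] using \<alpha>p assms(8,9) nq s \<theta> by simp_all
  qed (use assms(2) s p that in auto)
  have "real CARD('n) < s" using s by (simp add: assms(1))
  then obtain C where C: "0 < C" "\<And>f x. f \<in> Cc_infinity \<Longrightarrow>
      ennreal (cmod (T_op \<Omega> \<alpha> f x)) \<le> ennreal C * ball_potential \<alpha> s (\<lambda>z. ennreal (norm (gradient f z))) x"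
    by (rule T_op_le_ball_potential[OF assms(2,3) _ \<Omega> assms(5)]) (rule that)
  have "weighted_Lp_norm q l (T_op \<Omega> \<alpha> f) \<le> ennreal ((C powr q * c) powr (1 / q)) * weighted_Lp_norm p l (gradient f)"
    if f: "f \<in> Cc_infinity" for f
  proof -
    define g where "g z = ennreal (norm (gradient f z))" for z
    have "continuous_on UNIV (\<lambda>z. norm (gradient f z))"
      using derivative_dominated_gradient[OF f] by (simp add: derivative_dominated_def)
    then have "(\<lambda>z. norm (gradient f z)) \<in> borel_measurable borel"
      by (rule borel_measurable_continuous_onI)
    then have g[measurable]: "g \<in> borel_measurable borel" unfolding g_def[abs_def] by measurable
    define P where "P = (\<integral>\<^sup>+z. epow (ennreal (norm z powr l) * g z) p \<partial>lborel)"
    have "(\<integral>\<^sup>+x. epow (ennreal (norm x powr l) * ennreal (norm (T_op \<Omega> \<alpha> f x))) q \<partial>lborel)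
      \<le> (\<integral>\<^sup>+x. ennreal (C powr q) * epow (ennreal (norm x powr l) * ball_potential \<alpha> s g x) q \<partial>lborel)"
    proof (intro nn_integral_mono)
      fix x :: "real ^ 'n"
      have "epow (ennreal (norm x powr l) * ennreal (norm (T_op \<Omega> \<alpha> f x))) q
        \<le> epow (ennreal (norm x powr l) * (ennreal C * ball_potential \<alpha> s g x)) q"
        using C(2)[OF f, of x] q unfolding g_def by (intro epow_mono mult_left_mono) auto
      also have "\<dots> = ennreal (C powr q) * epow (ennreal (norm x powr l) * ball_potential \<alpha> s g x) q"
        using C(1) by (simp add: epow_mult epow_ennreal mult_ac)
      finally show "epow (ennreal (norm x powr l) * ennreal (norm (T_op \<Omega> \<alpha> f x))) q
        \<le> ennreal (C powr q) * epow (ennreal (norm x powr l) * ball_potential \<alpha> s g x) q" .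
    qed
    also have "\<dots> = ennreal (C powr q) * (\<integral>\<^sup>+x. epow (ennreal (norm x powr l) * ball_potential \<alpha> s g x) q \<partial>lborel)"
      by (rule nn_integral_cmult) measurable
    also have "\<dots> \<le> ennreal (C powr q) * (ennreal c * epow P (q / p))"
      unfolding P_def by (intro mult_left_mono c(2) g) simp
    finally have "weighted_Lp_norm q l (T_op \<Omega> \<alpha> f) \<le> epow (ennreal (C powr q) * (ennreal c * epow P (q / p))) (1 / q)"
      unfolding weighted_Lp_norm_eq_epow using q by (intro epow_mono) auto
    also have "\<dots> = epow (ennreal (C powr q * c)) (1 / q) * epow P (1 / p)"
      using c q by (simp add: ennreal_mult epow_mult epow_epow mult.assoc)
    also have "epow (ennreal (C powr q * c)) (1 / q) = ennreal ((C powr q * c) powr (1 / q))"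
      using c by (intro epow_ennreal) simp
    also have "epow P (1 / p) = weighted_Lp_norm p l (gradient f)"
      unfolding weighted_Lp_norm_eq_epow P_def g_def ..
    finally show ?thesis .
  qed
  then show ?thesis by blast
qed

end
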